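(* Let $\mathbb{G}$ be a homogeneous group of homogeneous dimension $Q\geq 2$, let $|\cdot|$ be a homogeneous quasi-norm on $\mathbb{G}$, and let $1<p<\infty$. Then for every $f\in C_{0}^{\infty}(\mathbb{G}\setminus\{0\})$, $$\sup_{R>0}\left\|\frac{f-f_{R}}{|x|^{\frac{Q}{p}}\log\frac{R}{|x|}}\right\|_{L^{p}(\mathbb{G})}\leq \frac{p}{p-1}\left\|\frac{1}{|x|^{\frac{Q}{p}-1}}\,\mathcal{R}f\right\|_{L^{p}(\mathbb{G})},$$ where $f_{R}(x)=f\left(R\frac{x}{|x|}\right)$. Moreover, the constant $\frac{p}{p-1}$ is optimal (it cannot be replaced by a smaller constant valid for all such $f$).
   Context: A homogeneous group $\mathbb{G}$ is a connected simply connected Lie group whose Lie algebra $\mathfrak{g}$ is equipped with a family of dilations $D_{\lambda}=\mathrm{Exp}(A\ln\lambda)=\sum_{k\ge 0}\frac{1}{k!}(\ln(\lambda)A)^{k}$, $\lambda>0$, where $A$ is a diagonalisable linear operator on $\mathfrak{g}$ with positive eigenvalues and each $D_{\lambda}$ is a Lie algebra morphism. Such a group is nilpotent, the exponential map $\mathfrak{g}\to\mathbb{G}$ is a global diffeomorphism, and the dilations are transported to $\mathbb{G}$ via it; write $\lambda x:=D_{\lambda}x$ for $x\in\mathbb{G}$. The unit element of $\mathbb{G}$ is denoted $0$. The homogeneous dimension is $Q=\mathrm{Tr}\,A$, and $dx$ denotes Haar measure; $L^p(\mathbb{G})$ is taken with respect to $dx$. A homogeneous quasi-norm is a continuous function $|\cdot|:\mathbb{G}\to[0,\infty)$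 with $|x^{-1}|=|x|$, $|\lambda x|=\lambda|x|$ for all $x\in\mathbb{G}$, $\lambda>0$, and $|x|=0$ if and only if $x=0$. For $x\neq 0$ and $R>0$, $R\frac{x}{|x|}$ denotes $D_{R/|x|}x$. The radial operator $\mathcal{R}=\frac{d}{d|x|}$ is defined by $\mathcal{R}f(x)=\frac{d}{dr}f(D_{r}y)\big|_{r=|x|}$, where $y=D_{1/|x|}x$ (so $|y|=1$). Functions are complex-valued; $C_0^\infty(\mathbb{G}\setminus\{0\})$ denotes smooth functions with compact support in $\mathbb{G}\setminus\{0\}$. *)

theory Defs
  imports "HOL-Analysis.Analysis"
begin

section \<open>Smooth maps\<close>

text \<open>
  Only used for open sets \<open>S\<close> in finite-dimensional spaces: all iterated directional derivatives
  of order at most \<open>k\<close> exist and are continuous.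
\<close>

primrec Ck_on :: "nat \<Rightarrow> 'a::real_normed_vector set \<Rightarrow> ('a \<Rightarrow> 'b::real_normed_vector) \<Rightarrow> bool" where
  "Ck_on 0 S f \<longleftrightarrow> continuous_on S f"
| "Ck_on (Suc k) S f \<longleftrightarrow>
     (\<forall>x\<in>S. f differentiable (at x)) \<and>
     (\<forall>v. Ck_on k S (\<lambda>x. frechet_derivative f (at x) v))"

definition smooth_on :: "'a::real_normed_vector set \<Rightarrow> ('a \<Rightarrow> 'b::real_normed_vector) \<Rightarrow> bool" where
  "smooth_on S f \<longleftrightarrow> (\<forall>k. Ck_on k S f)"


section \<open>Lie groups\<close>

text \<open>
  A group is a type of class \<open>topological_group_add\<close>; it is written additively but need not be
  commutative, so the product of \<open>x\<close> and \<open>y\<close> is \<open>x + y\<close>, the inverse is \<open>- x\<close> and the unit is \<open>0\<close>.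
  A chart is a pair of an open set \<open>U\<close> and a map \<open>\<phi>\<close>, only relevant on \<open>U\<close>, with values in a
  Euclidean space.
\<close>

type_synonym ('g, 'a) atlas = "('g set \<times> ('g \<Rightarrow> 'a)) set"

definition smooth_atlas :: "('g::topological_space, 'a::euclidean_space) atlas \<Rightarrow> bool" where
  "smooth_atlas \<A> \<longleftrightarrow>
     (\<Union>(U, \<phi>)\<in>\<A>. U) = UNIV \<and>
     (\<forall>(U, \<phi>)\<in>\<A>. open U \<and> open (\<phi> ` U) \<and> homeomorphism U (\<phi> ` U) \<phi> (inv_into U \<phi>)) \<and>
     (\<forall>(U, \<phi>)\<in>\<A>. \<forall>(V, \<psi>)\<in>\<A>. smooth_on (\<phi> ` (U \<inter> V)) (\<psi> \<circ> inv_into U \<phi>))"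

definition lie_group ::
  "('g::{topological_group_add, t2_space, second_countable_topology}, 'a::euclidean_space) atlas \<Rightarrow> bool" where
  "lie_group \<A> \<longleftrightarrow>
     smooth_atlas \<A> \<and>
     (\<forall>(U, \<phi>)\<in>\<A>. \<forall>(V, \<psi>)\<in>\<A>. \<forall>(W, \<theta>)\<in>\<A>.
        smooth_on {(\<phi> x, \<psi> y) | x y. x \<in> U \<and> y \<in> V \<and> x + y \<in> W}
          (\<lambda>(a, b). \<theta> (inv_into U \<phi> a + inv_into V \<psi> b))) \<and>
     (\<forall>(U, \<phi>)\<in>\<A>. \<forall>(V, \<psi>)\<in>\<A>.
        smooth_on (\<phi> ` {x\<in>U. - x \<in> V}) (\<lambda>a. \<psi> (- inv_into U \<phi> a)))"

definition smooth_fun ::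
  "('g, 'a::euclidean_space) atlas \<Rightarrow> ('g \<Rightarrow> 'b::real_normed_vector) \<Rightarrow> bool" where
  "smooth_fun \<A> f \<longleftrightarrow> (\<forall>(U, \<phi>)\<in>\<A>. smooth_on (\<phi> ` U) (f \<circ> inv_into U \<phi>))"

text \<open>
  The exponential map \<open>e\<close> of a Lie group for which it is a global diffeomorphism. The
  space \<open>'a\<close> is the Lie algebra, identified with the tangent space at \<open>0\<close> through the derivative
  of \<open>e\<close> at \<open>0\<close>, so that \<open>X\<close> is the initial velocity of the one-parameter subgroup
  \<open>t \<mapsto> e (tX)\<close>. The inner product of \<open>'a\<close> plays no role.
\<close>

definition global_exp ::
  "('g::topological_group_add, 'a::euclidean_space) atlas \<Rightarrow> ('a \<Rightarrow> 'g) \<Rightarrow> bool" where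
  "global_exp \<A> e \<longleftrightarrow>
     (\<forall>X s t. e ((s + t) *\<^sub>R X) = e (s *\<^sub>R X) + e (t *\<^sub>R X)) \<and>
     bij e \<and>
     continuous_on UNIV e \<and>
     (\<forall>(U, \<phi>)\<in>\<A>. smooth_on (e -` U) (\<phi> \<circ> e)) \<and>
     smooth_fun \<A> (inv e)"

text \<open>
  The adjoint action is the derivative at \<open>0\<close> of conjugation, read on the Lie algebra, and the Lie
  bracket is the derivative of the adjoint action.
\<close>

definition Ad :: "('a::euclidean_space \<Rightarrow> 'g::topological_group_add) \<Rightarrow> 'g \<Rightarrow> 'a \<Rightarrow> 'a" where
  "Ad e x Y = vector_derivative (\<lambda>t. inv e (x + e (t *\<^sub>R Y) - x)) (at 0)"

definition lie_bracket ::
  "('a::euclidean_space \<Rightarrow> 'g::topological_group_add) \<Rightarrow> 'a \<Rightarrow> 'a \<Rightarrow> 'a" where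
  "lie_bracket e X Y = vector_derivative (\<lambda>t. Ad e (e (t *\<^sub>R X)) Y) (at 0)"


section \<open>Homogeneous groups\<close>

definition diagonalisable_pos :: "('a::euclidean_space \<Rightarrow> 'a) \<Rightarrow> bool" where
  "diagonalisable_pos A \<longleftrightarrow>
     linear A \<and>
     (\<exists>B. independent B \<and> span B = UNIV \<and> (\<forall>b\<in>B. \<exists>c>0. A b = c *\<^sub>R b))"

definition dilation :: "('a::euclidean_space \<Rightarrow> 'a) \<Rightarrow> real \<Rightarrow> 'a \<Rightarrow> 'a" where
  "dilation A r X = (\<Sum>k. (1 / fact k) *\<^sub>R ((\<lambda>Y. ln r *\<^sub>R A Y) ^^ k) X)"

text \<open>
  For a connected simply connected Lie group with such dilations the exponential map always is a
  global diffeomorphism. This classical fact is recorded in the structure, because it is what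
  transports the dilations from the Lie algebra to the group.
\<close>

definition homogeneous_group ::
  "('g::{topological_group_add, t2_space, second_countable_topology}, 'a::euclidean_space) atlas
     \<Rightarrow> ('a \<Rightarrow> 'g) \<Rightarrow> ('a \<Rightarrow> 'a) \<Rightarrow> bool" where
  "homogeneous_group \<A> e A \<longleftrightarrow>
     lie_group \<A> \<and>
     connected (UNIV :: 'g set) \<and>
     simply_connected (UNIV :: 'g set) \<and>
     global_exp \<A> e \<and>
     diagonalisable_pos A \<and>
     (\<forall>r>0. linear (dilation A r) \<and>
        (\<forall>X Y. dilation A r (lie_bracket e X Y) =
               lie_bracket e (dilation A r X) (dilation A r Y)))"

definition group_dilation ::
  "('a::euclidean_space \<Rightarrow> 'g) \<Rightarrow> ('a \<Rightarrow> 'a) \<Rightarrow> real \<Rightarrow> 'g \<Rightarrow> 'g" where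
  "group_dilation e A r x = e (dilation A r (inv e x))"

definition homogeneous_dimension :: "('a::euclidean_space \<Rightarrow> 'a) \<Rightarrow> real" where
  "homogeneous_dimension A = (\<Sum>b\<in>Basis. A b \<bullet> b)"

text \<open>The Haar measure is left-invariant; on these groups it is bi-invariant.\<close>

definition haar_measure :: "'g::topological_group_add measure \<Rightarrow> bool" where
  "haar_measure \<mu> \<longleftrightarrow>
     sets \<mu> = sets borel \<and>
     (\<forall>x. distr \<mu> borel (\<lambda>y. x + y) = \<mu>) \<and>
     (\<forall>K. compact K \<longrightarrow> emeasure \<mu> K < \<infinity>) \<and>
     emeasure \<mu> UNIV \<noteq> 0"

definition homogeneous_quasi_norm ::
  "('a::euclidean_space \<Rightarrow> 'g::topological_group_add) \<Rightarrow> ('a \<Rightarrow> 'a) \<Rightarrow> ('g \<Rightarrow> real) \<Rightarrow> bool" where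
  "homogeneous_quasi_norm e A N \<longleftrightarrow>
     continuous_on UNIV N \<and>
     (\<forall>x. 0 \<le> N x) \<and>
     (\<forall>x. N (- x) = N x) \<and>
     (\<forall>x. \<forall>r>0. N (group_dilation e A r x) = r * N x) \<and>
     (\<forall>x. N x = 0 \<longleftrightarrow> x = 0)"


section \<open>Functions on homogeneous groups\<close>

definition test_function_off_0 ::
  "('g::topological_group_add, 'a::euclidean_space) atlas \<Rightarrow> ('g \<Rightarrow> complex) \<Rightarrow> bool" where
  "test_function_off_0 \<A> f \<longleftrightarrow>
     smooth_fun \<A> f \<and> compact (closure {x. f x \<noteq> 0}) \<and> 0 \<notin> closure {x. f x \<noteq> 0}"

text \<open>
  The next two operators are meaningful for \<open>x \<noteq> 0\<close> only; their values at \<open>0\<close>, a null set, are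
  irrelevant.
\<close>

definition radial_derivative ::
  "('a::euclidean_space \<Rightarrow> 'g) \<Rightarrow> ('a \<Rightarrow> 'a) \<Rightarrow> ('g \<Rightarrow> real) \<Rightarrow> ('g \<Rightarrow> complex) \<Rightarrow> 'g \<Rightarrow> complex" where
  "radial_derivative e A N f x =
     vector_derivative (\<lambda>r. f (group_dilation e A r (group_dilation e A (1 / N x) x))) (at (N x))"

definition sphere_value ::
  "('a::euclidean_space \<Rightarrow> 'g) \<Rightarrow> ('a \<Rightarrow> 'a) \<Rightarrow> ('g \<Rightarrow> real) \<Rightarrow> real \<Rightarrow> ('g \<Rightarrow> complex) \<Rightarrow> 'g \<Rightarrow> complex" where
  "sphere_value e A N R f x = f (group_dilation e A (R / N x) x)"

definition Lp_norm :: "'g measure \<Rightarrow> real \<Rightarrow> ('g \<Rightarrow> complex) \<Rightarrow> ennreal" where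
  "Lp_norm \<mu> p u =
     (let I = (\<integral>\<^sup>+x. ennreal (norm (u x) powr p) \<partial>\<mu>)
      in if I = \<infinity> then \<infinity> else ennreal (enn2real I powr (1 / p)))"

text \<open>
  On the null set where the quasi-norm of \<open>x\<close> is \<open>R\<close> the quotient has the form \<open>0/0\<close>, and it is
  \<open>0\<close> by the library's convention for division.
\<close>

definition hardy_lhs ::
  "('a::euclidean_space \<Rightarrow> 'g) \<Rightarrow> ('a \<Rightarrow> 'a) \<Rightarrow> ('g \<Rightarrow> real) \<Rightarrow> 'g measure \<Rightarrow> real \<Rightarrow> ('g \<Rightarrow> complex) \<Rightarrow> ennreal" where
  "hardy_lhs e A N \<mu> p f =
     (SUP R\<in>{0<..}. Lp_norm \<mu> p (\<lambda>x.
        (f x - sphere_value e A N R f x) /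
        of_real (N x powr (homogeneous_dimension A / p) * ln (R / N x))))"

definition hardy_rhs ::
  "('a::euclidean_space \<Rightarrow> 'g) \<Rightarrow> ('a \<Rightarrow> 'a) \<Rightarrow> ('g \<Rightarrow> real) \<Rightarrow> 'g measure \<Rightarrow> real \<Rightarrow> ('g \<Rightarrow> complex) \<Rightarrow> ennreal" where
  "hardy_rhs e A N \<mu> p f =
     Lp_norm \<mu> p (\<lambda>x.
       of_real (1 / N x powr (homogeneous_dimension A / p - 1)) * radial_derivative e A N f x)"

end

theory Submission
  imports Defs
begin

text \<open>
  In exponential coordinates the Haar measure is Lebesgue measure: writing \<open>m\<close> for the product, the
  derivative of \<open>y \<mapsto> m (- x) y\<close> at \<open>x\<close> is obtained from the adjoint action by integration along the
  one-parameter subgroup through \<open>x\<close>, hence is conjugated by every dilation; its determinant is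
  therefore constant along the curve \<open>D r x \<rightarrow> 0\<close>, and equals \<open>1\<close>. So left and right translations
  preserve Lebesgue measure, which dilations scale by \<open>r powr Tr A\<close>. The measure
  \<open>dx / N x powr Q\<close> is then dilation invariant, and averaging over orbits reduces the inequality to
  Hardy's inequality on the line in the variable \<open>t = ln (N x)\<close>. For sharpness, the almost extremal
  functions of the one-dimensional inequality are transplanted by means of a smooth logarithmic
  radius on a half space, which differs from \<open>ln (N x)\<close> by a bounded function; the
  bounded error disappears on long logarithmic scales.
\<close>


section \<open>Calculus of smooth maps\<close>

text \<open>Along an orbit put \<open>F t = f (D (exp t) x)\<close> and
  \<open>T = ln (R / N x)\<close>. Then \<open>N x\<close> times the radial derivative becomes
  \<open>F'\<close>, the subtracted function \<open>f_R\<close> becomes the constant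
  \<open>F T\<close>, and the logarithm becomes \<open>T - t\<close>. Hence the supremum over
  \<open>R\<close> costs nothing: on the two rays starting at \<open>T\<close>, Hardy's inequality
  has the constant \<open>p / (p - 1)\<close> whatever \<open>T\<close> is. Two obstacles shape the
  rest. The dilations are assumed to be automorphisms of the Lie algebra only, so nothing is known
  at first about their effect on the product; compatibility with its derivative is obtained by
  showing that suitable curves in \<open>t\<close> have derivative \<open>0\<close>. And the
  quasi-norm is merely continuous, so it yields neither a smooth sphere nor smooth radial test
  functions. The test functions therefore live in a dilation invariant cone, where a single small
  \<open>R\<close> already annihilates \<open>f_R\<close> and makes the left side explicit.\<close>

lemma Ck_on_SucD:
  assumes "Ck_on (Suc n) S f" "x \<in> S"
  shows "(f has_derivative frechet_derivative f (at x)) (at x)"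
  using assms frechet_derivative_works by auto

lemma Ck_on_cong:
  assumes "open S" "\<And>x. x \<in> S \<Longrightarrow> f x = g x" "Ck_on n S f"
  shows "Ck_on n S g"
  using assms(2,3)
proof (induction n arbitrary: f g)
  case 0
  then show ?case by (metis Ck_on.simps(1) continuous_on_cong)
next
  case (Suc n)
  have der: "(g has_derivative frechet_derivative f (at x)) (at x)" if "x \<in> S" for x
    using has_derivative_transform_within_open[OF Ck_on_SucD[OF Suc.prems(2) that] \<open>open S\<close> that]
      Suc.prems(1) by blast
  show ?case
    unfolding Ck_on.simps(2)
  proof (intro conjI ballI allI)
    show "g differentiable at x" if "x \<in> S" for x
      using der[OF that] by (auto simp: differentiable_def)
    show "Ck_on n S (\<lambda>x. frechet_derivative g (at x) v)" for v
    proof (rule Suc.IH)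
      show "Ck_on n S (\<lambda>x. frechet_derivative f (at x) v)" using Suc.prems(2) by simp
    qed (simp add: frechet_derivative_at[OF der])
  qed
qed

lemma Ck_on_SucI:
  assumes "open S" "\<And>x. x \<in> S \<Longrightarrow> (f has_derivative f' x) (at x)"
    and "\<And>v. Ck_on n S (\<lambda>x. f' x v)"
  shows "Ck_on (Suc n) S f"
  unfolding Ck_on.simps(2)
proof (intro conjI ballI allI)
  show "f differentiable at x" if "x \<in> S" for x
    using assms(2)[OF that] by (auto simp: differentiable_def)
  show "Ck_on n S (\<lambda>x. frechet_derivative f (at x) v)" for v
    by (rule Ck_on_cong[OF assms(1) _ assms(3)[of v]]) (simp add: frechet_derivative_at[OF assms(2)])
qed

lemma Ck_on_lower: "Ck_on (Suc n) S f \<Longrightarrow> Ck_on n S f"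
proof (induction n arbitrary: f)
  case 0
  then show ?case
    by (auto intro!: differentiable_imp_continuous_on differentiable_at_imp_differentiable_on)
next
  case (Suc n)
  from Suc.prems have "\<forall>v. Ck_on (Suc n) S (\<lambda>x. frechet_derivative f (at x) v)" by simp
  with Suc.IH have "\<forall>v. Ck_on n S (\<lambda>x. frechet_derivative f (at x) v)" by blast
  with Suc.prems show ?case by auto
qed

lemma Ck_on_Un:
  assumes "open S" "open T" "Ck_on n S f" "Ck_on n T f"
  shows "Ck_on n (S \<union> T) f"
  using assms(3,4) by (induction n arbitrary: f) (auto intro: continuous_on_open_Un assms)

lemma Ck_on_const: "open S \<Longrightarrow> Ck_on n S (\<lambda>x. c)"
proof (induction n arbitrary: c)
  case (Suc n)
  show ?case by (rule Ck_on_SucI[where f' = "\<lambda>_ _. 0"]) (use Suc in auto)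
qed auto

lemma Ck_on_bounded_linear:
  assumes "open S" "bounded_linear L"
  shows "Ck_on n S L"
proof (cases n)
  case 0
  then show ?thesis using assms by (simp add: linear_continuous_on)
next
  case (Suc m)
  show ?thesis unfolding Suc
    by (rule Ck_on_SucI[where f' = "\<lambda>_. L"])
      (use assms in \<open>auto intro: bounded_linear_imp_has_derivative Ck_on_const\<close>)
qed

lemma Ck_on_add:
  assumes "open S" "Ck_on n S f" "Ck_on n S g"
  shows "Ck_on n S (\<lambda>x. f x + g x)"
  using assms(2,3)
proof (induction n arbitrary: f g)
  case (Suc n)
  show ?case
  proof (rule Ck_on_SucI[OF \<open>open S\<close>])
    show "((\<lambda>x. f x + g x) has_derivative
        (\<lambda>v. frechet_derivative f (at x) v + frechet_derivative g (at x) v)) (at x)" if "x \<in> S" for x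
      using Ck_on_SucD[OF Suc.prems(1) that] Ck_on_SucD[OF Suc.prems(2) that]
      by (rule has_derivative_add)
    show "Ck_on n S (\<lambda>x. frechet_derivative f (at x) v + frechet_derivative g (at x) v)" for v
      using Suc by simp
  qed
qed (auto intro: continuous_on_add)

lemma Ck_on_bilinear:
  assumes "open S" "bounded_bilinear B" "Ck_on n S f" "Ck_on n S g"
  shows "Ck_on n S (\<lambda>x. B (f x) (g x))"
  using assms(3,4)
proof (induction n arbitrary: f g)
  case 0
  then show ?case by (auto intro: bounded_bilinear.continuous_on[OF assms(2)])
next
  case (Suc n)
  show ?case
  proof (rule Ck_on_SucI[OF \<open>open S\<close>])
    show "((\<lambda>x. B (f x) (g x)) has_derivative (\<lambda>v. B (f x) (frechet_derivative g (at x) v)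
        + B (frechet_derivative f (at x) v) (g x))) (at x)" if "x \<in> S" for x
      by (rule bounded_bilinear.FDERIV[OF assms(2) Ck_on_SucD[OF Suc.prems(1) that]
            Ck_on_SucD[OF Suc.prems(2) that]])
    show "Ck_on n S (\<lambda>x. B (f x) (frechet_derivative g (at x) v)
        + B (frechet_derivative f (at x) v) (g x))" for v
    proof (rule Ck_on_add[OF \<open>open S\<close>]; rule Suc.IH)
      show "Ck_on n S f" "Ck_on n S g" using Suc.prems Ck_on_lower by blast+
      show "Ck_on n S (\<lambda>x. frechet_derivative f (at x) v)" 
        "Ck_on n S (\<lambda>x. frechet_derivative g (at x) v)" using Suc.prems by auto
    qed
  qed
qed

lemma Ck_on_sum:
  assumes "open S" "finite I" "\<And>i. i \<in> I \<Longrightarrow> Ck_on n S (f i)"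
  shows "Ck_on n S (\<lambda>x. \<Sum>i\<in>I. f i x)"
  using assms(2,3)
  by (induction I rule: finite_induct) (auto intro!: Ck_on_const Ck_on_add \<open>open S\<close>)

lemma linear_eq_sum_Basis:
  fixes f :: "'a::euclidean_space \<Rightarrow> 'b::real_vector"
  assumes "linear f"
  shows "f v = (\<Sum>b\<in>Basis. (v \<bullet> b) *\<^sub>R f b)"
  using linear_sum[OF assms, of "\<lambda>b. (v \<bullet> b) *\<^sub>R b" Basis]
  by (simp add: euclidean_representation linear_scale[OF assms])

lemma Ck_on_bounded_linear_compose:
  assumes "open S" "bounded_linear L" "Ck_on n S f"
  shows "Ck_on n S (\<lambda>x. L (f x))"
  using assms(3)
proof (induction n arbitrary: f)
  case 0
  then show ?case by (auto intro: bounded_linear.continuous_on[OF assms(2)])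
next
  case (Suc n)
  show ?case
    by (rule Ck_on_SucI[OF \<open>open S\<close> bounded_linear.has_derivative[OF assms(2) Ck_on_SucD[OF Suc.prems]]])
      (use Suc in auto)
qed

text \<open>Expanding the derivative of \<open>k\<close> at \<open>h x\<close> over
  \<open>Basis\<close> turns the chain rule into a finite sum of products. The factors involving
  \<open>k\<close> are composites with the same \<open>h\<close>, so the induction varies
  \<open>k\<close> alone.\<close>

lemma Ck_on_compose:
  fixes h :: "'a::real_normed_vector \<Rightarrow> 'b::euclidean_space" and k :: "'b \<Rightarrow> 'c::real_normed_vector"
  assumes "open S" "Ck_on n S h" "Ck_on n T k" "h ` S \<subseteq> T"
  shows "Ck_on n S (\<lambda>x. k (h x))"
  using assms(2,3)
proof (induction n arbitrary: k)
  case 0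
  then show ?case using continuous_on_compose2[OF _ _ assms(4)] by auto
next
  case (Suc n)
  show ?case
  proof (rule Ck_on_SucI[OF \<open>open S\<close>])
    fix x assume "x \<in> S"
    then have k: "(k has_derivative frechet_derivative k (at (h x))) (at (h x))"
      using Ck_on_SucD[OF Suc.prems(2)] assms(4) by blast
    have "((\<lambda>x. k (h x)) has_derivative
        (\<lambda>v. frechet_derivative k (at (h x)) (frechet_derivative h (at x) v))) (at x)"
      using has_derivative_compose[OF Ck_on_SucD[OF Suc.prems(1) \<open>x \<in> S\<close>] k] by (simp add: o_def)
    then show "((\<lambda>x. k (h x)) has_derivative (\<lambda>v. \<Sum>b\<in>Basis.
        (frechet_derivative h (at x) v \<bullet> b) *\<^sub>R frechet_derivative k (at (h x)) b)) (at x)"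
      by (subst (asm) linear_eq_sum_Basis[OF has_derivative_linear[OF k]])
  next
    fix v
    have "Ck_on n S h" using Suc.prems(1) by (rule Ck_on_lower)
    then have "Ck_on n S (\<lambda>x. frechet_derivative k (at (h x)) b)" for b
      using Suc.IH[of "\<lambda>y. frechet_derivative k (at y) b"] Suc.prems by auto
    moreover have "Ck_on n S (\<lambda>x. frechet_derivative h (at x) v \<bullet> b)" for b
      using Suc.prems(1)
      by (intro Ck_on_bounded_linear_compose[OF \<open>open S\<close> bounded_linear_inner_left]) auto
    ultimately show "Ck_on n S (\<lambda>x. \<Sum>b\<in>Basis.
        (frechet_derivative h (at x) v \<bullet> b) *\<^sub>R frechet_derivative k (at (h x)) b)"
      by (intro Ck_on_sum Ck_on_bilinear[OF _ bounded_bilinear_scaleR] \<open>open S\<close>) auto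
  qed
qed

lemma Ck_on_Pair:
  assumes "open S" "Ck_on n S f" "Ck_on n S g"
  shows "Ck_on n S (\<lambda>x. (f x, g x))"
  using Ck_on_add[OF \<open>open S\<close>
      Ck_on_bounded_linear_compose[OF \<open>open S\<close> bounded_linear_Pair[OF bounded_linear_ident bounded_linear_zero] assms(2)]
      Ck_on_bounded_linear_compose[OF \<open>open S\<close> bounded_linear_Pair[OF bounded_linear_zero bounded_linear_ident] assms(3)]]
  by simp

lemma smooth_on_cong: "open S \<Longrightarrow> (\<And>x. x \<in> S \<Longrightarrow> f x = g x) \<Longrightarrow> smooth_on S f \<Longrightarrow> smooth_on S g"
  unfolding smooth_on_def using Ck_on_cong by blast

lemma smooth_on_const: "open S \<Longrightarrow> smooth_on S (\<lambda>x. c)"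
  unfolding smooth_on_def by (auto intro: Ck_on_const)

lemma smooth_on_bounded_linear: "open S \<Longrightarrow> bounded_linear L \<Longrightarrow> smooth_on S L"
  unfolding smooth_on_def by (auto intro: Ck_on_bounded_linear)

lemma smooth_on_Un: "open S \<Longrightarrow> open T \<Longrightarrow> smooth_on S f \<Longrightarrow> smooth_on T f \<Longrightarrow> smooth_on (S \<union> T) f"
  unfolding smooth_on_def by (auto intro: Ck_on_Un)

lemma smooth_on_sum: "open S \<Longrightarrow> finite I \<Longrightarrow> (\<And>i. i \<in> I \<Longrightarrow> smooth_on S (f i)) \<Longrightarrow>
    smooth_on S (\<lambda>x. \<Sum>i\<in>I. f i x)"
  unfolding smooth_on_def by (auto intro: Ck_on_sum)

lemma smooth_on_bilinear: "open S \<Longrightarrow> bounded_bilinear B \<Longrightarrow> smooth_on S f \<Longrightarrow> smooth_on S g \<Longrightarrow>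
    smooth_on S (\<lambda>x. B (f x) (g x))"
  unfolding smooth_on_def by (auto intro: Ck_on_bilinear)

lemma smooth_on_compose:
  fixes h :: "'a::real_normed_vector \<Rightarrow> 'b::euclidean_space"
  shows "open S \<Longrightarrow> smooth_on S h \<Longrightarrow> smooth_on T k \<Longrightarrow> h ` S \<subseteq> T \<Longrightarrow> smooth_on S (\<lambda>x. k (h x))"
  unfolding smooth_on_def by (auto intro: Ck_on_compose)

lemma smooth_on_Pair: "open S \<Longrightarrow> smooth_on S f \<Longrightarrow> smooth_on S g \<Longrightarrow> smooth_on S (\<lambda>x. (f x, g x))"
  unfolding smooth_on_def by (auto intro: Ck_on_Pair)

lemma smooth_on_compose_real:
  fixes h :: "'a::real_normed_vector \<Rightarrow> real" and k :: "real \<Rightarrow> 'b::real_normed_vector"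
  shows "open S \<Longrightarrow> smooth_on S h \<Longrightarrow> smooth_on UNIV k \<Longrightarrow> smooth_on S (\<lambda>x. k (h x))"
  by (rule smooth_on_compose) auto

lemma smooth_on_add: "open S \<Longrightarrow> smooth_on S f \<Longrightarrow> smooth_on S g \<Longrightarrow> smooth_on S (\<lambda>x. f x + g x)"
  unfolding smooth_on_def by (auto intro: Ck_on_add)

lemma smooth_on_bounded_linear_compose:
  "open S \<Longrightarrow> bounded_linear L \<Longrightarrow> smooth_on S f \<Longrightarrow> smooth_on S (\<lambda>x. L (f x))"
  unfolding smooth_on_def by (auto intro: Ck_on_bounded_linear_compose)

lemma smooth_on_diff: "open S \<Longrightarrow> smooth_on S f \<Longrightarrow> smooth_on S g \<Longrightarrow> smooth_on S (\<lambda>x. f x - g x)"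
  using smooth_on_add[OF _ _ smooth_on_bounded_linear_compose[OF _ bounded_linear_minus[OF bounded_linear_ident]]]
  by fastforce

lemma smooth_on_mult:
  fixes f g :: "'a::real_normed_vector \<Rightarrow> real"
  shows "open S \<Longrightarrow> smooth_on S f \<Longrightarrow> smooth_on S g \<Longrightarrow> smooth_on S (\<lambda>x. f x * g x)"
  by (rule smooth_on_bilinear[OF _ bounded_bilinear_mult])

lemma smooth_on_ident: "open S \<Longrightarrow> smooth_on S (\<lambda>x. x)"
  by (rule smooth_on_bounded_linear[OF _ bounded_linear_ident])

lemma smooth_on_has_derivative:
  "smooth_on S f \<Longrightarrow> x \<in> S \<Longrightarrow> (f has_derivative frechet_derivative f (at x)) (at x)"
  unfolding smooth_on_def using Ck_on_SucD by blast

lemma smooth_on_imp_continuous_on: "smooth_on S f \<Longrightarrow> continuous_on S f"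
  unfolding smooth_on_def by (metis Ck_on.simps(1))

lemma smooth_on_frechet_derivative: "smooth_on S f \<Longrightarrow> smooth_on S (\<lambda>x. frechet_derivative f (at x) v)"
  unfolding smooth_on_def by (metis Ck_on.simps(2))

text \<open>Serves to glue statements that are available only chart by chart, near one point at a
  time.\<close>

lemma smooth_on_local:
  assumes "\<And>x. x \<in> S \<Longrightarrow> \<exists>T. open T \<and> x \<in> T \<and> smooth_on T f"
  shows "smooth_on S f"
proof -
  have "Ck_on n S f" if "\<And>x. x \<in> S \<Longrightarrow> \<exists>T. open T \<and> x \<in> T \<and> Ck_on n T f" for n
    using that
  proof (induction n arbitrary: f)
    case 0
    have "continuous (at x within S) f" if x: "x \<in> S" for x
    proof -
      obtain T where T: "open T" "x \<in> T" "continuous_on T f" using 0[OF x] by auto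
      then show ?thesis using continuous_at_imp_continuous_at_within continuous_on_eq_continuous_at by blast
    qed
    then show ?case by (simp add: continuous_on_eq_continuous_within)
  next
    case (Suc n)
    show ?case unfolding Ck_on.simps
    proof (intro conjI ballI allI)
      fix x assume "x \<in> S" then show "f differentiable at x" using Suc.prems by auto
    next
      fix v show "Ck_on n S (\<lambda>x. frechet_derivative f (at x) v)"
        by (rule Suc.IH) (use Suc.prems in force)
    qed
  qed
  then show ?thesis using assms unfolding smooth_on_def by blast
qed

section \<open>Elementary smooth functions on the line\<close>

lemma smooth_on_exp: "smooth_on UNIV (exp :: real \<Rightarrow> real)"
proof -
  have "Ck_on n UNIV (exp :: real \<Rightarrow> real)" for n
  proof (induction n)
    case (Suc n)
    show ?case
    proof (rule Ck_on_SucI[where f' = "\<lambda>x v. v * exp x"])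
      show "Ck_on n UNIV (\<lambda>x. v * exp x)" for v :: real
        by (rule Ck_on_bounded_linear_compose[OF _ bounded_linear_mult_right Suc]) auto
    qed (auto intro!: derivative_eq_intros)
  qed (simp add: continuous_on_exp)
  then show ?thesis by (simp add: smooth_on_def)
qed

lemma smooth_on_ln: "smooth_on {0<..} (ln :: real \<Rightarrow> real)"
proof -
  have inv: "Ck_on n {0<..} (inverse :: real \<Rightarrow> real)" for n
  proof (induction n)
    case 0
    then show ?case by (auto intro!: continuous_intros)
  next
    case (Suc n)
    show ?case
    proof (rule Ck_on_SucI[where f' = "\<lambda>x v. (- v) * (inverse x * inverse x)"])
      show "Ck_on n {0<..} (\<lambda>x. - v * (inverse x * inverse x))" for v :: real
        by (intro Ck_on_bounded_linear_compose[OF _ bounded_linear_mult_right]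
            Ck_on_bilinear[OF _ bounded_bilinear_mult] Suc) auto
    qed (auto intro!: derivative_eq_intros)
  qed
  have "Ck_on n {0<..} (ln :: real \<Rightarrow> real)" for n
  proof (cases n)
    case 0
    then show ?thesis by (auto intro!: continuous_intros)
  next
    case (Suc m)
    show ?thesis unfolding Suc
    proof (rule Ck_on_SucI[where f' = "\<lambda>x v. v * inverse x"])
      show "Ck_on m {0<..} (\<lambda>x. v * inverse x)" for v :: real
        by (intro Ck_on_bounded_linear_compose[OF _ bounded_linear_mult_right] inv) auto
    qed (auto intro!: derivative_eq_intros simp: field_simps)
  qed
  then show ?thesis by (simp add: smooth_on_def)
qed

text \<open>The classical smooth function that is flat at \<open>0\<close>; every cut-off below is
  built from it.\<close>

definition flat_exp :: "real \<Rightarrow> real" where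
  "flat_exp x = (if 0 < x then exp (- (1 / x)) else 0)"

text \<open>In the variable \<open>1 / x\<close> this is exponential decay against a power. It is
  what makes all derivatives match at the seam \<open>0\<close>.\<close>

lemma flat_exp_power_tendsto: "((\<lambda>x. flat_exp x / x ^ n) \<longlongrightarrow> 0) (at (0::real))"
proof -
  have "((\<lambda>y::real. y ^ n / exp y) \<longlongrightarrow> 0) at_top"
    by (rule tendsto_power_div_exp_0)
  from filterlim_compose[OF this filterlim_inverse_at_top_right]
  have r: "((\<lambda>x. inverse x ^ n / exp (inverse x)) \<longlongrightarrow> 0) (at_right (0::real))" .
  have "((\<lambda>x. flat_exp x / x ^ n) \<longlongrightarrow> 0) (at_right 0)"
  proof (rule Lim_transform_eventually[OF r])
    show "\<forall>\<^sub>F x in at_right 0. inverse x ^ n / exp (inverse x) = flat_exp x / x ^ n"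
      unfolding eventually_at_right_field
      by (auto simp: flat_exp_def exp_minus field_simps intro!: exI[of _ 1])
  qed
  moreover have "((\<lambda>x. flat_exp x / x ^ n) \<longlongrightarrow> 0) (at_left 0)"
  proof (rule Lim_transform_eventually[OF tendsto_const])
    show "\<forall>\<^sub>F x in at_left 0. 0 = flat_exp x / x ^ n"
      unfolding eventually_at_left_field
      by (auto simp: flat_exp_def intro!: exI[of _ "-1"])
  qed
  ultimately show ?thesis by (simp add: filterlim_split_at)
qed

text \<open>The functions \<open>x\<^sup>-\<^sup>n flat_exp x\<close> are closed under differentiation up to linear combinations;
  this is what makes the induction go through.\<close>

lemma smooth_on_flat_exp: "smooth_on UNIV flat_exp"
proof -
  define h where "h n x = flat_exp x / x ^ n" for n :: nat and x :: real
  have der: "(h n has_real_derivative (h (n + 2) x - n * h (n + 1) x)) (at x)" for n x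
  proof (cases x "0::real" rule: linorder_cases)
    case less
    have "((\<lambda>x. 0::real) has_real_derivative 0) (at x)" by simp
    then have "(h n has_real_derivative 0) (at x)"
      by (rule DERIV_cong_ev[THEN iffD1, rotated 3, OF _ refl _ refl])
         (use less in \<open>auto simp: h_def flat_exp_def eventually_nhds intro!: exI[of _ "{..<0}"]\<close>)
    then show ?thesis using less by (simp add: h_def flat_exp_def)
  next
    case greater
    have d: "((\<lambda>x. exp (- (1 / x)) / x ^ n) has_real_derivative
       (exp (- (1 / x)) / x ^ (n+2) - n * (exp (- (1 / x)) / x ^ (n+1)))) (at x)"
      
    proof -
      have e: "((\<lambda>x. exp (- (1 / x))) has_real_derivative exp (- (1 / x)) * (1 / x ^ 2)) (at x)"
        using greater by (auto intro!: derivative_eq_intros simp: power2_eq_square)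
      have pw: "real n * x ^ (n - 1) = real n * x ^ n / x"
        using greater by (cases n) auto
      have "((\<lambda>x. exp (- (1 / x)) / x ^ n) has_real_derivative
          (exp (- (1 / x)) * (1 / x ^ 2) * x ^ n - exp (- (1 / x)) * (real n * x ^ n / x)) / (x ^ n * x ^ n)) (at x)"
        by (rule DERIV_divide[OF e DERIV_cong[OF DERIV_pow]]) (use greater pw in simp_all)
      then show ?thesis
        by (rule DERIV_cong) (use greater in \<open>simp add: field_simps power2_eq_square\<close>)
    qed
    have "(h n has_real_derivative
       (exp (- (1 / x)) / x ^ (n+2) - n * (exp (- (1 / x)) / x ^ (n+1)))) (at x)"
      by (rule DERIV_cong_ev[THEN iffD1, rotated 3, OF d refl _ refl])
         (use greater in \<open>auto simp: h_def flat_exp_def eventually_nhds intro!: exI[of _ "{0<..}"]\<close>)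
    then show ?thesis using greater by (simp add: h_def flat_exp_def)
  next
    case equal
    \<comment> \<open>At the seam the difference quotient of \<open>h n\<close> is
      \<open>h (Suc n)\<close>, because \<open>h n 0 = 0\<close>.\<close>
    have "((\<lambda>y. (h n y - h n 0) / (y - 0)) \<longlongrightarrow> 0) (at 0)"
      using flat_exp_power_tendsto[of "Suc n"] by (simp add: h_def flat_exp_def mult.commute)
    then show ?thesis using equal
      by (simp add: has_field_derivative_iff h_def flat_exp_def)
  qed
  have "Ck_on k UNIV (h n)" for k n
  proof (induction k arbitrary: n)
    case 0
    show ?case using der by (auto intro!: DERIV_continuous_on[of UNIV "h n" "\<lambda>x. h (n + 2) x - n * h (n + 1) x"])
  next
    case (Suc k)
    show ?case
    proof (rule Ck_on_SucI[where f' = "\<lambda>x v. v * (h (n + 2) x + (- real n) * h (n + 1) x)"])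
      show "Ck_on k UNIV (\<lambda>x. v * (h (n + 2) x + (- real n) * h (n + 1) x))" for v :: real
        by (intro Ck_on_bounded_linear_compose[OF _ bounded_linear_mult_right] Ck_on_add Suc) auto
      show "(h n has_derivative (\<lambda>v. v * (h (n + 2) x + (- real n) * h (n + 1) x))) (at x)" for x
        using der[of n x] unfolding has_field_derivative_def
        by (rule has_derivative_eq_rhs) (auto simp: fun_eq_iff algebra_simps)
    qed auto
  qed
  moreover have "h 0 = flat_exp" by (auto simp: h_def)
  ultimately show ?thesis unfolding smooth_on_def by metis
qed

lemma flat_exp_nonneg: "0 \<le> flat_exp x"
  by (simp add: flat_exp_def)

lemma flat_exp_pos_iff: "0 < flat_exp x \<longleftrightarrow> 0 < x"
  by (simp add: flat_exp_def)

lemma flat_exp_eq_0: "x \<le> 0 \<Longrightarrow> flat_exp x = 0"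
  by (simp add: flat_exp_def)

lemma flat_exp_le_1: "flat_exp x \<le> 1"
  by (simp add: flat_exp_def)

section \<open>Determinants on Euclidean spaces\<close>

text \<open>Determinants and the change of variables theorem are only available on \<open>real ^ 'n\<close>. Indexing
  coordinates by the basis vectors of \<open>'a\<close> transports them to an arbitrary Euclidean space.\<close>

typedef (overloaded) 'a basis_index = "Basis :: 'a::euclidean_space set"
  using nonempty_Basis by blast

instance basis_index :: (euclidean_space) finite
proof
  have "(UNIV :: 'a basis_index set) = Abs_basis_index ` Basis"
    using Rep_basis_index Rep_basis_index_inverse by (metis UNIV_eq_I image_eqI)
  then show "finite (UNIV :: 'a basis_index set)" by (metis finite_Basis finite_imageI)
qed

text \<open>The change of variables theorem used below asks for a well-ordered index type; the order
  is pulled back from an enumeration.\<close>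

instantiation basis_index :: (euclidean_space) wellorder
begin

definition less_eq_basis_index :: "'a basis_index \<Rightarrow> 'a basis_index \<Rightarrow> bool" where
  "less_eq_basis_index i j \<longleftrightarrow> to_nat i \<le> to_nat j"

definition less_basis_index :: "'a basis_index \<Rightarrow> 'a basis_index \<Rightarrow> bool" where
  "less_basis_index i j \<longleftrightarrow> to_nat i < to_nat j"

instance
proof
  fix P :: "'a basis_index \<Rightarrow> bool" and a :: "'a basis_index"
  assume *: "\<And>x. (\<And>y. y < x \<Longrightarrow> P y) \<Longrightarrow> P x"
  show "P a"
    by (induction "to_nat a" arbitrary: a rule: less_induct)
      (use * in \<open>auto simp: less_basis_index_def\<close>)
qed (auto simp: less_eq_basis_index_def less_basis_index_def)

end

definition to_vec :: "'a::euclidean_space \<Rightarrow> real ^ 'a basis_index" where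
  "to_vec x = (\<chi> i. x \<bullet> Rep_basis_index i)"

definition of_vec :: "real ^ 'a basis_index \<Rightarrow> 'a::euclidean_space" where
  "of_vec v = (\<Sum>b\<in>Basis. (v $ Abs_basis_index b) *\<^sub>R b)"

lemma Rep_basis_index_in [simp]: "Rep_basis_index i \<in> Basis"
  by (rule Rep_basis_index)

lemma bij_betw_Rep_basis_index: "bij_betw Rep_basis_index UNIV (Basis :: 'a::euclidean_space set)"
  by (rule bij_betwI[where g = Abs_basis_index])
    (auto simp: Rep_basis_index_inverse Abs_basis_index_inverse)

lemma of_vec_inner_Basis: "b \<in> Basis \<Longrightarrow> of_vec v \<bullet> b = v $ Abs_basis_index b"
  by (simp add: of_vec_def inner_sum_left inner_Basis if_distrib sum.delta cong: if_cong)

lemma of_vec_to_vec [simp]: "of_vec (to_vec x) = x"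
  by (simp add: euclidean_eq_iff[where 'a='a] of_vec_inner_Basis to_vec_def Abs_basis_index_inverse)

lemma to_vec_of_vec [simp]: "to_vec (of_vec v) = v"
  by (simp add: vec_eq_iff to_vec_def of_vec_inner_Basis Rep_basis_index_inverse)

lemma to_vec_image: "to_vec ` A = of_vec -` A"
proof (intro set_eqI iffI)
  fix v assume "v \<in> of_vec -` A"
  then show "v \<in> to_vec ` A" by (intro image_eqI[of _ _ "of_vec v"]) auto
qed auto

lemma linear_to_vec: "linear to_vec"
  by (auto simp: linear_iff to_vec_def vec_eq_iff inner_left_distrib)

lemma linear_of_vec: "linear of_vec"
  by (auto simp: linear_iff of_vec_def scaleR_left_distrib sum.distrib scaleR_sum_right)

lemma to_vec_measurable [measurable]: "to_vec \<in> borel_measurable borel"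
  using linear_to_vec by (intro borel_measurable_continuous_onI linear_continuous_on)
    (simp add: linear_linear)

lemma of_vec_measurable [measurable]: "of_vec \<in> borel_measurable borel"
  using linear_of_vec by (intro borel_measurable_continuous_onI linear_continuous_on)
    (simp add: linear_linear)

lemma to_vec_vimage_box: "to_vec -` box l u = box (of_vec l) (of_vec u)"
proof -
  have "(\<forall>i. l $ i < x \<bullet> Rep_basis_index i \<and> x \<bullet> Rep_basis_index i < u $ i) \<longleftrightarrow>
      (\<forall>b\<in>Basis. l $ Abs_basis_index b < x \<bullet> b \<and> x \<bullet> b < u $ Abs_basis_index b)" for x :: 'a
    by (metis Abs_basis_index_inverse Rep_basis_index_in Rep_basis_index_inverse)
  then show ?thesis
    by (auto simp: box_def to_vec_def of_vec_inner_Basis Basis_vec_def inner_axis)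
qed

text \<open>Boxes correspond to boxes with the same side lengths, and Lebesgue measure is determined
  by boxes.\<close>

lemma distr_lborel_to_vec: "distr lborel borel to_vec = (lborel :: (real ^ 'a::euclidean_space basis_index) measure)"
proof (rule lborel_eqI[symmetric])
  fix l u :: "real ^ 'a basis_index"
  assume le: "\<And>b. b \<in> Basis \<Longrightarrow> l \<bullet> b \<le> u \<bullet> b"
  have le': "l $ i \<le> u $ i" for i
    using le[of "axis i 1"] by (auto simp: inner_axis axis_in_Basis_iff)
  have "emeasure (distr lborel borel to_vec) (box l u) = emeasure lborel (box (of_vec l) (of_vec u))"
    by (simp add: emeasure_distr to_vec_vimage_box)
  also have "\<dots> = (\<Prod>b\<in>Basis. (of_vec u - of_vec l) \<bullet> b)"
    using le' by (auto simp: emeasure_lborel_box_eq of_vec_inner_Basis)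
  also have "(\<Prod>b\<in>Basis. (of_vec u - of_vec l) \<bullet> b) = (\<Prod>i\<in>UNIV. u $ i - l $ i)"
    by (subst prod.reindex_bij_betw[OF bij_betw_Rep_basis_index, symmetric])
      (simp add: inner_diff_left of_vec_inner_Basis Rep_basis_index_inverse)
  also have "\<dots> = (\<Prod>b\<in>(Basis :: (real ^ 'a basis_index) set). (u - l) \<bullet> b)"
  proof -
    have "bij_betw (\<lambda>i. axis i (1::real)) UNIV (Basis :: (real ^ 'a basis_index) set)"
      by (auto simp: bij_betw_def inj_on_def Basis_vec_def axis_eq_axis)
    from prod.reindex_bij_betw[OF this, of "\<lambda>b. (u - l) \<bullet> b"] show ?thesis
      by (simp add: inner_axis)
  qed
  finally show "emeasure (distr lborel borel to_vec) (box l u) = (\<Prod>b\<in>Basis. (u - l) \<bullet> b)" .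
qed simp

lemma emeasure_lborel_to_vec_vimage:
  fixes A :: "(real ^ 'a::euclidean_space basis_index) set"
  assumes "A \<in> sets borel"
  shows "emeasure lborel (to_vec -` A) = emeasure lborel A"
proof -
  have "emeasure (distr lborel borel to_vec) A = emeasure lborel (to_vec -` A)"
    using assms by (simp add: emeasure_distr)
  then show ?thesis by (simp only: distr_lborel_to_vec)
qed

definition edet :: "('a::euclidean_space \<Rightarrow> 'a) \<Rightarrow> real" where
  "edet f = det (matrix (to_vec \<circ> f \<circ> of_vec))"

lemma linear_to_vec_conj: "linear f \<Longrightarrow> linear (to_vec \<circ> f \<circ> of_vec)"
  by (intro linear_compose linear_of_vec linear_to_vec)

lemma matrix_to_vec_conj_compose:
  assumes "linear f" "linear g"
  shows "matrix (to_vec \<circ> (f \<circ> g) \<circ> of_vec) =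
    matrix (to_vec \<circ> f \<circ> of_vec) ** matrix (to_vec \<circ> g \<circ> of_vec)"
proof -
  have "to_vec \<circ> (f \<circ> g) \<circ> of_vec = (to_vec \<circ> f \<circ> of_vec) \<circ> (to_vec \<circ> g \<circ> of_vec)"
    by (simp add: fun_eq_iff)
  then show ?thesis using matrix_compose linear_to_vec_conj assms by metis
qed

lemma edet_compose: "linear f \<Longrightarrow> linear g \<Longrightarrow> edet (f \<circ> g) = edet f * edet g"
  by (simp add: edet_def matrix_to_vec_conj_compose det_mul)

lemma edet_id: "edet (\<lambda>x::'a::euclidean_space. x) = 1"
proof -
  have "to_vec \<circ> (\<lambda>x::'a. x) \<circ> of_vec = id" by auto
  then show ?thesis unfolding edet_def by (simp only: matrix_id det_I)
qed

lemma edet_conjugate: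
  fixes f g P P' :: "'a::euclidean_space \<Rightarrow> 'a"
  assumes "linear f" "linear g" "linear P" "linear P'" "\<And>x. P' (P x) = x" "\<And>x. f (P x) = P (g x)"
  shows "edet f = edet g"
proof -
  have "edet P' * edet P = 1"
  proof -
    have "P' \<circ> P = (\<lambda>x. x)" using assms(5) by auto
    then show ?thesis using edet_compose[OF assms(4,3)] edet_id by metis
  qed
  moreover have "edet f * edet P = edet P * edet g"
    using edet_compose[OF assms(1,3)] edet_compose[OF assms(3,2)] assms(6) by (simp add: o_def)
  ultimately show ?thesis by auto
qed

text \<open>Pointwise convergence suffices because a determinant is a polynomial in the matrix
  entries.\<close>

lemma tendsto_edet:
  assumes "\<And>v. ((\<lambda>n. f n v) \<longlongrightarrow> g v) F"
  shows "((\<lambda>n. edet (f n)) \<longlongrightarrow> edet g) F"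
proof -
  have "((\<lambda>n. to_vec (f n v)) \<longlongrightarrow> to_vec (g v)) F" for v
    unfolding to_vec_def by (intro vec_tendstoI) (simp, intro tendsto_intros assms)
  then show ?thesis
    unfolding edet_def det_def matrix_def vec_lambda_beta o_def by (intro tendsto_intros)
qed

lemma of_vec_axis: "of_vec (axis j 1) = Rep_basis_index j"
proof -
  have "to_vec (Rep_basis_index j) = axis j 1"
    by (auto simp: to_vec_def vec_eq_iff axis_def inner_Basis Rep_basis_index_inject)
  then show ?thesis by (metis of_vec_to_vec)
qed

lemma matrix_diagonal_Basis:
  assumes "\<And>b. b \<in> Basis \<Longrightarrow> f b = d b *\<^sub>R b"
  shows "matrix (to_vec \<circ> f \<circ> of_vec) = (\<chi> i j. if i = j then d (Rep_basis_index i) else 0)"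
  by (auto simp: matrix_def vec_eq_iff assms to_vec_def of_vec_axis inner_Basis Rep_basis_index_inject)

lemma linear_diagonal: "linear (\<lambda>x. \<Sum>b\<in>Basis. (d b * (x \<bullet> b)) *\<^sub>R b)"
  by (auto simp: linear_iff inner_left_distrib ring_distribs scaleR_left_distrib sum.distrib
      scaleR_sum_right mult_ac)

lemma diagonal_Basis: "b \<in> Basis \<Longrightarrow> (\<Sum>b'\<in>Basis. (d b' * (b \<bullet> b')) *\<^sub>R b') = d b *\<^sub>R b"
  by (simp add: inner_Basis if_distrib if_distribR sum.delta' cong: if_cong)

text \<open>\<open>P\<close> carries the standard basis to eigenvectors, so \<open>f\<close> is
  similar to a diagonal map, and determinant and trace are similarity invariants. The determinant
  gives the Jacobian of a dilation, the trace identifies the homogeneous dimension with the sum of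
  the exponents.\<close>

lemma edet_eigenbasis:
  fixes f P P' :: "'a::euclidean_space \<Rightarrow> 'a"
  assumes "linear f" "linear P" "linear P'" "\<And>x. P' (P x) = x" "\<And>x. P (P' x) = x"
    and eig: "\<And>b. b \<in> Basis \<Longrightarrow> f (P b) = d b *\<^sub>R P b"
  shows "edet f = (\<Prod>b\<in>Basis. d b)" and "(\<Sum>b\<in>Basis. f b \<bullet> b) = (\<Sum>b\<in>Basis. d b)"
proof -
  define \<Delta> where "\<Delta> = (\<lambda>x::'a. \<Sum>b\<in>Basis. (d b * (x \<bullet> b)) *\<^sub>R b)"
  have lin: "linear \<Delta>" unfolding \<Delta>_def by (rule linear_diagonal)
  have \<Delta>: "\<Delta> b = d b *\<^sub>R b" if "b \<in> Basis" for b unfolding \<Delta>_def using that by (rule diagonal_Basis)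
  have eq: "f (P x) = P (\<Delta> x)" for x
  proof -
    have "f \<circ> P = P \<circ> \<Delta>"
      by (rule linear_eq_stdbasis)
        (use assms(1,2) lin in \<open>auto intro: linear_compose simp: \<Delta> eig linear_scale\<close>)
    then show ?thesis by (metis comp_apply)
  qed
  have "edet \<Delta> = (\<Prod>i\<in>UNIV. d (Rep_basis_index i))"
    unfolding edet_def matrix_diagonal_Basis[OF \<Delta>, simplified] by (subst det_diagonal) auto
  also have "\<dots> = (\<Prod>b\<in>Basis. d b)"
    by (rule prod.reindex_bij_betw[OF bij_betw_Rep_basis_index])
  finally show "edet f = (\<Prod>b\<in>Basis. d b)"
    using edet_conjugate[OF assms(1) lin assms(2,3,4) eq] by simp
  have tr: "(\<Sum>b\<in>Basis. g b \<bullet> b) = trace (matrix (to_vec \<circ> g \<circ> of_vec))" for g :: "'a \<Rightarrow> 'a"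
  proof -
    have "trace (matrix (to_vec \<circ> g \<circ> of_vec)) = (\<Sum>i\<in>UNIV. g (Rep_basis_index i) \<bullet> Rep_basis_index i)"
      by (simp add: trace_def matrix_def to_vec_def of_vec_axis)
    then show ?thesis by (simp add: sum.reindex_bij_betw[OF bij_betw_Rep_basis_index, of "\<lambda>b. g b \<bullet> b"])
  qed
  have "f = P \<circ> (\<Delta> \<circ> P')" using eq assms(5) by (metis comp_apply ext)
  then have "(\<Sum>b\<in>Basis. f b \<bullet> b) = trace (matrix (to_vec \<circ> (P \<circ> (\<Delta> \<circ> P')) \<circ> of_vec))"
    using tr by metis
  also have "\<dots> = trace (matrix (to_vec \<circ> ((\<Delta> \<circ> P') \<circ> P) \<circ> of_vec))"
    using matrix_to_vec_conj_compose[OF linear_compose[OF assms(3) lin] assms(2)]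
      matrix_to_vec_conj_compose[OF assms(2) linear_compose[OF assms(3) lin]] trace_mul_sym by metis
  also have "(\<Delta> \<circ> P') \<circ> P = \<Delta>" using assms(4) by auto
  finally show "(\<Sum>b\<in>Basis. f b \<bullet> b) = (\<Sum>b\<in>Basis. d b)"
    unfolding tr[symmetric] by (simp add: \<Delta>)
qed

text \<open>By the change of variables theorem the image of Lebesgue measure under the inverse
  \<open>h\<close> gives each box \<open>d\<close> times its volume. Boxes determine the measure, so
  no general transformation formula is required.\<close>

lemma nn_integral_lborel_const_det:
  fixes f h :: "'a::euclidean_space \<Rightarrow> 'a"
  assumes der: "\<And>x. (f has_derivative f' x) (at x)"
    and det: "\<And>x. \<bar>edet (f' x)\<bar> = d"
    and inv: "\<And>x. f (h x) = x" "\<And>x. h (f x) = x"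
    and meas: "h \<in> borel_measurable borel" and d: "0 < d"
    and F: "F \<in> borel_measurable borel"
  shows "(\<integral>\<^sup>+x. F (h x) \<partial>lborel) = ennreal d * (\<integral>\<^sup>+x. F x \<partial>lborel)"
proof -
  define M where "M = distr lborel borel h"
  have "emeasure M (box l u) = ennreal d * emeasure lborel (box l u)" for l u :: 'a
  proof -
    define S where "S = to_vec ` box l u"
    define g where "g = to_vec \<circ> f \<circ> of_vec"
    have S: "S = box (to_vec l) (to_vec u)"
    proof -
      have "S = of_vec -` box l u" by (simp add: S_def to_vec_image)
      also have "\<dots> = of_vec -` (to_vec -` box (to_vec l) (to_vec u))" by (simp add: to_vec_vimage_box)
      finally show ?thesis by auto
    qed
    have "(g has_derivative (to_vec \<circ> f' (of_vec v) \<circ> of_vec)) (at v within S)" for v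
    proof -
      have 1: "(of_vec has_derivative of_vec) (at v within S)"
        by (rule bounded_linear_imp_has_derivative[OF linear_of_vec[unfolded linear_conv_bounded_linear]])
      have 2: "((f \<circ> of_vec) has_derivative (f' (of_vec v) \<circ> of_vec)) (at v within S)"
        using has_derivative_compose[OF 1 der] by (simp add: o_def)
      show ?thesis
        using has_derivative_compose[OF 2 bounded_linear_imp_has_derivative[OF linear_to_vec[unfolded linear_conv_bounded_linear]]]
        by (simp add: o_def g_def)
    qed
    moreover have "inj_on g S"
      by (rule inj_onI) (metis g_def comp_apply inv(2) of_vec_to_vec to_vec_of_vec)
    moreover have "((\<lambda>v. \<bar>det (matrix (to_vec \<circ> f' (of_vec v) \<circ> of_vec))\<bar>) has_integral d * measure lebesgue S) S"
    proof -
      have "S \<in> lmeasurable" by (simp add: S)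
      then have "((\<lambda>v. 1) has_integral measure lebesgue S) S"
        unfolding has_integral_iff by (simp only: lmeasurable_iff_integrable_on lmeasure_integral simp_thms)
      from has_integral_mult_right[OF this, of d] det show ?thesis by (simp add: edet_def)
    qed
    ultimately have gS: "g ` S \<in> lmeasurable \<and> measure lebesgue (g ` S) = d * measure lebesgue S"
      by (subst has_measure_differentiable_image) (auto simp: S)
    have gS': "g ` S = of_vec -` (h -` box l u)"
    proof -
      have "g ` S = to_vec ` (f ` box l u)" by (auto simp: g_def S_def image_image)
      also have "f ` box l u = h -` box l u" using inv by (metis bij_vimage_eq_inv_image bijI' inv_equality)
      also have "to_vec ` (h -` box l u) = of_vec -` (h -` box l u)"
        by (rule to_vec_image)
      finally show ?thesis .
    qed
    have hb: "h -` box l u \<in> sets borel" using measurable_sets[OF meas, of "box l u"] by simp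
    then have "of_vec -` (h -` box l u) \<in> sets borel"
      using measurable_sets[OF of_vec_measurable, of "h -` box l u"] by simp
    then have "g ` S \<in> sets borel" using gS' by simp
    have "emeasure M (box l u) = emeasure lborel (h -` box l u)"
      using meas by (simp add: M_def emeasure_distr)
    also have "h -` box l u = to_vec -` (g ` S)" unfolding gS' by auto
    also have "emeasure lborel (to_vec -` (g ` S)) = emeasure lborel (g ` S)"
      using \<open>g ` S \<in> sets borel\<close> by (rule emeasure_lborel_to_vec_vimage)
    also have "\<dots> = emeasure lebesgue (g ` S)" using \<open>g ` S \<in> sets borel\<close> by simp
    also have "\<dots> = ennreal (d * measure lebesgue S)"
      using gS by (simp add: emeasure_eq_measure2)
    also have "\<dots> = ennreal d * emeasure lebesgue S"
      using d by (simp add: ennreal_mult emeasure_eq_measure2 S)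
    also have "emeasure lebesgue S = emeasure lborel (to_vec -` S)"
      by (simp add: S emeasure_lborel_to_vec_vimage)
    also have "to_vec -` S = box l u" by (simp add: S to_vec_vimage_box)
    finally show ?thesis .
  qed
  then have "lborel = scale_measure (1 / d) M"
    using d by (intro lborel_eqI)
      (auto simp: emeasure_lborel_box_eq M_def mult.assoc[symmetric] ennreal_mult[symmetric])
  then have "(\<integral>\<^sup>+x. F x \<partial>lborel) = (1 / d) * (\<integral>\<^sup>+x. F x \<partial>M)"
    using F nn_integral_scale_measure[of F M "1/d"] by (simp add: M_def)
  then have "ennreal d * (\<integral>\<^sup>+x. F x \<partial>lborel) = (\<integral>\<^sup>+x. F x \<partial>M)"
    using d by (simp add: mult.assoc[symmetric] ennreal_mult[symmetric])
  then show ?thesis using F meas by (simp add: M_def nn_integral_distr)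
qed

section \<open>Groups in exponential coordinates\<close>

text \<open>One-parameter identities reduce a derivative at \<open>t\<close> to one at
  \<open>0\<close>; this is the return step.\<close>

lemma has_vector_derivative_shift:
  fixes f :: "real \<Rightarrow> 'a::real_normed_vector"
  assumes "((\<lambda>h. f (t + h)) has_vector_derivative d) (at 0)"
  shows "(f has_vector_derivative d) (at t)"
proof -
  have "((\<lambda>s. s - t) has_vector_derivative 1) (at t)"
    by (auto intro!: derivative_eq_intros)
  from vector_diff_chain_at[OF this, of "\<lambda>h. f (t + h)" d] assms show ?thesis
    by (simp add: o_def)
qed

lemma has_vector_derivative_zero_eq:
  fixes f :: "real \<Rightarrow> 'a::real_normed_vector"
  assumes "\<And>t. (f has_vector_derivative 0) (at t)"
  shows "f s = f t"
proof -
  have "\<exists>c. \<forall>x\<in>UNIV. f x = c"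
    by (rule has_derivative_zero_constant) (use assms in \<open>auto simp: has_vector_derivative_def\<close>)
  then show ?thesis by auto
qed

text \<open>A group law transported to the Lie algebra, so that the exponential map is the identity:
  lines through \<open>0\<close> are one-parameter subgroups, which makes \<open>0\<close> the unit
  and \<open>- x\<close> the inverse.\<close>

locale exp_coordinates =
  fixes m :: "'a::euclidean_space \<Rightarrow> 'a \<Rightarrow> 'a"
  assumes smooth_m: "smooth_on UNIV (\<lambda>(x, y). m x y)"
    and assoc: "m (m x y) z = m x (m y z)"
    and one_parameter: "m (s *\<^sub>R x) (t *\<^sub>R x) = (s + t) *\<^sub>R x"
begin

lemma left_zero [simp]: "m 0 x = x"
  using one_parameter[of 0 x 1] by simp

lemma right_zero [simp]: "m x 0 = x"
  using one_parameter[of 1 x 0] by simp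

lemma left_minus [simp]: "m (- x) x = 0"
  using one_parameter[of "- 1" x 1] by simp

lemma right_minus [simp]: "m x (- x) = 0"
  using one_parameter[of 1 x "- 1"] by simp

lemma left_minus_cancel [simp]: "m (- x) (m x y) = y"
  by (simp add: assoc[symmetric])

lemma right_minus_cancel [simp]: "m x (m (- x) y) = y"
  by (simp add: assoc[symmetric])

lemma minus_m: "- m x y = m (- y) (- x)"
proof -
  have "m (m (- y) (- x)) (m x y) = 0" by (simp add: assoc)
  then have "m (m (- y) (- x)) (m (m x y) (- m x y)) = - m x y" by (metis assoc left_zero)
  then show ?thesis by simp
qed

definition dm :: "'a \<times> 'a \<Rightarrow> 'a \<times> 'a \<Rightarrow> 'a" where
  "dm z = frechet_derivative (\<lambda>(x, y). m x y) (at z)"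

lemma dm: "((\<lambda>(x, y). m x y) has_derivative dm z) (at z)"
  unfolding dm_def by (rule smooth_on_has_derivative[OF smooth_m]) simp

lemma smooth_m_compose:
  fixes f g :: "'b::euclidean_space \<Rightarrow> 'a"
  assumes "smooth_on UNIV f" "smooth_on UNIV g"
  shows "smooth_on UNIV (\<lambda>x. m (f x) (g x))"
  using smooth_on_compose[OF open_UNIV smooth_on_Pair[OF open_UNIV assms] smooth_m] by simp

lemma left_has_derivative: "(m a has_derivative (\<lambda>v. dm (a, x) (0, v))) (at x)"
proof -
  have "((\<lambda>x. (a, x)) has_derivative (\<lambda>v. (0, v))) (at x)"
    by (auto intro!: derivative_eq_intros)
  from has_derivative_compose[OF this dm[of "(a, x)"]] show ?thesis by simp
qed

lemma right_has_derivative: "((\<lambda>x. m x a) has_derivative (\<lambda>v. dm (x, a) (v, 0))) (at x)"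
proof -
  have "((\<lambda>x. (x, a)) has_derivative (\<lambda>v. (v, 0))) (at x)"
    by (auto intro!: derivative_eq_intros)
  from has_derivative_compose[OF this dm[of "(x, a)"]] show ?thesis by simp
qed

text \<open>Both partial derivatives at the unit are the identity, since \<open>m x 0 = x\<close>
  and \<open>m 0 y = y\<close>.\<close>

lemma dm_zero: "dm (0, 0) (v, w) = v + w"
proof -
  have "((\<lambda>x. m x 0) has_derivative (\<lambda>x. x)) (at 0)" "(m 0 has_derivative (\<lambda>x. x)) (at 0)"
  proof -
    have "m 0 = (\<lambda>x. x)" by (simp add: fun_eq_iff)
    then show "(m 0 has_derivative (\<lambda>x. x)) (at 0)" by simp
  qed simp
  from this(1)[THEN has_derivative_unique[OF right_has_derivative]]
    this(2)[THEN has_derivative_unique[OF left_has_derivative]]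
  have "dm (0, 0) (v, 0) = v" "dm (0, 0) (0, w) = w"
    by (simp_all add: fun_eq_iff)
  then show ?thesis
    using linear_add[OF has_derivative_linear[OF dm], of "(0, 0)" "(v, 0)" "(0, w)"] by simp
qed

lemma m_has_vector_derivative_0:
  assumes "(f has_vector_derivative v) (at t)" "(g has_vector_derivative w) (at t)" "f t = 0" "g t = 0"
  shows "((\<lambda>s. m (f s) (g s)) has_vector_derivative v + w) (at t)"
proof -
  have "((\<lambda>s. (f s, g s)) has_derivative (\<lambda>h. (h *\<^sub>R v, h *\<^sub>R w))) (at t)"
    using assms(1,2) by (auto simp: has_vector_derivative_def intro: has_derivative_Pair)
  from has_derivative_compose[OF this dm] assms(3,4) show ?thesis
    by (simp add: has_vector_derivative_def dm_zero scaleR_add_right)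
qed

section \<open>Conjugation, adjoint action and bracket\<close>

definition inner_aut :: "'a \<Rightarrow> 'a \<Rightarrow> 'a" where
  "inner_aut a x = m (m a x) (- a)"

text \<open>Taken as a partial derivative of the joint map of both arguments, so that smoothness in
  \<open>a\<close> is inherited from conjugation.\<close>

definition adj :: "'a \<Rightarrow> 'a \<Rightarrow> 'a" where
  "adj a v = frechet_derivative (\<lambda>(x, y). inner_aut x y) (at (a, 0)) (0, v)"

definition bracket :: "'a \<Rightarrow> 'a \<Rightarrow> 'a" where
  "bracket x v = vector_derivative (\<lambda>t. adj (t *\<^sub>R x) v) (at 0)"

lemma smooth_inner_aut: "smooth_on UNIV (\<lambda>(x, y). inner_aut x y)"
proof -
  have "smooth_on UNIV (\<lambda>z. m (m (fst z) (snd z)) (- fst z))"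
    by (intro smooth_m_compose smooth_on_bounded_linear open_UNIV
        bounded_linear_minus bounded_linear_fst bounded_linear_snd)
  then show ?thesis by (simp add: inner_aut_def case_prod_unfold)
qed

lemma inner_aut_has_derivative: "(inner_aut a has_derivative adj a) (at 0)"
proof -
  have "((\<lambda>x. (a, x)) has_derivative (\<lambda>v. (0, v))) (at 0)"
    by (auto intro!: derivative_eq_intros)
  from has_derivative_compose[OF this smooth_on_has_derivative[OF smooth_inner_aut]] show ?thesis
    by (simp add: adj_def[abs_def])
qed

lemma linear_adj: "linear (adj a)"
  using inner_aut_has_derivative by (rule has_derivative_linear)

lemma bounded_linear_adj: "bounded_linear (adj a)"
  using inner_aut_has_derivative by (rule has_derivative_bounded_linear)

lemma inner_aut_zero [simp]: "inner_aut a 0 = 0"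
  by (simp add: inner_aut_def)

lemma adj_zero [simp]: "adj 0 v = v"
proof -
  have "(inner_aut 0 has_derivative (\<lambda>v. v)) (at 0)"
    by (simp add: inner_aut_def[abs_def])
  from has_derivative_unique[OF inner_aut_has_derivative this] show ?thesis by simp
qed

lemma adj_m: "adj (m a b) v = adj a (adj b v)"
proof -
  have "((\<lambda>x. inner_aut a (inner_aut b x)) has_derivative (\<lambda>v. adj a (adj b v))) (at 0)"
    using has_derivative_compose[OF inner_aut_has_derivative, of "inner_aut a" "adj a" b] inner_aut_has_derivative by simp
  moreover have "(\<lambda>x. inner_aut a (inner_aut b x)) = inner_aut (m a b)"
    by (simp add: fun_eq_iff inner_aut_def minus_m assoc)
  ultimately show ?thesis
    using has_derivative_unique[OF inner_aut_has_derivative] by metis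
qed

lemma adj_minus_cancel [simp]: "adj (- a) (adj a v) = v"
  by (simp flip: adj_m)

lemma adj_minus_cancel' [simp]: "adj a (adj (- a) v) = v"
  by (simp flip: adj_m)

lemma smooth_adj: "smooth_on UNIV (\<lambda>a. adj a v)"
proof -
  have "smooth_on UNIV (\<lambda>a::'a. (a, 0::'a))"
    by (intro smooth_on_Pair smooth_on_bounded_linear smooth_on_const open_UNIV bounded_linear_ident)
  from smooth_on_compose[OF open_UNIV this smooth_on_frechet_derivative[OF smooth_inner_aut]]
  show ?thesis by (simp add: adj_def)
qed

lemma adj_has_vector_derivative:
  "((\<lambda>t. adj (t *\<^sub>R x) v) has_vector_derivative bracket x v) (at 0)"
proof -
  have "((\<lambda>t::real. t *\<^sub>R x) has_derivative (\<lambda>h. h *\<^sub>R x)) (at 0)"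
    by (auto intro!: derivative_eq_intros)
  from has_derivative_compose[OF this smooth_on_has_derivative[OF smooth_adj]]
  have "(\<lambda>t. adj (t *\<^sub>R x) v) differentiable (at 0)"
    unfolding differentiable_def by auto
  then show ?thesis unfolding bracket_def using vector_derivative_works by blast
qed

lemma linear_bracket: "linear (bracket x)"
proof (rule linearI)
  fix v w c
  have "((\<lambda>t. adj (t *\<^sub>R x) v + adj (t *\<^sub>R x) w) has_vector_derivative bracket x v + bracket x w) (at 0)"
    by (intro has_vector_derivative_add adj_has_vector_derivative)
  then show "bracket x (v + w) = bracket x v + bracket x w"
    unfolding linear_add[OF linear_adj, symmetric]
    by (rule vector_derivative_unique_at[OF adj_has_vector_derivative])
  have "((\<lambda>t. c *\<^sub>R adj (t *\<^sub>R x) v) has_vector_derivative c *\<^sub>R bracket x v) (at 0)"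
    by (intro bounded_linear.has_vector_derivative[OF bounded_linear_scaleR_right] adj_has_vector_derivative)
  then show "bracket x (c *\<^sub>R v) = c *\<^sub>R bracket x v"
    unfolding linear_scale[OF linear_adj, symmetric]
    by (rule vector_derivative_unique_at[OF adj_has_vector_derivative])
qed

text \<open>The product rule for an operator applied to a moving vector. Expanding
  \<open>w h\<close> over \<open>Basis\<close> leaves only derivatives of the adjoint action on
  fixed vectors, which are brackets.\<close>

lemma adj_apply_has_vector_derivative:
  assumes "(w has_vector_derivative w') (at 0)"
  shows "((\<lambda>h. adj (- (h *\<^sub>R y)) (w h)) has_vector_derivative w' - bracket y (w 0)) (at 0)"
proof -
  have "((\<lambda>h. adj (- (h *\<^sub>R y)) b) has_vector_derivative - bracket y b) (at 0)" for b
  proof -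
    have "((\<lambda>h::real. - h) has_vector_derivative - 1) (at 0)"
      by (auto intro!: derivative_eq_intros)
    from vector_diff_chain_at[OF this, of "\<lambda>t. adj (t *\<^sub>R y) b"] adj_has_vector_derivative
    show ?thesis by (simp add: o_def)
  qed
  then have "((\<lambda>h. \<Sum>b\<in>Basis. (w h \<bullet> b) *\<^sub>R adj (- (h *\<^sub>R y)) b) has_vector_derivative
      (\<Sum>b\<in>Basis. (w 0 \<bullet> b) *\<^sub>R - bracket y b + (w' \<bullet> b) *\<^sub>R adj (- (0 *\<^sub>R y)) b)) (at 0)"
    using bounded_linear.has_vector_derivative[OF bounded_linear_inner_left assms]
    by (intro has_vector_derivative_sum has_vector_derivative_scaleR)
      (simp add: has_real_derivative_iff_has_vector_derivative)
  also have "(\<lambda>h. \<Sum>b\<in>Basis. (w h \<bullet> b) *\<^sub>R adj (- (h *\<^sub>R y)) b) = (\<lambda>h. adj (- (h *\<^sub>R y)) (w h))"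
    by (simp flip: linear_eq_sum_Basis[OF linear_adj])
  also have "(\<Sum>b\<in>Basis. (w 0 \<bullet> b) *\<^sub>R - bracket y b + (w' \<bullet> b) *\<^sub>R adj (- (0 *\<^sub>R y)) b) =
      w' - bracket y (w 0)"
    by (simp add: sum_subtractf euclidean_representation flip: linear_eq_sum_Basis[OF linear_bracket])
  finally show ?thesis .
qed

text \<open>\<open>D\<close> is known to respect brackets but not the product \<open>m\<close>.
  Transporting \<open>D (adj (t x) v)\<close> back by \<open>adj (- (t D x))\<close> gives a curve
  whose derivative is the image under \<open>adj (- (t D x))\<close> of
  \<open>D (bracket x z) - bracket (D x) (D z) = 0\<close>. The claim compares its values at
  \<open>0\<close> and \<open>1\<close>.\<close>

lemma adj_equivariant:
  assumes D: "linear D" "\<And>x y. D (bracket x y) = bracket (D x) (D y)"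
  shows "adj (D x) (D v) = D (adj x v)"
proof -
  define S where "S t = adj (- (t *\<^sub>R D x)) (D (adj (t *\<^sub>R x) v))" for t
  have bD: "bounded_linear D" using D(1) by (simp add: linear_conv_bounded_linear)
  have "(S has_vector_derivative 0) (at t)" for t
  proof (rule has_vector_derivative_shift)
    define z where "z = adj (t *\<^sub>R x) v"
    \<comment> \<open>The factors are ordered so that the \<open>h\<close> parts meet in the middle;
      only they have to be differentiated, at \<open>h = 0\<close>.\<close>
    have "S (t + h) = adj (- (t *\<^sub>R D x)) (adj (- (h *\<^sub>R D x)) (D (adj (h *\<^sub>R x) z)))" for h
    proof -
      have "- ((t + h) *\<^sub>R D x) = m (- (t *\<^sub>R D x)) (- (h *\<^sub>R D x))"
        using one_parameter[of "- t" "D x" "- h"] by (simp add: algebra_simps)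
      moreover have "(t + h) *\<^sub>R x = m (h *\<^sub>R x) (t *\<^sub>R x)"
        by (simp add: one_parameter algebra_simps)
      ultimately show ?thesis unfolding S_def z_def by (simp only: adj_m)
    qed
    moreover have "((\<lambda>h. adj (- (h *\<^sub>R D x)) (D (adj (h *\<^sub>R x) z))) has_vector_derivative
        D (bracket x z) - bracket (D x) (D (adj (0 *\<^sub>R x) z))) (at 0)"
      by (intro adj_apply_has_vector_derivative bounded_linear.has_vector_derivative[OF bD]
          adj_has_vector_derivative)
    ultimately show "((\<lambda>h. S (t + h)) has_vector_derivative 0) (at 0)"
      using bounded_linear.has_vector_derivative[OF bounded_linear_adj, of _ 0 "at 0" "- (t *\<^sub>R D x)"]
      by (simp add: D(2) linear_0[OF linear_adj])
  qed
  then have "S 1 = S 0" by (rule has_vector_derivative_zero_eq)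
  then have "adj (- D x) (D (adj x v)) = D v" by (simp add: S_def)
  then show ?thesis by (metis adj_minus_cancel')
qed

text \<open>The logarithmic derivative of the exponential map.\<close>

definition mc :: "'a \<Rightarrow> 'a \<Rightarrow> 'a" where
  "mc x v = dm (- x, x) (0, v)"

lemma mc_has_derivative: "(m (- x) has_derivative mc x) (at x)"
  unfolding mc_def[abs_def] by (rule left_has_derivative)

lemma linear_mc: "linear (mc x)"
  using mc_has_derivative by (rule has_derivative_linear)

lemma mc_zero [simp]: "mc 0 v = v"
  by (simp add: mc_def dm_zero)

lemma smooth_mc: "smooth_on UNIV (\<lambda>x. mc x v)"
proof -
  have "smooth_on UNIV (\<lambda>a::'a. (- a, a))"
    by (intro smooth_on_Pair smooth_on_bounded_linear open_UNIV bounded_linear_ident bounded_linear_minus)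
  from smooth_on_compose[OF open_UNIV this smooth_on_frechet_derivative[OF smooth_m]]
  show ?thesis by (simp add: mc_def dm_def)
qed

lemma scale_mc_has_vector_derivative:
  "((\<lambda>s. m (- (t *\<^sub>R x)) (t *\<^sub>R (x + s *\<^sub>R v))) has_vector_derivative t *\<^sub>R mc (t *\<^sub>R x) v) (at 0)"
proof -
  have "((\<lambda>s. t *\<^sub>R (x + s *\<^sub>R v)) has_derivative (\<lambda>h. h *\<^sub>R t *\<^sub>R v)) (at 0)"
    by (auto intro!: derivative_eq_intros simp: scaleR_left_commute)
  from has_derivative_compose[OF this, of "m (- (t *\<^sub>R x))" "mc (t *\<^sub>R x)"] mc_has_derivative[of "t *\<^sub>R x"]
  show ?thesis by (simp add: has_vector_derivative_def linear_scale[OF linear_mc])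
qed

text \<open>Cutting the line with velocity \<open>x + s v\<close> at time \<open>u\<close> writes
  \<open>c (u + t)\<close> as the conjugate of \<open>c u\<close> by \<open>- t x\<close>, times
  \<open>c t\<close>. Both curves pass through the unit at \<open>s = 0\<close>, where the
  derivative of a product is the sum of the derivatives.\<close>

lemma scale_mc_cocycle:
  "(u + t) *\<^sub>R mc ((u + t) *\<^sub>R x) v = adj (- (t *\<^sub>R x)) (u *\<^sub>R mc (u *\<^sub>R x) v) + t *\<^sub>R mc (t *\<^sub>R x) v"
proof -
  \<comment> \<open>The endpoint of the perturbed line at time \<open>t\<close>, seen from the
    endpoint of the unperturbed one.\<close>
  define c where "c t s = m (- (t *\<^sub>R x)) (t *\<^sub>R (x + s *\<^sub>R v))" for t s
  have c: "(c t has_vector_derivative t *\<^sub>R mc (t *\<^sub>R x) v) (at 0)" for t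
    unfolding c_def[abs_def] by (rule scale_mc_has_vector_derivative)
  have "c (u + t) s = m (inner_aut (- (t *\<^sub>R x)) (c u s)) (c t s)" for s
  proof -
    have "- ((u + t) *\<^sub>R x) = m (- (t *\<^sub>R x)) (- (u *\<^sub>R x))"
      using one_parameter[of "- t" x "- u"] by (simp add: algebra_simps)
    moreover have "(u + t) *\<^sub>R (x + s *\<^sub>R v) = m (u *\<^sub>R (x + s *\<^sub>R v)) (t *\<^sub>R (x + s *\<^sub>R v))"
      by (simp add: one_parameter)
    ultimately show ?thesis by (simp add: c_def inner_aut_def assoc)
  qed
  then have eq: "c (u + t) = (\<lambda>s. m (inner_aut (- (t *\<^sub>R x)) (c u s)) (c t s))" by blast
  have c0: "c t 0 = 0" for t by (simp add: c_def)
  have "((\<lambda>s. inner_aut (- (t *\<^sub>R x)) (c u s)) has_vector_derivative adj (- (t *\<^sub>R x)) (u *\<^sub>R mc (u *\<^sub>R x) v)) (at 0)"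
  proof -
    have "(inner_aut (- (t *\<^sub>R x)) has_derivative adj (- (t *\<^sub>R x))) (at (c u 0))"
      by (simp add: c0 inner_aut_has_derivative)
    from has_derivative_compose[OF c[of u, unfolded has_vector_derivative_def] this] show ?thesis
      by (simp add: has_vector_derivative_def linear_scale[OF linear_adj])
  qed
  from m_has_vector_derivative_0[OF this c[of t]]
  have "(c (u + t) has_vector_derivative adj (- (t *\<^sub>R x)) (u *\<^sub>R mc (u *\<^sub>R x) v) + t *\<^sub>R mc (t *\<^sub>R x) v) (at 0)"
    unfolding eq by (simp add: c0)
  from vector_derivative_unique_at[OF c this] show ?thesis .
qed

text \<open>Differentiate the cocycle in \<open>u\<close> at \<open>0\<close>, where
  \<open>u mc (u x) v\<close> has derivative \<open>mc 0 v = v\<close>. In integrated form,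
  \<open>mc x v\<close> is the integral of \<open>adj (- (t x)) v\<close> over \<open>t\<close> from
  \<open>0\<close> to \<open>1\<close>.\<close>

lemma scale_mc_has_vector_derivative_t:
  "((\<lambda>t. t *\<^sub>R mc (t *\<^sub>R x) v) has_vector_derivative adj (- (t *\<^sub>R x)) v) (at t)"
proof (rule has_vector_derivative_shift)
  have "((\<lambda>t::real. t *\<^sub>R x) has_derivative (\<lambda>h. h *\<^sub>R x)) (at 0)"
    by (auto intro!: derivative_eq_intros)
  from has_derivative_compose[OF this smooth_on_has_derivative[OF smooth_mc]]
  have "(\<lambda>t. mc (t *\<^sub>R x) v) differentiable (at 0)"
    unfolding differentiable_def by auto
  then obtain d where "((\<lambda>t. mc (t *\<^sub>R x) v) has_vector_derivative d) (at 0)"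
    using vector_derivative_works by blast
  from has_vector_derivative_scaleR[OF DERIV_ident this]
  have "((\<lambda>u. u *\<^sub>R mc (u *\<^sub>R x) v) has_vector_derivative v) (at 0)" by simp
  from bounded_linear.has_vector_derivative[OF bounded_linear_adj this, of "- (t *\<^sub>R x)"]
  have "((\<lambda>u. adj (- (t *\<^sub>R x)) (u *\<^sub>R mc (u *\<^sub>R x) v) + t *\<^sub>R mc (t *\<^sub>R x) v) has_vector_derivative
      adj (- (t *\<^sub>R x)) v) (at 0)"
    by (auto intro!: derivative_eq_intros)
  moreover have "(t + u) *\<^sub>R mc ((t + u) *\<^sub>R x) v =
      adj (- (t *\<^sub>R x)) (u *\<^sub>R mc (u *\<^sub>R x) v) + t *\<^sub>R mc (t *\<^sub>R x) v" for u
    using scale_mc_cocycle[of u t] by (simp only: add.commute)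
  ultimately show "((\<lambda>u. (t + u) *\<^sub>R mc ((t + u) *\<^sub>R x) v) has_vector_derivative adj (- (t *\<^sub>R x)) v) (at 0)"
    by presburger
qed

text \<open>As functions of \<open>t\<close>, \<open>t mc (t D x) (D v)\<close> and
  \<open>D (t mc (t x) v)\<close> have the same derivative, by equivariance of the adjoint action,
  and both vanish at \<open>0\<close>.\<close>

lemma mc_equivariant:
  assumes D: "linear D" "\<And>x y. D (bracket x y) = bracket (D x) (D y)"
  shows "mc (D x) (D v) = D (mc x v)"
proof -
  define V where "V t = t *\<^sub>R mc (t *\<^sub>R D x) (D v) - D (t *\<^sub>R mc (t *\<^sub>R x) v)" for t
  have bD: "bounded_linear D" using D(1) by (simp add: linear_conv_bounded_linear)
  have "(V has_vector_derivative 0) (at t)" for t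
  proof -
    have "(V has_vector_derivative adj (- (t *\<^sub>R D x)) (D v) - D (adj (- (t *\<^sub>R x)) v)) (at t)"
      unfolding V_def by (intro has_vector_derivative_diff scale_mc_has_vector_derivative_t
          bounded_linear.has_vector_derivative[OF bD])
    also have "D (adj (- (t *\<^sub>R x)) v) = adj (D (- (t *\<^sub>R x))) (D v)"
      by (rule adj_equivariant[OF D, symmetric])
    also have "D (- (t *\<^sub>R x)) = - (t *\<^sub>R D x)"
      by (simp add: linear_neg[OF D(1)] linear_scale[OF D(1)])
    finally show ?thesis by simp
  qed
  then have "V 1 = V 0" by (rule has_vector_derivative_zero_eq)
  then show ?thesis by (simp add: V_def linear_0[OF D(1)])
qed

end

text \<open>Automorphisms of the Lie algebra contracting to \<open>0\<close> force unimodularity: they conjugate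
  \<open>adj x\<close> and \<open>mc x\<close> into operators arbitrarily close to the identity.\<close>

locale contractible_exp_coordinates = exp_coordinates m for m :: "'a::euclidean_space \<Rightarrow> 'a \<Rightarrow> 'a" +
  fixes D D' :: "nat \<Rightarrow> 'a \<Rightarrow> 'a"
  assumes linear_D: "linear (D n)" "linear (D' n)"
    and D_inverse: "D' n (D n x) = x"
    and D_bracket: "D n (bracket x y) = bracket (D n x) (D n y)"
    and D_tendsto: "(\<lambda>n. D n x) \<longlonglongrightarrow> 0"
begin

lemma edet_eq_1:
  assumes lin: "\<And>x. linear (T x)" and eqv: "\<And>n x v. T (D n x) (D n v) = D n (T x v)"
    and cont: "\<And>v. continuous_on UNIV (\<lambda>x. T x v)" and "\<And>v. T 0 v = v"
  shows "edet (T x) = 1"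
proof -
  have "(\<lambda>n. edet (T (D n x))) \<longlonglongrightarrow> edet (\<lambda>v::'a. v)"
  proof (rule tendsto_edet)
    fix v
    have "(\<lambda>n. T (D n x) v) \<longlonglongrightarrow> T 0 v"
      by (rule continuous_on_tendsto_compose[where s = UNIV and f = "\<lambda>x. T x v", OF cont D_tendsto UNIV_I])
        (rule always_eventually, simp)
    then show "(\<lambda>n. T (D n x) v) \<longlonglongrightarrow> v" by (simp only: assms(4))
  qed
  moreover have "edet (T (D n x)) = edet (T x)" for n
    by (rule edet_conjugate[where P = "D n" and P' = "D' n"])
      (simp_all only: lin linear_D D_inverse eqv)
  ultimately show ?thesis by (simp add: edet_id LIMSEQ_const_iff)
qed

lemma edet_adj: "edet (adj x) = 1"
  by (rule edet_eq_1[OF linear_adj])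
    (auto simp: adj_equivariant[OF linear_D(1) D_bracket] intro: smooth_on_imp_continuous_on smooth_adj)

lemma edet_mc: "edet (mc x) = 1"
  by (rule edet_eq_1[OF linear_mc])
    (auto simp: mc_equivariant[OF linear_D(1) D_bracket] intro: smooth_on_imp_continuous_on smooth_mc)

section \<open>Invariance of Lebesgue measure and uniqueness of Haar measure\<close>

lemma continuous_m: "continuous_on UNIV (m a)" "continuous_on UNIV (\<lambda>x. m x a)"
  by (rule has_derivative_continuous_on[OF has_derivative_at_withinI[OF left_has_derivative]],
      rule has_derivative_continuous_on[OF has_derivative_at_withinI[OF right_has_derivative]])

text \<open>Returning to the unit from the translated point is the same as returning from
  \<open>x\<close> itself, so \<open>mc\<close> at the translated point composed with the derivative
  of the translation is \<open>mc x\<close>. Both \<open>mc\<close> factors have determinant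
  \<open>1\<close>, hence so has the translation. The map differentiated is translation by
  \<open>- a\<close>, the inverse of the one in the integrand.\<close>

lemma nn_integral_left_translation:
  assumes F: "F \<in> borel_measurable borel"
  shows "(\<integral>\<^sup>+x. F (m a x) \<partial>lborel) = (\<integral>\<^sup>+x. F x \<partial>lborel)"
proof -
  have "edet (\<lambda>v. dm (- a, x) (0, v)) = 1" for x
  proof -
    define L where "L = (\<lambda>v. dm (- a, x) (0, v))"
    have L: "(m (- a) has_derivative L) (at x)" unfolding L_def by (rule left_has_derivative)
    have "((\<lambda>y. m (- m (- a) x) (m (- a) y)) has_derivative (\<lambda>v. mc (m (- a) x) (L v))) (at x)"
      by (rule has_derivative_compose[OF L mc_has_derivative])
    moreover have "(\<lambda>y. m (- m (- a) x) (m (- a) y)) = m (- x)"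
      by (simp add: fun_eq_iff minus_m assoc)
    ultimately have "(m (- x) has_derivative (\<lambda>v. mc (m (- a) x) (L v))) (at x)" by simp
    from has_derivative_unique[OF this mc_has_derivative]
    have "mc (m (- a) x) \<circ> L = mc x" by (simp add: comp_def)
    then have "edet (mc (m (- a) x) \<circ> L) = 1" by (simp only: edet_mc)
    then show ?thesis
      using edet_compose[OF linear_mc has_derivative_linear[OF L], of "m (- a) x"]
      unfolding edet_mc L_def by simp
  qed
  from nn_integral_lborel_const_det[OF left_has_derivative, of "- a" 1 "m a" F] this show ?thesis
    using F continuous_m(1)[THEN borel_measurable_continuous_onI] by simp
qed

text \<open>Read through left translations to the unit, a right translation becomes conjugation by
  \<open>a\<close>. Thus the adjoint action appears beside \<open>mc\<close>, and its determinant
  \<open>1\<close> is what makes the measure bi-invariant.\<close>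

lemma nn_integral_right_translation:
  assumes F: "F \<in> borel_measurable borel"
  shows "(\<integral>\<^sup>+x. F (m x a) \<partial>lborel) = (\<integral>\<^sup>+x. F x \<partial>lborel)"
proof -
  have "edet (\<lambda>v. dm (x, - a) (v, 0)) = 1" for x
  proof -
    define R where "R = (\<lambda>v. dm (x, - a) (v, 0))"
    have R: "((\<lambda>x. m x (- a)) has_derivative R) (at x)" unfolding R_def by (rule right_has_derivative)
    have "((\<lambda>y. m (- m x (- a)) (m y (- a))) has_derivative (\<lambda>v. mc (m x (- a)) (R v))) (at x)"
      by (rule has_derivative_compose[OF R mc_has_derivative])
    moreover have "((\<lambda>y. inner_aut a (m (- x) y)) has_derivative (\<lambda>v. adj a (mc x v))) (at x)"
      using has_derivative_compose[OF mc_has_derivative[of x], of "inner_aut a" "adj a"] inner_aut_has_derivative by simp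
    moreover have "(\<lambda>y. m (- m x (- a)) (m y (- a))) = (\<lambda>y. inner_aut a (m (- x) y))"
      by (simp add: fun_eq_iff minus_m inner_aut_def assoc)
    ultimately have "((\<lambda>y. inner_aut a (m (- x) y)) has_derivative (\<lambda>v. mc (m x (- a)) (R v))) (at x)"
      "((\<lambda>y. inner_aut a (m (- x) y)) has_derivative (\<lambda>v. adj a (mc x v))) (at x)" by simp_all
    from has_derivative_unique[OF this]
    have "mc (m x (- a)) \<circ> R = adj a \<circ> mc x" by (simp add: comp_def)
    then have "edet (mc (m x (- a)) \<circ> R) = 1"
      using edet_compose[OF linear_adj linear_mc, of a x] by (simp add: edet_mc edet_adj)
    then show ?thesis
      using edet_compose[OF linear_mc has_derivative_linear[OF R], of "m x (- a)"]
      unfolding edet_mc R_def by simp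
  qed
  from nn_integral_lborel_const_det[OF right_has_derivative, of "- a" 1 "\<lambda>x. m x a" F] this show ?thesis
    using F continuous_m(2)[THEN borel_measurable_continuous_onI] by (simp add: assoc)
qed

text \<open>Uniqueness of Haar measure, comparing both measures through the double integral of
  \<open>f x * g (x\<^sup>-\<^sup>1 y)\<close>.\<close>

lemma left_invariant_eq_lborel:
  assumes sets: "sets \<nu> = sets borel"
    and inv: "\<And>a F. F \<in> borel_measurable borel \<Longrightarrow> (\<integral>\<^sup>+x. F (m a x) \<partial>\<nu>) = (\<integral>\<^sup>+x. F x \<partial>\<nu>)"
    and fin: "\<And>r. emeasure \<nu> (cball 0 r) < \<infinity>" and nz: "emeasure \<nu> UNIV \<noteq> 0"
  obtains c :: real where "0 < c"
    "\<And>F. F \<in> borel_measurable borel \<Longrightarrow> (\<integral>\<^sup>+x. F x \<partial>\<nu>) = ennreal c * (\<integral>\<^sup>+x. F x \<partial>lborel)"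
proof -
  have space: "space \<nu> = UNIV" using sets_eq_imp_space_eq[OF sets] by simp
  interpret \<nu>: sigma_finite_measure \<nu>
  proof
    show "\<exists>A. countable A \<and> A \<subseteq> sets \<nu> \<and> \<Union> A = space \<nu> \<and> (\<forall>a\<in>A. emeasure \<nu> a \<noteq> \<infinity>)"
    proof (intro exI[of _ "range (\<lambda>n::nat. cball 0 (real n))"] conjI)
      show "\<Union> (range (\<lambda>n::nat. cball (0::'a) (real n))) = space \<nu>"
        using real_arch_simple by (auto simp: space)
    qed (use fin sets in \<open>auto simp: less_top\<close>)
  qed
  interpret P: pair_sigma_finite \<nu> "lborel :: 'a measure" ..
  have [measurable_cong]: "sets \<nu> = sets borel" by (rule sets)
  have [measurable]: "(\<lambda>z. m (fst z) (snd z)) \<in> borel_measurable (borel \<Otimes>\<^sub>M borel)"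
    using smooth_on_imp_continuous_on[OF smooth_m]
    by (simp add: borel_prod case_prod_beta borel_measurable_continuous_onI)
  have [measurable]: "(\<lambda>x. m (f x) (g x)) \<in> borel_measurable M"
    if [measurable]: "f \<in> borel_measurable M" "g \<in> borel_measurable M" for f g and M :: "'b measure"
  proof -
    have "(\<lambda>x. (f x, g x)) \<in> M \<rightarrow>\<^sub>M borel \<Otimes>\<^sub>M borel" by measurable
    from measurable_compose[OF this \<open>(\<lambda>z. m (fst z) (snd z)) \<in> borel_measurable (borel \<Otimes>\<^sub>M borel)\<close>]
    show ?thesis by simp
  qed
  \<comment> \<open>The unit ball is symmetric under inversion, which is negation in these
    coordinates, and has finite mass for both measures.\<close>
  define g where "g = (indicator (cball (0::'a) 1) :: 'a \<Rightarrow> ennreal)"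
  have g [measurable]: "g \<in> borel_measurable borel"
    unfolding g_def by (intro borel_measurable_indicator borel_closed closed_cball)
  have g_minus: "g (- x) = g x" for x by (simp add: g_def indicator_def)
  have main: "(\<integral>\<^sup>+x. F x \<partial>\<nu>) * (\<integral>\<^sup>+y. g y \<partial>lborel) = (\<integral>\<^sup>+y. F y \<partial>lborel) * (\<integral>\<^sup>+x. g x \<partial>\<nu>)"
    if F [measurable]: "F \<in> borel_measurable borel" for F
  proof -
    have "(\<integral>\<^sup>+x. F x \<partial>\<nu>) * (\<integral>\<^sup>+y. g y \<partial>lborel) = (\<integral>\<^sup>+x. F x * (\<integral>\<^sup>+y. g y \<partial>lborel) \<partial>\<nu>)"
      by (simp add: nn_integral_multc)
    also have "\<dots> = (\<integral>\<^sup>+x. (\<integral>\<^sup>+y. F x * g (m (- x) y) \<partial>lborel) \<partial>\<nu>)"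
      by (simp add: nn_integral_cmult nn_integral_left_translation)
    also have "\<dots> = (\<integral>\<^sup>+y. (\<integral>\<^sup>+x. F x * g (m (- x) y) \<partial>\<nu>) \<partial>lborel)"
      by (rule P.Fubini'[symmetric]) measurable
    also have "\<dots> = (\<integral>\<^sup>+y. (\<integral>\<^sup>+x. F (m y x) * g x \<partial>\<nu>) \<partial>lborel)"
    proof (rule nn_integral_cong)
      \<comment> \<open>Left invariance of \<open>\<nu>\<close> allows \<open>x\<close> to be
        replaced by \<open>m y x\<close>; then \<open>m (- x) y\<close> turns into
        \<open>- x\<close>, and the symmetry of \<open>g\<close> removes the sign.\<close>
      fix y
      have "(\<integral>\<^sup>+x. F x * g (m (- x) y) \<partial>\<nu>) = (\<integral>\<^sup>+x. F (m y x) * g (m (- m y x) y) \<partial>\<nu>)"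
        by (rule inv[symmetric]) measurable
      then show "(\<integral>\<^sup>+x. F x * g (m (- x) y) \<partial>\<nu>) = (\<integral>\<^sup>+x. F (m y x) * g x \<partial>\<nu>)"
        by (simp add: minus_m assoc g_minus)
    qed
    also have "\<dots> = (\<integral>\<^sup>+x. (\<integral>\<^sup>+y. F (m y x) * g x \<partial>lborel) \<partial>\<nu>)"
      by (rule P.Fubini') measurable
    also have "\<dots> = (\<integral>\<^sup>+y. F y \<partial>lborel) * (\<integral>\<^sup>+x. g x \<partial>\<nu>)"
      by (simp add: nn_integral_multc nn_integral_right_translation nn_integral_cmult)
    finally show ?thesis .
  qed
  define a where "a = measure lborel (cball (0::'a) 1)"
  define b where "b = measure \<nu> (cball (0::'a) 1)"
  have a: "(\<integral>\<^sup>+y. g y \<partial>lborel) = ennreal a" "0 < a"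
    using content_cball_pos[of 1 "0::'a"] emeasure_lborel_cball_finite[of "0::'a" 1]
    by (simp_all add: g_def a_def emeasure_eq_ennreal_measure less_top[symmetric] infinity_ennreal_def)
  have b: "(\<integral>\<^sup>+y. g y \<partial>\<nu>) = ennreal b" "0 \<le> b"
    using fin[of 1] by (auto simp: g_def b_def emeasure_eq_ennreal_measure less_top)
  have eq: "(\<integral>\<^sup>+x. F x \<partial>\<nu>) = ennreal (b / a) * (\<integral>\<^sup>+x. F x \<partial>lborel)"
    if "F \<in> borel_measurable borel" for F
  proof -
    have "(\<integral>\<^sup>+x. F x \<partial>\<nu>) = (\<integral>\<^sup>+x. F x \<partial>\<nu>) * ennreal a * ennreal (1 / a)"
      using a(2) by (simp add: mult.assoc ennreal_mult[symmetric])
    also have "\<dots> = (\<integral>\<^sup>+x. F x \<partial>lborel) * (ennreal b * ennreal (1 / a))"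
      using main[OF that] a b by (simp add: mult.assoc)
    also have "ennreal b * ennreal (1 / a) = ennreal (b / a)"
      using a(2) b(2) by (simp add: ennreal_mult[symmetric])
    finally have "(\<integral>\<^sup>+x. F x \<partial>\<nu>) = (\<integral>\<^sup>+x. F x \<partial>lborel) * ennreal (b / a)" .
    also have "\<dots> = ennreal (b / a) * (\<integral>\<^sup>+x. F x \<partial>lborel)"
      by (rule mult.commute)
    finally show ?thesis .
  qed
  have "b \<noteq> 0"
    using eq[of "\<lambda>_. 1"] nz by (auto simp: space)
  then show ?thesis using that[of "b / a"] eq a(2) b(2) by auto
qed

end

section \<open>Hardy's inequality on the line\<close>

text \<open>Only the point \<open>x = 0\<close> is not covered by the library, and there \<open>1 < p\<close> is needed.\<close>

lemma has_real_derivative_abs_powr: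
  fixes p x :: real
  assumes "1 < p" "0 \<le> x"
  shows "((\<lambda>x. \<bar>x\<bar> powr p) has_real_derivative p * x powr (p - 1)) (at x)"
proof (cases "x = 0")
  case True
  have "((\<lambda>h. \<bar>h\<bar> powr (p - 1)) \<longlongrightarrow> 0) (at (0::real))"
    by (rule tendsto_zero_powrI[where b = "p - 1"]) (use \<open>1 < p\<close> in \<open>auto intro!: tendsto_eq_intros\<close>)
  then have "((\<lambda>h. norm ((\<bar>h\<bar> powr p - 0) / h)) \<longlongrightarrow> 0) (at (0::real))"
  proof (rule Lim_transform_eventually)
    show "\<forall>\<^sub>F h in at 0. \<bar>h\<bar> powr (p - 1) = norm ((\<bar>h\<bar> powr p - 0) / h)"
      by (auto simp: eventually_at_filter powr_diff)
  qed
  then have "((\<lambda>h. (\<bar>h\<bar> powr p - 0) / h) \<longlongrightarrow> 0) (at (0::real))"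
    by (simp only: tendsto_norm_zero_iff)
  then show ?thesis using True by (simp add: has_field_derivative_iff)
next
  case False
  with assms have "0 < x" by simp
  then have "((\<lambda>x. x powr p) has_real_derivative p * x powr (p - 1)) (at x)"
    by (rule has_real_derivative_powr)
  then show ?thesis
    by (rule DERIV_cong_ev[THEN iffD1, rotated 3, OF _ refl _ refl])
      (use \<open>0 < x\<close> in \<open>auto simp: eventually_nhds intro!: exI[of _ "{0<..}"]\<close>)
qed

text \<open>Young's inequality turns \<open>X\<^sup>p - q\<^sup>p g\<^sup>p\<close>, where \<open>X = U / t\<close>, into at most the derivative of
  \<open>- q U\<^sup>p t\<^sup>1\<^sup>-\<^sup>p\<close>, whose boundary term at \<open>0\<close> vanishes.\<close>

lemma hardy_truncated:
  fixes U g :: "real \<Rightarrow> real" and p :: real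
  assumes p: "1 < p" and q: "q = p / (p - 1)"
    and U: "\<And>t. (U has_real_derivative g t) (at t)" and U0: "\<And>t. 0 \<le> t \<Longrightarrow> 0 \<le> U t"
    and g: "continuous_on UNIV g" "\<And>t. 0 \<le> g t"
    and ab: "0 < a" "a \<le> b"
  shows "(\<integral>\<^sup>+t. ennreal ((U t / t) powr p) * indicator {a..b} t \<partial>lborel) \<le>
    ennreal (q powr p) * (\<integral>\<^sup>+t. ennreal (g t powr p) * indicator {0<..} t \<partial>lborel) +
    ennreal (q * (a * (U a / a) powr p))"
proof -
  have q1: "1 < q" using p unfolding q by (simp add: less_divide_eq)
  have pq: "1 / p + 1 / q = 1" using p unfolding q by (simp add: field_simps)
  \<comment> \<open>The absolute value keeps \<open>H\<close> differentiable at positive times where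
    \<open>U\<close> vanishes.\<close>
  define H where "H t = - q * (\<bar>U t\<bar> powr p * t powr (1 - p))" for t
  define X where "X t = U t / t" for t
  define H' where "H' t = p * (X t powr p - q * X t powr (p - 1) * g t)" for t
  have HH: "(H has_real_derivative H' t) (at t)" if t: "0 < t" for t
  proof -
    have d: "((\<lambda>t. \<bar>U t\<bar> powr p) has_real_derivative p * U t powr (p - 1) * g t) (at t)"
      using DERIV_chain[OF has_real_derivative_abs_powr[OF p] U, of t] U0 t by (simp add: o_def)
    have "(H has_real_derivative - q * (\<bar>U t\<bar> powr p * ((1 - p) * t powr (1 - p - 1)) +
        p * U t powr (p - 1) * g t * t powr (1 - p))) (at t)"
      unfolding H_def
      by (rule DERIV_cong[OF DERIV_cmult[OF DERIV_mult[OF d has_real_derivative_powr[OF t]]]]) simp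
    moreover have "- q * (1 - p) = p" using p q by (simp add: field_simps)
    moreover have "X t powr p = U t powr p * t powr (- p)" "X t powr (p - 1) = U t powr (p - 1) * t powr (1 - p)"
      using U0[of t] t by (simp_all add: X_def powr_divide powr_minus_divide powr_diff)
    ultimately show ?thesis
      using U0[of t] t unfolding H'_def by (elim DERIV_cong) (simp add: algebra_simps, algebra)
  qed
  have pt: "X t powr p \<le> q powr p * g t powr p + H' t" if t: "0 < t" for t
  proof -
    have X0: "0 \<le> X t" using U0 t by (simp add: X_def)
    \<comment> \<open>The conjugate exponent sends \<open>X powr (p - 1)\<close> to
      \<open>X powr p\<close>. Multiplied by \<open>p\<close>, this term has coefficient
      \<open>p / q = p - 1\<close>, so exactly one copy of \<open>X powr p\<close> survives against
      the \<open>p\<close> copies in \<open>H'\<close>.\<close>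
    have "(q * g t) * X t powr (p - 1) \<le> (q * g t) powr p / p + (X t powr (p - 1)) powr q / q"
      by (rule Youngs_inequality[OF p q1 pq]) (use q1 g(2) in auto)
    also have "(X t powr (p - 1)) powr q = X t powr p"
      using p by (simp add: powr_powr q)
    finally have "p * (q * g t * X t powr (p - 1)) \<le> p * ((q * g t) powr p / p + X t powr p / q)"
      using p by (intro mult_left_mono) auto
    also have "\<dots> = (q * g t) powr p + (p - 1) * X t powr p"
      using p by (simp add: q field_simps)
    also have "(q * g t) powr p = q powr p * g t powr p"
      using q1 g(2) by (simp add: powr_mult)
    finally show ?thesis by (simp add: H'_def algebra_simps)
  qed
  have contU: "continuous_on S U" for S
    by (rule DERIV_continuous_on[OF has_field_derivative_at_within[OF U]])
  have iX: "(\<lambda>t. X t powr p) integrable_on {a..b}"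
    unfolding X_def
  proof (intro integrable_continuous_interval continuous_on_powr' continuous_on_const)
    show "continuous_on {a..b} (\<lambda>t. U t / t)"
      using contU[of "{a..b}"] ab by (intro continuous_on_divide continuous_on_id) auto
  qed (use ab p U0 in auto)
  have ig: "(\<lambda>t. g t powr p) integrable_on {a..b}"
    by (intro integrable_continuous_interval continuous_on_powr' continuous_on_const
        continuous_on_subset[OF g(1)]) (use p g(2) in auto)
  have iH: "(H' has_integral (H b - H a)) {a..b}"
    by (rule fundamental_theorem_of_calculus)
      (use ab HH in \<open>auto simp: has_real_derivative_iff_has_vector_derivative[symmetric] intro: has_field_derivative_at_within\<close>)
  have "(\<integral>\<^sup>+t. ennreal ((U t / t) powr p) * indicator {a..b} t \<partial>lborel) =
      ennreal (integral {a..b} (\<lambda>t. X t powr p))"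
    unfolding X_def[symmetric]
    by (rule nn_integral_has_integral_lebesgue') (use iX in auto)
  also have "integral {a..b} (\<lambda>t. X t powr p) \<le> q powr p * integral {a..b} (\<lambda>t. g t powr p) + (H b - H a)"
  proof (rule has_integral_le)
    show "((\<lambda>t. X t powr p) has_integral integral {a..b} (\<lambda>t. X t powr p)) {a..b}" using iX by auto
    show "((\<lambda>t. q powr p * g t powr p + H' t) has_integral
        q powr p * integral {a..b} (\<lambda>t. g t powr p) + (H b - H a)) {a..b}"
      using ig iH by (intro has_integral_add has_integral_mult_right) auto
  qed (use pt ab in auto)
  also have "\<dots> \<le> q powr p * integral {a..b} (\<lambda>t. g t powr p) + q * (a * (U a / a) powr p)"
  proof -
    have "H b \<le> 0" using q1 by (simp add: H_def)
    moreover have "- H a = q * (a * (U a / a) powr p)"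
      using U0[of a] ab by (simp add: H_def powr_divide powr_diff)
    ultimately show ?thesis by simp
  qed
  finally have "(\<integral>\<^sup>+t. ennreal ((U t / t) powr p) * indicator {a..b} t \<partial>lborel) \<le>
      ennreal (q powr p * integral {a..b} (\<lambda>t. g t powr p) + q * (a * (U a / a) powr p))"
    by (simp add: ennreal_leI)
  also have "\<dots> = ennreal (q powr p) * ennreal (integral {a..b} (\<lambda>t. g t powr p)) +
      ennreal (q * (a * (U a / a) powr p))"
    using q1 ab ig by (simp add: ennreal_mult integral_nonneg)
  also have "ennreal (integral {a..b} (\<lambda>t. g t powr p)) =
      (\<integral>\<^sup>+t. ennreal (g t powr p) * indicator {a..b} t \<partial>lborel)"
    by (rule nn_integral_has_integral_lebesgue'[symmetric]) (use ig in auto)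
  also have "\<dots> \<le> (\<integral>\<^sup>+t. ennreal (g t powr p) * indicator {0<..} t \<partial>lborel)"
    by (rule nn_integral_mono) (use ab in \<open>auto simp: indicator_def\<close>)
  finally show ?thesis by (simp add: add_right_mono mult_left_mono)
qed

text \<open>Exhaust the half line by compact intervals. At the left end \<open>a\<close> the
  boundary term is \<open>q a (U a / a) powr p\<close>; since \<open>U a / a\<close> tends to
  \<open>g 0\<close>, the extra factor \<open>a\<close> sends it to \<open>0\<close>.\<close>

lemma hardy_half_line:
  fixes U g :: "real \<Rightarrow> real" and p :: real
  assumes p: "1 < p" and q: "q = p / (p - 1)"
    and U: "\<And>t. (U has_real_derivative g t) (at t)" and U0: "U 0 = 0"
    and g: "continuous_on UNIV g" "\<And>t. 0 \<le> g t"
  shows "(\<integral>\<^sup>+t. ennreal ((U t / t) powr p) * indicator {0<..} t \<partial>lborel) \<le>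
    ennreal (q powr p) * (\<integral>\<^sup>+t. ennreal (g t powr p) * indicator {0<..} t \<partial>lborel)"
    (is "?L \<le> ?R")
proof -
  have Upos: "0 \<le> U t" if "0 \<le> t" for t
    using DERIV_nonneg_imp_nondecreasing[OF that, of U] U g(2) U0 by metis
  have [measurable]: "U \<in> borel_measurable borel"
    by (intro borel_measurable_continuous_onI DERIV_continuous_on[OF U])
  define A where "A n = {1 / real (Suc n)..real (Suc n)}" for n
  define f where "f n t = ennreal ((U t / t) powr p) * indicator (A n) t" for n t
  have "(\<lambda>n. \<integral>\<^sup>+t. f n t \<partial>lborel) \<longlonglongrightarrow> ?L"
  proof (rule nn_integral_LIMSEQ)
    have "A m \<subseteq> A n" if "m \<le> n" for m n
    proof -
      have "1 / real (Suc n) \<le> 1 / real (Suc m)" using that by (intro frac_le) auto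
      then show ?thesis using that by (auto simp: A_def)
    qed
    then show "incseq f"
      by (auto simp: incseq_def le_fun_def f_def indicator_def)
    show "f n \<in> borel_measurable lborel" for n by (simp add: f_def[abs_def] A_def)
    show "(\<lambda>n. f n t) \<longlonglongrightarrow> ennreal ((U t / t) powr p) * indicator {0<..} t" for t
    proof (cases "0 < t")
      case True
      obtain k1 where k1: "1 / real (Suc k1) < t" using True reals_Archimedean[OF True] by (auto simp: inverse_eq_divide)
      obtain k2 where k2: "t \<le> real k2" using real_arch_simple by blast
      have "t \<in> A n" if "max k1 k2 \<le> n" for n
      proof -
        have "1 / real (Suc n) \<le> 1 / real (Suc k1)" using that by (intro frac_le) auto
        then show ?thesis using k1 k2 that by (auto simp: A_def)
      qed
      then have "\<forall>\<^sub>F n in sequentially. f n t = ennreal ((U t / t) powr p) * indicator {0<..} t"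
        unfolding eventually_sequentially using True by (intro exI[of _ "max k1 k2"]) (auto simp: f_def)
      then show ?thesis by (rule tendsto_eventually)
    next
      case False
      have "t \<notin> A n" for n
      proof -
        have "0 < 1 / real (Suc n)" by simp
        then show ?thesis using False unfolding A_def atLeastAtMost_iff by linarith
      qed
      then show ?thesis using False by (simp add: f_def)
    qed
  qed
  moreover have "(\<lambda>n. ?R + ennreal (q * (1 / real (Suc n) * (U (1 / real (Suc n)) / (1 / real (Suc n))) powr p))) \<longlonglongrightarrow> ?R + ennreal (q * (0 * g 0 powr p))"
  proof (intro tendsto_add tendsto_const tendsto_ennrealI tendsto_mult tendsto_powr')
    show inv: "(\<lambda>n. 1 / real (Suc n)) \<longlonglongrightarrow> 0" by (rule LIMSEQ_Suc) (rule lim_1_over_n)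
    have "((\<lambda>t. U t / t) \<longlongrightarrow> g 0) (at 0)"
      using U[of 0] U0 by (simp add: has_field_derivative_iff)
    moreover have "filterlim (\<lambda>n. 1 / real (Suc n)) (at 0) sequentially"
      unfolding filterlim_at using inv by auto
    ultimately show "(\<lambda>n. U (1 / real (Suc n)) / (1 / real (Suc n))) \<longlonglongrightarrow> g 0"
      by (rule filterlim_compose)
  qed (use p Upos in \<open>auto intro!: always_eventually\<close>)
  moreover have "(\<integral>\<^sup>+t. f n t \<partial>lborel) \<le>
      ?R + ennreal (q * (1 / real (Suc n) * (U (1 / real (Suc n)) / (1 / real (Suc n))) powr p))" for n
    unfolding f_def A_def by (rule hardy_truncated[OF p q U Upos g]) (auto simp: field_simps)
  ultimately have "?L \<le> ?R + ennreal (q * (0 * g 0 powr p))"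
    by (intro LIMSEQ_le) auto
  then show ?thesis by simp
qed

text \<open>Reduction to the scalar case: the arc length \<open>U\<close> from time \<open>0\<close>
  dominates \<open>norm (F t - F 0)\<close>, and its derivative is exactly
  \<open>norm (F' t)\<close>.\<close>

lemma hardy_half_line_curve:
  fixes F :: "real \<Rightarrow> 'a::real_normed_vector" and p :: real
  assumes p: "1 < p" and q: "q = p / (p - 1)"
    and F: "\<And>t. (F has_vector_derivative F' t) (at t)" and F': "continuous_on UNIV F'"
  shows "(\<integral>\<^sup>+t. ennreal ((norm (F t - F 0) / t) powr p) * indicator {0<..} t \<partial>lborel) \<le>
    ennreal (q powr p) * (\<integral>\<^sup>+t. ennreal (norm (F' t) powr p) * indicator {0<..} t \<partial>lborel)"
proof -
  have g: "continuous_on UNIV (\<lambda>t. norm (F' t))" using F' by (intro continuous_intros)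
  have "\<exists>V. \<forall>x. - \<infinity> < ereal x \<longrightarrow> ereal x < \<infinity> \<longrightarrow> (V has_vector_derivative norm (F' x)) (at x)"
    by (rule einterval_antiderivative) (use g in \<open>auto simp: continuous_on_eq_continuous_at\<close>)
  then obtain V where V: "(V has_real_derivative norm (F' x)) (at x)" for x
    by (auto simp: has_real_derivative_iff_has_vector_derivative)
  define U where "U t = V t - V 0" for t
  have U: "(U has_real_derivative norm (F' t)) (at t)" for t
    unfolding U_def by (auto intro!: derivative_eq_intros V)
  have bound: "norm (F t - F 0) \<le> U t" if "0 < t" for t
  proof -
    have "norm (F t - F 0) \<le> U t - U 0"
    proof (rule differentiable_bound_general[OF that])
      show "continuous_on {0..t} F"
        by (meson F continuous_at_imp_continuous_on has_vector_derivative_continuous)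
      show "continuous_on {0..t} U"
        by (rule DERIV_continuous_on[OF has_field_derivative_at_within[OF U]])
    qed (use F U in \<open>auto simp: has_real_derivative_iff_has_vector_derivative\<close>)
    then show ?thesis by (simp add: U_def)
  qed
  have "(\<integral>\<^sup>+t. ennreal ((norm (F t - F 0) / t) powr p) * indicator {0<..} t \<partial>lborel) \<le>
      (\<integral>\<^sup>+t. ennreal ((U t / t) powr p) * indicator {0<..} t \<partial>lborel)"
    by (rule nn_integral_mono)
      (use bound p in \<open>auto simp: indicator_def intro!: ennreal_leI powr_mono2 divide_right_mono\<close>)
  also have "\<dots> \<le> ennreal (q powr p) * (\<integral>\<^sup>+t. ennreal (norm (F' t) powr p) * indicator {0<..} t \<partial>lborel)"
    by (rule hardy_half_line[OF p q U]) (use g in \<open>auto simp: U_def\<close>)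
  finally show ?thesis .
qed

lemma nn_integral_split_at:
  fixes f :: "real \<Rightarrow> ennreal"
  assumes [measurable]: "f \<in> borel_measurable borel"
  shows "(\<integral>\<^sup>+t. f t \<partial>lborel) = (\<integral>\<^sup>+t. f (T + t) * indicator {0<..} t \<partial>lborel) +
    (\<integral>\<^sup>+t. f (T - t) * indicator {0<..} t \<partial>lborel)"
proof -
  have "(\<integral>\<^sup>+t. f t \<partial>lborel) = (\<integral>\<^sup>+t. f (T + t) \<partial>lborel)"
    by (subst nn_integral_real_affine[where c = 1 and t = T]) auto
  also have "\<dots> = (\<integral>\<^sup>+t. f (T + t) * indicator {0<..} t + f (T + t) * indicator {..<0} t \<partial>lborel)"
  proof (rule nn_integral_cong_AE)
    have "AE t in lborel. t \<noteq> (0::real)" by (rule AE_lborel_singleton)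
    then show "AE t in lborel. f (T + t) = f (T + t) * indicator {0<..} t + f (T + t) * indicator {..<0} t"
      by eventually_elim (auto simp: indicator_def)
  qed
  also have "\<dots> = (\<integral>\<^sup>+t. f (T + t) * indicator {0<..} t \<partial>lborel) + (\<integral>\<^sup>+t. f (T + t) * indicator {..<0} t \<partial>lborel)"
    by (rule nn_integral_add) auto
  also have "(\<integral>\<^sup>+t. f (T + t) * indicator {..<0} t \<partial>lborel) = (\<integral>\<^sup>+t. f (T - t) * indicator {0<..} t \<partial>lborel)"
    by (subst nn_integral_real_affine[where c = "-1" and t = 0]) (auto simp: indicator_def)
  finally show ?thesis .
qed

text \<open>The half-line inequality is applied to both rays issuing from \<open>T\<close>, after
  reflecting the left one.\<close>

lemma hardy_line:
  fixes F :: "real \<Rightarrow> 'a::{real_normed_vector, second_countable_topology}" and p T :: real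
  assumes p: "1 < p" and q: "q = p / (p - 1)"
    and F: "\<And>t. (F has_vector_derivative F' t) (at t)" and F': "continuous_on UNIV F'"
  shows "(\<integral>\<^sup>+t. ennreal ((norm (F t - F T) / \<bar>T - t\<bar>) powr p) \<partial>lborel) \<le>
    ennreal (q powr p) * (\<integral>\<^sup>+t. ennreal (norm (F' t) powr p) \<partial>lborel)"
proof -
  have "continuous_on UNIV F"
    by (meson F continuous_at_imp_continuous_on has_vector_derivative_continuous)
  then have [measurable]: "F \<in> borel_measurable borel" "F' \<in> borel_measurable borel"
    using F' by (auto intro: borel_measurable_continuous_onI)
  have 1: "((\<lambda>t. F (T + t)) has_vector_derivative F' (T + t)) (at t)" for t
  proof -
    have "((\<lambda>s. T + s) has_vector_derivative 1) (at t)" by (auto intro!: derivative_eq_intros)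
    from vector_diff_chain_at[OF this F] show ?thesis by (simp add: o_def)
  qed
  have 2: "((\<lambda>t. F (T - t)) has_vector_derivative - F' (T - t)) (at t)" for t
  proof -
    have "((\<lambda>s. T - s) has_vector_derivative - 1) (at t)" by (auto intro!: derivative_eq_intros)
    from vector_diff_chain_at[OF this F] show ?thesis by (simp add: o_def)
  qed
  have c: "continuous_on UNIV (\<lambda>t. F' (T + t))" "continuous_on UNIV (\<lambda>t. - F' (T - t))"
    by (auto intro!: continuous_intros continuous_on_compose2[OF F'])
  have indicator_mult_abs: "ennreal ((c / \<bar>t\<bar>) powr p) * indicator {0<..} t =
      ennreal ((c / t) powr p) * indicator {0<..} t" for c t :: real
    by (simp add: indicator_def)
  have "(\<integral>\<^sup>+t. ennreal ((norm (F (T + t) - F T) / \<bar>T - (T + t)\<bar>) powr p) * indicator {0<..} t \<partial>lborel)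
      \<le> ennreal (q powr p) * (\<integral>\<^sup>+t. ennreal (norm (F' (T + t)) powr p) * indicator {0<..} t \<partial>lborel)"
    using hardy_half_line_curve[OF p q 1 c(1)] by (simp add: indicator_mult_abs)
  moreover have "(\<integral>\<^sup>+t. ennreal ((norm (F (T - t) - F T) / \<bar>T - (T - t)\<bar>) powr p) * indicator {0<..} t \<partial>lborel)
      \<le> ennreal (q powr p) * (\<integral>\<^sup>+t. ennreal (norm (F' (T - t)) powr p) * indicator {0<..} t \<partial>lborel)"
    using hardy_half_line_curve[OF p q 2 c(2)] by (simp add: indicator_mult_abs)
  ultimately show ?thesis
    unfolding nn_integral_split_at[of "\<lambda>t. ennreal ((norm (F t - F T) / \<bar>T - t\<bar>) powr p)" T, simplified]
    by (subst nn_integral_split_at[where T = T]) (auto simp: distrib_left intro: add_mono)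
qed

section \<open>Dilations and averaging over orbits\<close>

text \<open>The dilations in linear coordinates that diagonalise \<open>A\<close>.\<close>

definition diag_dilation :: "('a::euclidean_space \<Rightarrow> real) \<Rightarrow> real \<Rightarrow> 'a \<Rightarrow> 'a" where
  "diag_dilation c r x = (\<Sum>b\<in>Basis. (r powr c b * (x \<bullet> b)) *\<^sub>R b)"

lemma diag_dilation_inner [simp]: "b \<in> Basis \<Longrightarrow> diag_dilation c r x \<bullet> b = r powr c b * (x \<bullet> b)"
  by (simp add: diag_dilation_def)

lemma linear_diag_dilation: "linear (diag_dilation c r)"
  unfolding diag_dilation_def[abs_def] by (rule linear_diagonal)

lemma diag_dilation_compose:
  "0 \<le> r \<Longrightarrow> 0 \<le> s \<Longrightarrow> diag_dilation c r (diag_dilation c s x) = diag_dilation c (r * s) x"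
  by (auto simp: euclidean_eq_iff[where 'a='a] powr_mult)

lemma diag_dilation_1 [simp]: "diag_dilation c 1 x = x"
  by (auto simp: euclidean_eq_iff[where 'a='a])

lemma diag_dilation_measurable [measurable]:
  assumes [measurable]: "r \<in> borel_measurable M" "f \<in> borel_measurable M"
  shows "(\<lambda>x. diag_dilation c (r x) (f x)) \<in> borel_measurable M"
  unfolding diag_dilation_def by measurable

lemma nn_integral_diag_dilation:
  assumes F: "F \<in> borel_measurable borel" and r: "0 < r"
  shows "(\<integral>\<^sup>+x. F (diag_dilation c r x) \<partial>lborel) =
    ennreal (r powr - (\<Sum>b\<in>Basis. c b)) * (\<integral>\<^sup>+x. F (x::'a::euclidean_space) \<partial>lborel)"
proof (rule nn_integral_lborel_const_det)
  have "(\<Prod>b\<in>Basis. (1 / r) powr c b) = r powr - (\<Sum>b\<in>(Basis::'a set). c b)"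
    using r by (simp add: powr_sum powr_divide powr_minus_divide prod_dividef)
  then show "\<bar>edet (diag_dilation c (1 / r))\<bar> = r powr - (\<Sum>b\<in>(Basis::'a set). c b)"
    by (subst edet_eigenbasis(1)[where P = "\<lambda>x. x" and P' = "\<lambda>x. x" and d = "\<lambda>b. (1 / r) powr c b"])
      (auto simp: linear_diag_dilation linear_id[unfolded id_def] diag_dilation_def
        diagonal_Basis)
  show "(diag_dilation c (1 / r) has_derivative diag_dilation c (1 / r)) (at x)" for x :: 'a
    by (rule bounded_linear_imp_has_derivative[OF linear_diag_dilation[unfolded linear_conv_bounded_linear]])
qed (use r F in \<open>auto simp: diag_dilation_compose\<close>)

text \<open>Here the group law has disappeared: dilations, the quasi-norm in diagonal coordinates
  and Lebesgue measure carry the whole inequality.\<close>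

locale diagonal_dilation =
  fixes c n :: "'a::euclidean_space \<Rightarrow> real"
  assumes c_pos: "b \<in> Basis \<Longrightarrow> 0 < c b"
    and n_continuous: "continuous_on UNIV n"
    and n_nonneg: "0 \<le> n x"
    and n_eq_0: "n x = 0 \<longleftrightarrow> x = 0"
    and n_dilation: "0 < r \<Longrightarrow> n (diag_dilation c r x) = r * n x"
begin

abbreviation dil :: "real \<Rightarrow> 'a \<Rightarrow> 'a" where
  "dil \<equiv> diag_dilation c"

definition Q :: real where
  "Q = (\<Sum>b\<in>Basis. c b)"

lemma Q_nonneg: "0 \<le> Q"
  unfolding Q_def by (rule sum_nonneg) (simp add: c_pos less_imp_le)

lemma n_pos: "x \<noteq> 0 \<Longrightarrow> 0 < n x"
  using n_nonneg[of x] n_eq_0[of x] by linarith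

lemma n_measurable [measurable]: "n \<in> borel_measurable borel"
  using n_continuous by (rule borel_measurable_continuous_onI)

text \<open>The measure \<open>n x powr - Q dx\<close> is dilation invariant, so that it may be averaged over the orbits;
  the fundamental domain \<open>1 \<le> n x < e\<close> of \<open>dil (exp 1)\<close> plays the role of the sphere in polar
  coordinates. The origin does not contribute since \<open>0 powr - Q = 0\<close>.\<close>

lemma nn_integral_orbits:
  assumes H [measurable]: "H \<in> borel_measurable borel"
  shows "(\<integral>\<^sup>+x. H x * ennreal (n x powr - Q) \<partial>lborel) =
    (\<integral>\<^sup>+x. indicator {1..<exp 1} (n x) * ennreal (n x powr - Q) * (\<integral>\<^sup>+t. H (dil (exp t) x) \<partial>lborel) \<partial>lborel)"
proof -
  define w where "w x = indicator {1..<exp 1} (n x) * ennreal (n x powr - Q)" for x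
  have [measurable]: "w \<in> borel_measurable borel" unfolding w_def by measurable
  have "(\<integral>\<^sup>+x. w x * (\<integral>\<^sup>+t. H (dil (exp t) x) \<partial>lborel) \<partial>lborel) =
      (\<integral>\<^sup>+x. (\<integral>\<^sup>+t. w x * H (dil (exp t) x) \<partial>lborel) \<partial>lborel)"
    by (simp add: nn_integral_cmult)
  also have "\<dots> = (\<integral>\<^sup>+t. (\<integral>\<^sup>+x. w x * H (dil (exp t) x) \<partial>lborel) \<partial>lborel)"
    by (rule lborel_pair.Fubini') measurable
  also have "\<dots> = (\<integral>\<^sup>+t. (\<integral>\<^sup>+x. ennreal (exp t powr - Q) * (w (dil (exp (- t)) x) * H x) \<partial>lborel) \<partial>lborel)"
  proof (rule nn_integral_cong)
    fix t :: real
    \<comment> \<open>The dilation is moved from \<open>H\<close> to the cut-off \<open>w\<close> by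
      rescaling \<open>x\<close>. The Jacobian is then absorbed by the homogeneity of
      \<open>n x powr - Q\<close>.\<close>
    have "w x * H (dil (exp t) x) = w (dil (exp (- t)) (dil (exp t) x)) * H (dil (exp t) x)" for x
      by (simp add: diag_dilation_compose exp_minus)
    then show "(\<integral>\<^sup>+x. w x * H (dil (exp t) x) \<partial>lborel) =
        (\<integral>\<^sup>+x. ennreal (exp t powr - Q) * (w (dil (exp (- t)) x) * H x) \<partial>lborel)"
      using nn_integral_diag_dilation[of "\<lambda>x. w (dil (exp (- t)) x) * H x" "exp t" c]
      by (simp add: nn_integral_cmult Q_def)
  qed
  also have "\<dots> = (\<integral>\<^sup>+t. (\<integral>\<^sup>+x. indicator {1..<exp 1} (exp (- t) * n x) * (H x * ennreal (n x powr - Q)) \<partial>lborel) \<partial>lborel)"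
  proof (intro nn_integral_cong)
    fix t :: real and x :: 'a
    have *: "ennreal (exp t powr - Q) * ennreal ((exp (- t) * n x) powr - Q) = ennreal (n x powr - Q)"
      by (simp add: ennreal_mult[symmetric] n_nonneg powr_mult[symmetric] mult.assoc[symmetric] exp_minus)
    have "ennreal (exp t powr - Q) * (w (dil (exp (- t)) x) * H x) =
        indicator {1..<exp 1} (exp (- t) * n x) *
          (H x * (ennreal (exp t powr - Q) * ennreal ((exp (- t) * n x) powr - Q)))"
      by (simp add: w_def n_dilation mult_ac)
    then show "ennreal (exp t powr - Q) * (w (dil (exp (- t)) x) * H x) =
        indicator {1..<exp 1} (exp (- t) * n x) * (H x * ennreal (n x powr - Q))"
      by (simp only: *)
  qed
  also have "\<dots> = (\<integral>\<^sup>+x. (\<integral>\<^sup>+t. indicator {1..<exp 1} (exp (- t) * n x) * (H x * ennreal (n x powr - Q)) \<partial>lborel) \<partial>lborel)"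
    by (rule lborel_pair.Fubini'[symmetric]) measurable
  also have "\<dots> = (\<integral>\<^sup>+x. H x * ennreal (n x powr - Q) \<partial>lborel)"
  proof (rule nn_integral_cong)
    fix x :: 'a
    show "(\<integral>\<^sup>+t. indicator {1..<exp 1} (exp (- t) * n x) * (H x * ennreal (n x powr - Q)) \<partial>lborel) =
        H x * ennreal (n x powr - Q)"
    proof (cases "x = 0")
      case True
      then show ?thesis using n_eq_0[of x] by simp
    next
      case False
      \<comment> \<open>The orbit of a nonzero point meets the fundamental domain during a time
        interval of length exactly \<open>1\<close>.\<close>
      have "indicator {1..<exp 1} (exp (- t) * n x) = (indicator {ln (n x) - 1<..ln (n x)} t :: ennreal)" for t
      proof -
        have "exp (- t) * n x = exp (ln (n x) - t)"
          using n_pos[OF False] by (simp add: exp_diff exp_minus field_simps)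
        then have "exp (- t) * n x \<in> {1..<exp 1} \<longleftrightarrow> t \<in> {ln (n x) - 1<..ln (n x)}" by auto
        then show ?thesis by (simp add: indicator_def)
      qed
      then show ?thesis by (simp add: nn_integral_multc)
    qed
  qed
  finally show ?thesis by (simp add: w_def)
qed

section \<open>The Euler vector field and derivatives along orbits\<close>

definition gen :: "'a \<Rightarrow> 'a" where
  "gen x = (\<Sum>b\<in>Basis. (c b * (x \<bullet> b)) *\<^sub>R b)"

text \<open>The Euler operator, which is \<open>n x\<close> times the radial derivative at
  \<open>x \<noteq> 0\<close>. Unlike the radial derivative it does not involve the quasi-norm, so
  it is continuous for smooth \<open>f\<close>.\<close>

definition flow_deriv :: "('a \<Rightarrow> 'b::real_normed_vector) \<Rightarrow> 'a \<Rightarrow> 'b" where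
  "flow_deriv f x = frechet_derivative f (at x) (gen x)"

lemma dil_has_vector_derivative:
  assumes "0 < r"
  shows "((\<lambda>r. dil r x) has_vector_derivative (1 / r) *\<^sub>R gen (dil r x)) (at r)"
proof -
  have "((\<lambda>r. (r powr c b * (x \<bullet> b)) *\<^sub>R b) has_vector_derivative
      (c b * r powr (c b - 1) * (x \<bullet> b)) *\<^sub>R b) (at r)" for b
    using has_vector_derivative_scaleR[OF DERIV_cmult_right[OF has_real_derivative_powr[OF assms]]
        has_vector_derivative_const, of "c b" "x \<bullet> b" b] by simp
  then have "((\<lambda>r. dil r x) has_vector_derivative
      (\<Sum>b\<in>Basis. (c b * r powr (c b - 1) * (x \<bullet> b)) *\<^sub>R b)) (at r)"
    unfolding diag_dilation_def by (intro has_vector_derivative_sum) auto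
  also have "(\<Sum>b\<in>Basis. (c b * r powr (c b - 1) * (x \<bullet> b)) *\<^sub>R b) = (1 / r) *\<^sub>R gen (dil r x)"
    using assms by (auto simp: gen_def scaleR_sum_right powr_diff intro!: sum.cong)
  finally show ?thesis .
qed

lemma dil_compose_has_vector_derivative:
  assumes f: "smooth_on UNIV f" and "0 < r"
  shows "((\<lambda>r. f (dil r x)) has_vector_derivative (1 / r) *\<^sub>R flow_deriv f (dil r x)) (at r)"
proof -
  have f': "(f has_derivative frechet_derivative f (at (dil r x))) (at (dil r x))"
    by (rule smooth_on_has_derivative[OF f]) simp
  from has_derivative_compose[OF dil_has_vector_derivative[OF assms(2), unfolded has_vector_derivative_def] this]
  show ?thesis
    by (simp add: has_vector_derivative_def flow_deriv_def linear_scale[OF has_derivative_linear[OF f']])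
qed

lemma flow_has_vector_derivative:
  assumes f: "smooth_on UNIV f"
  shows "((\<lambda>t. f (dil (exp t) x)) has_vector_derivative flow_deriv f (dil (exp t) x)) (at t)"
proof -
  have "(exp has_vector_derivative exp t) (at t)"
    using DERIV_exp[of t] unfolding has_real_derivative_iff_has_vector_derivative .
  from vector_diff_chain_at[OF this dil_compose_has_vector_derivative[OF f exp_gt_zero]]
  show ?thesis by (simp add: o_def)
qed

lemma flow_deriv_continuous:
  assumes f: "smooth_on UNIV f"
  shows "continuous_on UNIV (flow_deriv f)"
proof -
  have "flow_deriv f = (\<lambda>x. \<Sum>b\<in>Basis. (c b * (x \<bullet> b)) *\<^sub>R frechet_derivative f (at x) b)"
  proof
    fix x
    have "linear (frechet_derivative f (at x))"
      using smooth_on_has_derivative[OF f UNIV_I] by (rule has_derivative_linear)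
    then have "flow_deriv f x = (\<Sum>b\<in>Basis. (gen x \<bullet> b) *\<^sub>R frechet_derivative f (at x) b)"
      unfolding flow_deriv_def by (rule linear_eq_sum_Basis)
    then show "flow_deriv f x = (\<Sum>b\<in>Basis. (c b * (x \<bullet> b)) *\<^sub>R frechet_derivative f (at x) b)"
      by (simp add: gen_def)
  qed
  moreover have "continuous_on UNIV (\<lambda>x. frechet_derivative f (at x) b)" for b
    by (rule smooth_on_imp_continuous_on[OF smooth_on_frechet_derivative[OF f]])
  ultimately show ?thesis by (simp, intro continuous_intros)
qed

lemma radial_has_vector_derivative:
  assumes f: "smooth_on UNIV f" and x: "x \<noteq> 0"
  shows "((\<lambda>r. f (dil r (dil (1 / n x) x))) has_vector_derivative (1 / n x) *\<^sub>R flow_deriv f x) (at (n x))"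
  using dil_compose_has_vector_derivative[OF f n_pos[OF x], of "dil (1 / n x) x"] n_pos[OF x]
  by (simp add: diag_dilation_compose)

text \<open>On an orbit both sides are the two sides of Hardy's inequality on the line, with \<open>t = ln (n x)\<close>.\<close>

definition lhs_density :: "real \<Rightarrow> real \<Rightarrow> ('a \<Rightarrow> complex) \<Rightarrow> 'a \<Rightarrow> real" where
  "lhs_density p R f x = (norm (f x - f (dil (R / n x) x)) / \<bar>ln (R / n x)\<bar>) powr p"

text \<open>All points of an orbit have the same projection to the sphere of radius
  \<open>R\<close>, so the subtracted value is frozen at the time when the orbit crosses that
  sphere.\<close>

lemma lhs_density_orbit:
  assumes "x \<noteq> 0" "0 < R"
  shows "lhs_density p R f (dil (exp t) x) =
    (norm (f (dil (exp t) x) - f (dil (exp (ln (R / n x))) x)) / \<bar>ln (R / n x) - t\<bar>) powr p"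
proof -
  have "dil (R / n (dil (exp t) x)) (dil (exp t) x) = dil (exp (ln (R / n x))) x"
    using assms n_pos[OF assms(1)] by (simp add: n_dilation diag_dilation_compose)
  moreover have "ln (R / n (dil (exp t) x)) = ln (R / n x) - t"
    using assms n_pos[OF assms(1)] by (simp add: n_dilation ln_div ln_mult)
  ultimately show ?thesis by (simp add: lhs_density_def)
qed

lemma lhs_density_measurable [measurable]:
  assumes [measurable]: "f \<in> borel_measurable borel"
  shows "lhs_density p R f \<in> borel_measurable borel"
  unfolding lhs_density_def[abs_def] by measurable

lemma smooth_on_UNIV_measurable: "smooth_on UNIV f \<Longrightarrow> f \<in> borel_measurable borel"
  by (intro borel_measurable_continuous_onI smooth_on_imp_continuous_on)

lemma hardy_orbits:
  assumes p: "1 < p" and q: "q = p / (p - 1)" and R: "0 < R" and f: "smooth_on UNIV f"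
  shows "(\<integral>\<^sup>+x. ennreal (lhs_density p R f x) * ennreal (n x powr - Q) \<partial>lborel) \<le>
    ennreal (q powr p) * (\<integral>\<^sup>+x. ennreal (norm (flow_deriv f x) powr p) * ennreal (n x powr - Q) \<partial>lborel)"
proof -
  note [measurable] = smooth_on_UNIV_measurable[OF f]
    borel_measurable_continuous_onI[OF flow_deriv_continuous[OF f]]
  define w where "w x = indicator {1..<exp 1} (n x) * ennreal (n x powr - Q)" for x
  have [measurable]: "w \<in> borel_measurable borel" unfolding w_def by measurable
  have "w x * (\<integral>\<^sup>+t. ennreal (lhs_density p R f (dil (exp t) x)) \<partial>lborel) \<le>
      w x * (ennreal (q powr p) * (\<integral>\<^sup>+t. ennreal (norm (flow_deriv f (dil (exp t) x)) powr p) \<partial>lborel))" for x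
  proof (cases "x = 0")
    case True
    then show ?thesis using n_eq_0[of x] by (simp add: w_def)
  next
    case False
    have "continuous_on UNIV (\<lambda>t. dil (exp t) x)"
      unfolding diag_dilation_def by (intro continuous_intros) auto
    then have "continuous_on UNIV (\<lambda>t. flow_deriv f (dil (exp t) x))"
      by (rule continuous_on_compose2[OF flow_deriv_continuous[OF f]]) auto
    from hardy_line[OF p q flow_has_vector_derivative[OF f] this, of "ln (R / n x)"]
    show ?thesis using False R by (intro mult_left_mono) (auto simp: lhs_density_orbit)
  qed
  then have "(\<integral>\<^sup>+x. w x * (\<integral>\<^sup>+t. ennreal (lhs_density p R f (dil (exp t) x)) \<partial>lborel) \<partial>lborel) \<le>
      (\<integral>\<^sup>+x. ennreal (q powr p) * (w x * (\<integral>\<^sup>+t. ennreal (norm (flow_deriv f (dil (exp t) x)) powr p) \<partial>lborel)) \<partial>lborel)"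
    by (intro nn_integral_mono) (simp add: mult.left_commute)
  also have "\<dots> = ennreal (q powr p) * (\<integral>\<^sup>+x. w x * (\<integral>\<^sup>+t. ennreal (norm (flow_deriv f (dil (exp t) x)) powr p) \<partial>lborel) \<partial>lborel)"
    by (rule nn_integral_cmult) measurable
  finally show ?thesis by (simp add: nn_integral_orbits w_def)
qed

lemma lhs_density_eq:
  assumes p: "1 < p"
  shows "ennreal (norm ((f x - f (dil (R / n x) x)) / of_real (n x powr (Q / p) * ln (R / n x))) powr p) =
    ennreal (lhs_density p R f x) * ennreal (n x powr - Q)"
proof -
  have "(n x powr (Q / p)) powr p = n x powr Q" using p by (simp add: powr_powr)
  then have "(u / (n x powr (Q / p) * v)) powr p = (u / v) powr p * n x powr - Q" if "0 \<le> u" "0 \<le> v" for u v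
    using that by (simp add: powr_divide powr_mult powr_minus_divide)
  then show ?thesis
    by (simp add: lhs_density_def norm_divide norm_mult abs_mult ennreal_mult[symmetric])
qed

text \<open>The weight \<open>n x powr (Q / p - 1)\<close> and the factor \<open>n x\<close>
  relating the radial derivative to the Euler operator combine to \<open>n x powr (Q / p)\<close>.
  Its power \<open>p\<close> is the weight of the invariant measure.\<close>

lemma rhs_density_eq:
  assumes p: "1 < p"
  shows "ennreal (norm (of_real (1 / n x powr (Q / p - 1)) * ((1 / n x) *\<^sub>R flow_deriv f x)) powr p) =
    ennreal (norm (flow_deriv f x :: complex) powr p) * ennreal (n x powr - Q)"
proof (cases "x = 0")
  case True
  then show ?thesis using n_eq_0[of x] by simp
next
  case False
  note n = n_pos[OF False]
  have "(n x powr (Q / p)) powr p = n x powr Q" using p by (simp add: powr_powr)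
  moreover have "n x powr (Q / p - 1) * n x = n x powr (Q / p)" using n by (simp add: powr_diff)
  then have "norm (of_real (1 / n x powr (Q / p - 1)) * ((1 / n x) *\<^sub>R flow_deriv f x)) =
      norm (flow_deriv f x) / n x powr (Q / p)"
    using n by (simp add: norm_mult norm_divide field_simps)
  ultimately have "norm (of_real (1 / n x powr (Q / p - 1)) * ((1 / n x) *\<^sub>R flow_deriv f x)) powr p =
      norm (flow_deriv f x) powr p * n x powr - Q"
    by (simp add: powr_divide powr_minus_divide)
  then show ?thesis by (simp add: ennreal_mult[symmetric])
qed

end

section \<open>Almost extremal functions\<close>

definition bump :: "real \<Rightarrow> real" where
  "bump w = flat_exp (w - 1) * flat_exp (2 - w)"

definition dbump :: "real \<Rightarrow> real" where
  "dbump w = frechet_derivative bump (at w) 1"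

lemma smooth_bump: "smooth_on UNIV bump"
  unfolding bump_def[abs_def]
  by (intro smooth_on_mult smooth_on_compose_real[OF _ _ smooth_on_flat_exp] smooth_on_diff
      smooth_on_ident smooth_on_const open_UNIV)

lemma bump_has_real_derivative: "(bump has_real_derivative dbump w) (at w)"
proof -
  have d: "(bump has_derivative frechet_derivative bump (at w)) (at w)"
    by (rule smooth_on_has_derivative[OF smooth_bump]) simp
  have "frechet_derivative bump (at w) h = dbump w * h" for h
    using linear_scale[OF has_derivative_linear[OF d], of h 1] unfolding dbump_def
    by (simp add: mult.commute)
  then have "frechet_derivative bump (at w) = (*) (dbump w)" by (rule ext)
  with d show ?thesis by (simp only: has_field_derivative_def)
qed

lemma continuous_dbump: "continuous_on S dbump"
  unfolding dbump_def[abs_def]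
  by (rule continuous_on_subset[OF smooth_on_imp_continuous_on[OF smooth_on_frechet_derivative[OF smooth_bump]]]) simp

lemma continuous_bump: "continuous_on S bump"
  by (rule continuous_on_subset[OF smooth_on_imp_continuous_on[OF smooth_bump]]) simp

lemma bump_nonneg: "0 \<le> bump w"
  by (simp add: bump_def flat_exp_nonneg)

lemma bump_eq_0: "w \<notin> {1<..<2} \<Longrightarrow> bump w = 0"
  by (auto simp: bump_def flat_exp_eq_0)

lemma dbump_eq_0:
  assumes "w \<notin> {1..2}"
  shows "dbump w = 0"
proof -
  have "((\<lambda>_. 0) has_real_derivative dbump w) (at w)"
    by (rule DERIV_cong_ev[THEN iffD1, rotated 3, OF bump_has_real_derivative refl _ refl])
      (use assms in \<open>auto simp: eventually_nhds bump_eq_0 intro!: exI[of _ "- {1..2}"]\<close>)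
  then show ?thesis using DERIV_unique[OF DERIV_const] by metis
qed

text \<open>The extremal \<open>s powr (1 / q)\<close> of Hardy's inequality, cut off on the logarithmic scale.\<close>

definition extremal :: "real \<Rightarrow> real \<Rightarrow> real \<Rightarrow> real" where
  "extremal q \<epsilon> s = (if 0 < s then s powr (1 / q) * bump (\<epsilon> * ln s) else 0)"

definition dextremal :: "real \<Rightarrow> real \<Rightarrow> real \<Rightarrow> real" where
  "dextremal q \<epsilon> s =
    (if 0 < s then s powr (1 / q - 1) * (bump (\<epsilon> * ln s) / q + \<epsilon> * dbump (\<epsilon> * ln s)) else 0)"

lemma extremal_nonneg: "0 \<le> extremal q \<epsilon> s"
  by (simp add: extremal_def bump_nonneg)

lemma extremal_support:
  assumes "0 < \<epsilon>" "extremal q \<epsilon> s \<noteq> 0"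
  shows "exp (1 / \<epsilon>) < s" "s < exp (2 / \<epsilon>)"
proof -
  have s: "0 < s" and "bump (\<epsilon> * ln s) \<noteq> 0" using assms by (auto simp: extremal_def split: if_splits)
  then have "1 < \<epsilon> * ln s" "\<epsilon> * ln s < 2" using bump_eq_0 by fastforce+
  then have "1 / \<epsilon> < ln s" "ln s < 2 / \<epsilon>" using assms(1) by (simp_all add: field_simps)
  then show "exp (1 / \<epsilon>) < s" "s < exp (2 / \<epsilon>)"
    using s by (metis exp_less_mono exp_ln)+
qed

lemma extremal_eq_0: "0 < \<epsilon> \<Longrightarrow> s \<le> 1 \<Longrightarrow> extremal q \<epsilon> s = 0"
  using extremal_support(1)[of \<epsilon> q s] one_less_exp_iff[of "1 / \<epsilon>"] by fastforce

lemma dextremal_support: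
  assumes "0 < \<epsilon>" "s \<notin> {exp (1 / \<epsilon>)..exp (2 / \<epsilon>)}"
  shows "dextremal q \<epsilon> s = 0"
proof (cases "0 < s")
  case True
  have "\<epsilon> * ln s \<notin> {1..2}"
  proof
    assume "\<epsilon> * ln s \<in> {1..2}"
    then have "1 / \<epsilon> \<le> ln s" "ln s \<le> 2 / \<epsilon>" using assms(1) by (auto simp: field_simps)
    then have "exp (1 / \<epsilon>) \<le> s" "s \<le> exp (2 / \<epsilon>)" using True by (metis exp_le_cancel_iff exp_ln)+
    then show False using assms(2) by simp
  qed
  then show ?thesis by (auto simp: dextremal_def dbump_eq_0 bump_eq_0)
qed (simp add: dextremal_def)

lemma extremal_has_real_derivative:
  assumes "0 < \<epsilon>"
  shows "(extremal q \<epsilon> has_real_derivative dextremal q \<epsilon> s) (at s)"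
proof (cases "0 < s")
  case True
  have "((\<lambda>s. bump (\<epsilon> * ln s)) has_real_derivative dbump (\<epsilon> * ln s) * (\<epsilon> / s)) (at s)"
  proof (rule DERIV_chain2[OF bump_has_real_derivative])
    show "((\<lambda>s. \<epsilon> * ln s) has_real_derivative \<epsilon> / s) (at s)"
      using True by (auto intro!: derivative_eq_intros)
  qed
  from DERIV_mult[OF has_real_derivative_powr[OF True, of "1 / q"] this]
  have "((\<lambda>s. s powr (1 / q) * bump (\<epsilon> * ln s)) has_real_derivative dextremal q \<epsilon> s) (at s)"
    by (rule DERIV_cong) (use True in \<open>simp add: dextremal_def powr_diff field_simps\<close>)
  then show ?thesis
    by (rule DERIV_cong_ev[THEN iffD1, rotated 3, OF _ refl _ refl])
      (use True in \<open>auto simp: eventually_nhds extremal_def intro!: exI[of _ "{0<..}"]\<close>)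
next
  case False
  have "((\<lambda>s. 0) has_real_derivative 0) (at s)" by simp
  then have "(extremal q \<epsilon> has_real_derivative 0) (at s)"
    by (rule DERIV_cong_ev[THEN iffD1, rotated 3, OF _ refl _ refl])
      (use False assms in \<open>auto simp: eventually_nhds extremal_eq_0 intro!: exI[of _ "{..<1}"]\<close>)
  then show ?thesis using False by (simp add: dextremal_def)
qed

lemma extremal_measurable [measurable]: "extremal q \<epsilon> \<in> borel_measurable borel"
proof -
  have [measurable]: "bump \<in> borel_measurable borel" by (intro borel_measurable_continuous_onI continuous_bump)
  show ?thesis unfolding extremal_def[abs_def] by measurable
qed

lemma dextremal_measurable [measurable]: "dextremal q \<epsilon> \<in> borel_measurable borel"
proof -
  have [measurable]: "bump \<in> borel_measurable borel" "dbump \<in> borel_measurable borel"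
    by (intro borel_measurable_continuous_onI continuous_bump continuous_dbump)+
  show ?thesis unfolding dextremal_def[abs_def] by measurable
qed

text \<open>The substitution \<open>s = exp (w / \<epsilon>)\<close> carries the moving support to
  the fixed interval from \<open>1\<close> to \<open>2\<close>, where the limit in
  \<open>\<epsilon>\<close> can be taken.\<close>

lemma nn_integral_exp_substitution:
  assumes [measurable]: "h \<in> borel_measurable borel" and "0 < \<epsilon>"
    and supp: "\<And>s. s \<notin> {exp (1 / \<epsilon>)..exp (2 / \<epsilon>)} \<Longrightarrow> h s = 0"
  shows "(\<integral>\<^sup>+s. ennreal (h s) \<partial>lborel) =
    (\<integral>\<^sup>+w. ennreal (h (exp (w / \<epsilon>)) * (exp (w / \<epsilon>) / \<epsilon>)) * indicator {1..2} w \<partial>lborel)"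
proof -
  have "(\<integral>\<^sup>+s. ennreal (h s) \<partial>lborel) = (\<integral>\<^sup>+s. ennreal (h s * indicator {exp (1 / \<epsilon>)..exp (2 / \<epsilon>)} s) \<partial>lborel)"
    by (rule nn_integral_cong) (metis indicator_simps mult.right_neutral mult_zero_right supp)
  also have "\<dots> = (\<integral>\<^sup>+w. ennreal (h (exp (w / \<epsilon>)) * (exp (w / \<epsilon>) / \<epsilon>) * indicator {1..2} w) \<partial>lborel)"
    by (rule nn_integral_substitution)
      (use \<open>0 < \<epsilon>\<close> in \<open>auto intro!: derivative_eq_intros continuous_intros simp: set_borel_measurable_def\<close>)
  also have "\<dots> = (\<integral>\<^sup>+w. ennreal (h (exp (w / \<epsilon>)) * (exp (w / \<epsilon>) / \<epsilon>)) * indicator {1..2} w \<partial>lborel)"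
    by (rule nn_integral_cong) (simp add: indicator_def)
  finally show ?thesis .
qed

text \<open>The power \<open>s powr (1 / q)\<close> makes both integrands equal to
  \<open>1 / s\<close> up to the cut-off, so \<open>s = exp (w / \<epsilon>)\<close> leaves a common
  factor \<open>1 / \<epsilon>\<close> that cancels. As \<open>\<epsilon>\<close> tends to
  \<open>0\<close> the derivative of the cut-off drops out, and what remains is
  \<open>I \<le> C powr p * I / q powr p\<close>. The shift \<open>K\<close> models the discrepancy
  between two logarithmic radii; the support escapes to infinity, where it has no effect.\<close>

lemma hardy_line_sharp:
  assumes p: "1 < p" and q: "q = p / (p - 1)" and K: "0 \<le> K" and C: "0 \<le> C"
    and le: "\<And>\<epsilon>. 0 < \<epsilon> \<Longrightarrow> (\<integral>\<^sup>+s. ennreal ((extremal q \<epsilon> s / (s + K)) powr p) \<partial>lborel) \<le>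
      ennreal (C powr p) * (\<integral>\<^sup>+s. ennreal (\<bar>dextremal q \<epsilon> s\<bar> powr p) \<partial>lborel)"
  shows "q \<le> C"
proof -
  have q1: "1 < q" using p unfolding q by (simp add: less_divide_eq)
  have pq: "p / q = p - 1" using p unfolding q by (simp add: field_simps)
  define I where "I = integral {1..2} (\<lambda>w. bump w powr p)"
  define J where "J \<epsilon> = integral {1..2} (\<lambda>w. \<bar>bump w / q + \<epsilon> * dbump w\<bar> powr p)" for \<epsilon>
  have intI: "(\<lambda>w. bump w powr p) integrable_on {1..2}"
    by (intro integrable_continuous_interval continuous_on_powr' continuous_on_const continuous_bump)
      (use p bump_nonneg in auto)
  have contJ: "continuous_on {1..2} (\<lambda>w. \<bar>bump w / q + \<epsilon> * dbump w\<bar> powr p)" for \<epsilon>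
    by (intro continuous_on_powr' continuous_intros continuous_bump continuous_dbump)
      (use p q1 in auto)
  have intJ: "(\<lambda>w. \<bar>bump w / q + \<epsilon> * dbump w\<bar> powr p) integrable_on {1..2}" for \<epsilon>
    by (rule integrable_continuous_interval[OF contJ])
  have main: "(1 / (1 + K * exp (- (1 / \<epsilon>)))) powr p * I \<le> C powr p * J \<epsilon>" if \<epsilon>: "0 < \<epsilon>" for \<epsilon>
  proof -
    \<comment> \<open>A lower bound for \<open>(s / (s + K)) powr p\<close> on the support, attained
      at its left end \<open>s = exp (1 / \<epsilon>)\<close>.\<close>
    define a where "a = (1 / (1 + K * exp (- (1 / \<epsilon>)))) powr p"
    have a: "0 \<le> a" by (simp add: a_def)
    have lower: "ennreal (a / \<epsilon> * I) \<le> (\<integral>\<^sup>+s. ennreal ((extremal q \<epsilon> s / (s + K)) powr p) \<partial>lborel)"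
    proof -
      have "ennreal (a / \<epsilon> * I) = (\<integral>\<^sup>+w. ennreal (a / \<epsilon> * bump w powr p) * indicator {1..2} w \<partial>lborel)"
      proof (rule nn_integral_has_integral_lebesgue'[symmetric])
        show "((\<lambda>w. a / \<epsilon> * bump w powr p) has_integral a / \<epsilon> * I) {1..2}"
          unfolding I_def by (rule has_integral_mult_right[OF integrable_integral[OF intI]])
      qed (use a \<epsilon> in auto)
      also have "\<dots> \<le> (\<integral>\<^sup>+w. ennreal ((extremal q \<epsilon> (exp (w / \<epsilon>)) / (exp (w / \<epsilon>) + K)) powr p *
          (exp (w / \<epsilon>) / \<epsilon>)) * indicator {1..2} w \<partial>lborel)"
      proof (rule nn_integral_mono)
        fix w
        show "ennreal (a / \<epsilon> * bump w powr p) * indicator {1..2} w \<le>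
          ennreal ((extremal q \<epsilon> (exp (w / \<epsilon>)) / (exp (w / \<epsilon>) + K)) powr p * (exp (w / \<epsilon>) / \<epsilon>)) * indicator {1..2} w"
        proof (cases "w \<in> {1..2}")
          case True
          define s where "s = exp (w / \<epsilon>)"
          have s: "0 < s" by (simp add: s_def)
          have "\<epsilon> * ln s = w" using \<epsilon> by (simp add: s_def)
          then have "(extremal q \<epsilon> s / (s + K)) powr p * s = (s powr (1 / q)) powr p * bump w powr p / (s + K) powr p * s"
            using s K by (simp add: extremal_def powr_mult powr_divide bump_nonneg)
          also have "(s powr (1 / q)) powr p = s powr p / s"
            using pq s by (simp add: powr_powr powr_diff)
          also have "s powr p / s * bump w powr p / (s + K) powr p * s = (s / (s + K)) powr p * bump w powr p"
            using s K by (simp add: powr_divide)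
          also have "a * bump w powr p \<le> (s / (s + K)) powr p * bump w powr p"
          proof -
            have "exp (- (w / \<epsilon>)) \<le> exp (- (1 / \<epsilon>))" using True \<epsilon> by (simp add: divide_right_mono)
            then have "1 + K * exp (- (w / \<epsilon>)) \<le> 1 + K * exp (- (1 / \<epsilon>))"
              using K by (simp add: mult_left_mono)
            moreover have "s / (s + K) = 1 / (1 + K * exp (- (w / \<epsilon>)))"
              using s K by (simp add: s_def exp_minus field_simps)
            ultimately have "1 / (1 + K * exp (- (1 / \<epsilon>))) \<le> s / (s + K)"
              using K by (simp add: frac_le add_pos_nonneg)
            then show ?thesis unfolding a_def using K p
              by (intro mult_right_mono powr_mono2) auto
          qed
          finally have "a * bump w powr p \<le> (extremal q \<epsilon> s / (s + K)) powr p * s"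
            using \<open>(extremal q \<epsilon> s / (s + K)) powr p * s = _\<close> by simp
          then show ?thesis using True \<epsilon> unfolding s_def[symmetric]
            by (auto intro!: ennreal_leI simp: divide_right_mono)
        qed simp
      qed
      also have "\<dots> = (\<integral>\<^sup>+s. ennreal ((extremal q \<epsilon> s / (s + K)) powr p) \<partial>lborel)"
      proof (rule nn_integral_exp_substitution[OF _ \<epsilon>, symmetric])
        show "(extremal q \<epsilon> s / (s + K)) powr p = 0" if "s \<notin> {exp (1 / \<epsilon>)..exp (2 / \<epsilon>)}" for s
          using extremal_support[OF \<epsilon>, of q s] that by (cases "extremal q \<epsilon> s = 0") auto
      qed measurable
      finally show ?thesis .
    qed
    have upper: "(\<integral>\<^sup>+s. ennreal (\<bar>dextremal q \<epsilon> s\<bar> powr p) \<partial>lborel) = ennreal (1 / \<epsilon> * J \<epsilon>)"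
    proof -
      have "(\<integral>\<^sup>+s. ennreal (\<bar>dextremal q \<epsilon> s\<bar> powr p) \<partial>lborel) =
          (\<integral>\<^sup>+w. ennreal (\<bar>dextremal q \<epsilon> (exp (w / \<epsilon>))\<bar> powr p * (exp (w / \<epsilon>) / \<epsilon>)) * indicator {1..2} w \<partial>lborel)"
        by (rule nn_integral_exp_substitution[OF _ \<epsilon>]) (auto simp: dextremal_support[OF \<epsilon>])
      also have "\<dots> = (\<integral>\<^sup>+w. ennreal (1 / \<epsilon> * \<bar>bump w / q + \<epsilon> * dbump w\<bar> powr p) * indicator {1..2} w \<partial>lborel)"
      proof (rule nn_integral_cong)
        fix w
        define s where "s = exp (w / \<epsilon>)"
        have s: "0 < s" by (simp add: s_def)
        have "\<epsilon> * ln s = w" using \<epsilon> by (simp add: s_def)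
        then have "\<bar>dextremal q \<epsilon> s\<bar> powr p * s =
            (s powr (1 / q - 1)) powr p * s * \<bar>bump w / q + \<epsilon> * dbump w\<bar> powr p"
          using s by (simp add: dextremal_def powr_mult abs_mult)
        also have "(s powr (1 / q - 1)) powr p * s = 1"
        proof -
          \<comment> \<open>This exponent exactly cancels the factor \<open>s\<close> coming from
            \<open>ds = (s / \<epsilon>) dw\<close>.\<close>
          have "(1 / q - 1) * p = - 1" using pq q1 by (simp add: field_simps)
          then show ?thesis using s by (simp add: powr_powr powr_minus_divide)
        qed
        finally have "\<bar>dextremal q \<epsilon> (exp (w / \<epsilon>))\<bar> powr p * (exp (w / \<epsilon>) / \<epsilon>) =
            1 / \<epsilon> * \<bar>bump w / q + \<epsilon> * dbump w\<bar> powr p"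
          by (simp add: s_def)
        then show "ennreal (\<bar>dextremal q \<epsilon> (exp (w / \<epsilon>))\<bar> powr p * (exp (w / \<epsilon>) / \<epsilon>)) * indicator {1..2} w =
            ennreal (1 / \<epsilon> * \<bar>bump w / q + \<epsilon> * dbump w\<bar> powr p) * indicator {1..2} w"
          by (simp only:)
      qed
      also have "\<dots> = ennreal (1 / \<epsilon> * J \<epsilon>)"
      proof (rule nn_integral_has_integral_lebesgue')
        show "((\<lambda>w. 1 / \<epsilon> * \<bar>bump w / q + \<epsilon> * dbump w\<bar> powr p) has_integral 1 / \<epsilon> * J \<epsilon>) {1..2}"
          unfolding J_def by (rule has_integral_mult_right[OF integrable_integral[OF intJ]])
      qed (use \<epsilon> in auto)
      finally show ?thesis .
    qed
    have "ennreal (a / \<epsilon> * I) \<le> ennreal (C powr p) * ennreal (1 / \<epsilon> * J \<epsilon>)"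
      using order_trans[OF lower le[OF \<epsilon>]] upper by simp
    moreover have J0: "0 \<le> J \<epsilon>" unfolding J_def by (rule integral_nonneg[OF intJ]) simp
    ultimately have "a / \<epsilon> * I \<le> C powr p * (1 / \<epsilon> * J \<epsilon>)"
      using \<epsilon> by (subst (asm) ennreal_mult[symmetric]) (auto simp: ennreal_le_iff)
    then show ?thesis using \<epsilon> by (simp add: a_def field_simps)
  qed
  \<comment> \<open>Along \<open>\<epsilon> = 1 / Suc k \<le> 1\<close> the integrands have one
    common continuous majorant.\<close>
  have limJ: "(\<lambda>k. J (1 / real (Suc k))) \<longlonglongrightarrow> integral {1..2} (\<lambda>w. (bump w / q) powr p)"
    unfolding J_def
  proof (rule dominated_convergence(2))
    show "(\<lambda>w. (bump w / q + \<bar>dbump w\<bar>) powr p) integrable_on {1..2}"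
      by (intro integrable_continuous_interval continuous_on_powr' continuous_intros continuous_bump continuous_dbump)
        (use p q1 in \<open>auto simp: bump_nonneg\<close>)
    show "norm (\<bar>bump w / q + 1 / real (Suc k) * dbump w\<bar> powr p) \<le> (bump w / q + \<bar>dbump w\<bar>) powr p"
      for k w
    proof -
      have "\<bar>1 / real (Suc k) * dbump w\<bar> \<le> \<bar>dbump w\<bar>"
        unfolding abs_mult by (rule mult_left_le_one_le) auto
      then have "\<bar>bump w / q + 1 / real (Suc k) * dbump w\<bar> \<le> bump w / q + \<bar>dbump w\<bar>"
        using bump_nonneg[of w] q1 abs_triangle_ineq[of "bump w / q" "1 / real (Suc k) * dbump w"] by simp
      then show ?thesis using p by (simp add: powr_mono2)
    qed
    show "(\<lambda>k. \<bar>bump w / q + 1 / real (Suc k) * dbump w\<bar> powr p) \<longlonglongrightarrow> (bump w / q) powr p" for w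
    proof -
      have "(\<lambda>k. 1 / real (Suc k)) \<longlonglongrightarrow> 0" by (rule LIMSEQ_Suc) (rule lim_1_over_n)
      then have "(\<lambda>k. \<bar>bump w / q + 1 / real (Suc k) * dbump w\<bar> powr p) \<longlonglongrightarrow> \<bar>bump w / q + 0 * dbump w\<bar> powr p"
        by (intro tendsto_intros) (use p q1 in auto)
      then show ?thesis using bump_nonneg[of w] q1 by simp
    qed
  qed (rule intJ)
  have Jlim: "integral {1..2} (\<lambda>w. (bump w / q) powr p) = I / q powr p"
    unfolding I_def using q1 by (simp add: powr_divide bump_nonneg)
  have "(\<lambda>k. (1 / (1 + K * exp (- (1 / (1 / real (Suc k)))))) powr p * I) \<longlonglongrightarrow> (1 / (1 + K * 0)) powr p * I"
  proof (intro tendsto_intros)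
    have "filterlim (\<lambda>k. real (Suc k)) at_top sequentially"
      by (rule filterlim_compose[OF filterlim_real_sequentially filterlim_Suc])
    then have "filterlim (\<lambda>k. - real (Suc k)) at_bot sequentially"
      unfolding filterlim_uminus_at_bot by (simp only: minus_minus)
    from filterlim_compose[OF exp_at_bot this]
    show "(\<lambda>k. exp (- (1 / (1 / real (Suc k))))) \<longlonglongrightarrow> 0" by simp
  qed auto
  moreover have "(\<lambda>k. C powr p * J (1 / real (Suc k))) \<longlonglongrightarrow> C powr p * (I / q powr p)"
    using limJ unfolding Jlim by (rule tendsto_mult_left)
  ultimately have "(1 / (1 + K * 0)) powr p * I \<le> C powr p * (I / q powr p)"
  proof (rule LIMSEQ_le)
    show "\<exists>N. \<forall>k\<ge>N. (1 / (1 + K * exp (- (1 / (1 / real (Suc k)))))) powr p * I \<le> C powr p * J (1 / real (Suc k))"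
      by (intro exI allI impI main) simp
  qed
  then have "I * q powr p \<le> I * C powr p" using q1 by (simp add: field_simps)
  moreover have "0 < I"
  proof -
    have "I \<noteq> 0"
    proof
      assume "I = 0"
      moreover have "continuous_on {1..2} (\<lambda>w. bump w powr p)"
        by (intro continuous_on_powr' continuous_on_const continuous_bump) (use p bump_nonneg in auto)
      ultimately have "\<forall>w\<in>{1..2}. bump w powr p = 0"
        unfolding I_def by (subst (asm) integral_eq_0_iff) auto
      then have "bump (3 / 2) = 0" by (auto dest!: bspec[of _ _ "3 / 2"])
      then show False using flat_exp_pos_iff[of "1 / 2"] by (simp add: bump_def)
    qed
    moreover have "0 \<le> I" unfolding I_def by (rule integral_nonneg[OF intI]) simp
    ultimately show ?thesis by simp
  qed
  ultimately have "q powr p \<le> C powr p" by simp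
  then show ?thesis using p powr_less_mono2[of p C q] C by fastforce
qed

section \<open>Sharpness\<close>

context diagonal_dilation
begin

definition b0 :: 'a where
  "b0 = (SOME b. b \<in> Basis)"

lemma b0_in [simp]: "b0 \<in> Basis"
  unfolding b0_def using nonempty_Basis by (metis all_not_in_conv someI_ex)

lemma c_b0: "0 < c b0"
  by (simp add: c_pos)

text \<open>On the half space \<open>0 < x \<bullet> b0\<close> these are a smooth logarithmic radius and a smooth
  dilation invariant function. The quasi-norm itself need not be smooth.\<close>

definition log_radius :: "'a \<Rightarrow> real" where
  "log_radius x = ln (x \<bullet> b0) / c b0"

definition angle :: "'a \<Rightarrow> real" where
  "angle x = (\<Sum>b\<in>Basis. ((x \<bullet> b) * (x \<bullet> b0) powr (- (c b / c b0)))\<^sup>2)"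

text \<open>The angular factor confines the support to a dilation invariant cone around
  \<open>b0\<close>. The threshold \<open>3\<close> lies above the value \<open>1\<close> of
  \<open>angle\<close> at \<open>b0\<close>, so the cone has interior, and below \<open>4\<close>,
  so coordinates in the slice \<open>x \<bullet> b0 = 1\<close> are at most
  \<open>2\<close>.\<close>

definition test_fun :: "real \<Rightarrow> real \<Rightarrow> 'a \<Rightarrow> complex" where
  "test_fun q \<epsilon> x =
    (if 0 < x \<bullet> b0 then of_real (extremal q \<epsilon> (log_radius x) * flat_exp (3 - angle x)) else 0)"

lemma log_radius_dil:
  assumes "0 < x \<bullet> b0" "0 < r"
  shows "log_radius (dil r x) = log_radius x + ln r"
  using assms c_b0 by (simp add: log_radius_def ln_mult ln_powr add_divide_distrib)

lemma inner_b0_eq: "0 < x \<bullet> b0 \<Longrightarrow> x \<bullet> b0 = exp (c b0 * log_radius x)"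
  using c_b0 by (simp add: log_radius_def)

lemma angle_dil:
  assumes "0 < x \<bullet> b0" "0 < r"
  shows "angle (dil r x) = angle x"
proof -
  have "(r powr c b * (x \<bullet> b)) * (r powr c b0 * (x \<bullet> b0)) powr (- (c b / c b0)) =
      (x \<bullet> b) * (x \<bullet> b0) powr (- (c b / c b0))" for b
  proof -
    have "(r powr c b0) powr (- (c b / c b0)) = r powr (- c b)"
      using c_b0 by (simp add: powr_powr)
    then show ?thesis using assms by (simp add: powr_mult powr_minus field_simps)
  qed
  then show ?thesis
    unfolding angle_def by (intro sum.cong refl) (simp only: diag_dilation_inner b0_in)
qed

lemma coordinate_bound:
  assumes "0 < x \<bullet> b0" "angle x \<le> 3" "b \<in> Basis"
  shows "\<bar>x \<bullet> b\<bar> \<le> 2 * (x \<bullet> b0) powr (c b / c b0)"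
proof -
  define z where "z = (x \<bullet> b) * (x \<bullet> b0) powr (- (c b / c b0))"
  have "z\<^sup>2 \<le> angle x"
    unfolding z_def angle_def by (rule member_le_sum[OF assms(3)]) auto
  then have "\<bar>z\<bar> \<le> 2" using assms(2) by (intro abs_le_square_iff[THEN iffD2, of z 2, simplified]) simp
  moreover have "x \<bullet> b = z * (x \<bullet> b0) powr (c b / c b0)"
    using assms(1) by (simp add: z_def powr_minus)
  ultimately show ?thesis by (simp add: abs_mult mult_right_mono)
qed

lemma bounded_log_radius_set:
  "\<exists>M. {x. 0 < x \<bullet> b0 \<and> angle x \<le> 3 \<and> log_radius x \<le> a} \<subseteq> cbox (- M) M"
proof -
  define M where "M = (\<Sum>b\<in>Basis. (2 * exp (c b0 * a) powr (c b / c b0)) *\<^sub>R b)"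
  have "x \<in> cbox (- M) M" if x: "0 < x \<bullet> b0" "angle x \<le> 3" "log_radius x \<le> a" for x
  proof -
    have "\<bar>x \<bullet> b\<bar> \<le> M \<bullet> b" if b: "b \<in> Basis" for b
    proof -
      have "x \<bullet> b0 \<le> exp (c b0 * a)"
        using inner_b0_eq[OF x(1)] x(3) c_b0 by simp
      then have "(x \<bullet> b0) powr (c b / c b0) \<le> exp (c b0 * a) powr (c b / c b0)"
        using x(1) c_b0 c_pos[OF b] by (intro powr_mono2) auto
      with coordinate_bound[OF x(1,2) b] b show ?thesis by (simp add: M_def)
    qed
    then show ?thesis by (fastforce simp: mem_box abs_le_iff)
  qed
  then show ?thesis by blast
qed

text \<open>The difference is dilation invariant, so it can be bounded on the slice
  \<open>x \<bullet> b0 = 1\<close>. There \<open>angle\<close> is the squared norm, hence the cone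
  cuts out part of a compact set avoiding the origin, on which \<open>ln (n x)\<close> is
  bounded.\<close>

lemma log_radius_n_bound:
  obtains \<kappa> where "0 \<le> \<kappa>" "\<And>x. 0 < x \<bullet> b0 \<Longrightarrow> angle x \<le> 3 \<Longrightarrow> \<bar>log_radius x - ln (n x)\<bar> \<le> \<kappa>"
proof -
  define E where "E = {x::'a. x \<bullet> b0 = 1} \<inter> cball 0 2"
  have "closed {x::'a. x \<bullet> b0 = 1}" by (intro closed_Collect_eq continuous_intros)
  then have "compact E" unfolding E_def by (simp add: closed_Int_compact)
  moreover have "n x \<noteq> 0" if "x \<in> E" for x
    using that n_eq_0[of x] by (auto simp: E_def)
  then have "continuous_on E (\<lambda>x. ln (n x))"
    by (intro continuous_on_ln continuous_on_subset[OF n_continuous]) auto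
  ultimately have "bounded ((\<lambda>x. ln (n x)) ` E)"
    by (intro compact_imp_bounded compact_continuous_image)
  then obtain \<kappa> where \<kappa>: "0 < \<kappa>" "\<And>x. x \<in> E \<Longrightarrow> \<bar>ln (n x)\<bar> \<le> \<kappa>"
    unfolding bounded_pos by auto
  have "\<bar>log_radius x - ln (n x)\<bar> \<le> \<kappa>" if x: "0 < x \<bullet> b0" "angle x \<le> 3" for x
  proof -
    define y where "y = dil (exp (- log_radius x)) x"
    have "x \<noteq> 0" using x by auto
    then have ln_y: "ln (n y) = ln (n x) - log_radius x"
      using n_pos[of x] by (simp add: y_def n_dilation ln_mult)
    have y0: "y \<bullet> b0 = 1"
      using inner_b0_eq[OF x(1)] by (simp add: y_def powr_def mult_exp_exp)
    have "angle y \<le> 3" using angle_dil[OF x(1)] x(2) by (simp add: y_def)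
    then have "(\<Sum>b\<in>Basis. (y \<bullet> b)\<^sup>2) \<le> 3" by (simp add: angle_def y0)
    moreover have "(norm y)\<^sup>2 = (\<Sum>b\<in>Basis. (y \<bullet> b)\<^sup>2)"
      unfolding power2_norm_eq_inner by (subst euclidean_inner) (simp add: power2_eq_square)
    ultimately have "(norm y)\<^sup>2 \<le> 2\<^sup>2" by simp
    then have "norm y \<le> 2" by (rule power2_le_imp_le) simp
    then have "y \<in> E" using y0 by (simp add: E_def)
    from \<kappa>(2)[OF this] show ?thesis by (simp add: ln_y abs_minus_commute)
  qed
  with \<kappa>(1) show ?thesis using that[of \<kappa>] by simp
qed

lemma open_half_space: "open {x::'a. a < x \<bullet> b0}" "open {x::'a. x \<bullet> b0 < a}"
  by (intro open_Collect_less continuous_intros)+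

lemma smooth_inner: "open S \<Longrightarrow> smooth_on S (\<lambda>x::'a. x \<bullet> b)"
  by (rule smooth_on_bounded_linear[OF _ bounded_linear_inner_left])

lemma smooth_on_ln_compose:
  "open S \<Longrightarrow> smooth_on S h \<Longrightarrow> (\<And>x. x \<in> S \<Longrightarrow> 0 < h x) \<Longrightarrow> smooth_on S (\<lambda>x. ln (h x))"
  for h :: "'a \<Rightarrow> real"
  by (rule smooth_on_compose[OF _ _ smooth_on_ln]) auto

lemma smooth_on_powr_compose:
  fixes h :: "'a \<Rightarrow> real"
  assumes "open S" "smooth_on S h" "\<And>x. x \<in> S \<Longrightarrow> 0 < h x"
  shows "smooth_on S (\<lambda>x. h x powr a)"
proof (rule smooth_on_cong[OF assms(1)])
  show "exp (a * ln (h x)) = h x powr a" if "x \<in> S" for x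
    using assms(3)[OF that] by (simp add: powr_def)
  show "smooth_on S (\<lambda>x. exp (a * ln (h x)))"
    by (intro smooth_on_compose_real[OF _ _ smooth_on_exp] smooth_on_mult smooth_on_ln_compose
        smooth_on_const assms)
qed

lemma smooth_log_radius: "open S \<Longrightarrow> S \<subseteq> {x. 0 < x \<bullet> b0} \<Longrightarrow> smooth_on S log_radius"
  unfolding log_radius_def[abs_def] divide_inverse
  by (intro smooth_on_mult smooth_on_ln_compose smooth_on_const smooth_inner) auto

lemma smooth_angle: "open S \<Longrightarrow> S \<subseteq> {x. 0 < x \<bullet> b0} \<Longrightarrow> smooth_on S angle"
  unfolding angle_def[abs_def] power2_eq_square
  by (intro smooth_on_sum smooth_on_mult smooth_on_powr_compose smooth_inner finite_Basis) auto

text \<open>Two overlapping open half spaces cover everything. On \<open>S\<close> the logarithmic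
  radius is positive and the formula is a smooth expression; on \<open>T\<close> it is below
  \<open>1\<close> where it is defined, so the function vanishes, also across the wall
  \<open>x \<bullet> b0 = 0\<close>.\<close>

lemma smooth_test_fun:
  assumes \<epsilon>: "0 < \<epsilon>"
  shows "smooth_on UNIV (test_fun q \<epsilon>)"
proof -
  define S where "S = {x::'a. 1 < x \<bullet> b0}"
  define T where "T = {x::'a. x \<bullet> b0 < exp (c b0)}"
  have open': "open S" "open T" unfolding S_def T_def by (rule open_half_space)+
  have lr: "0 < log_radius x" if "x \<in> S" for x
    using that c_b0 by (simp add: log_radius_def S_def)
  have "smooth_on S (test_fun q \<epsilon>)"
  proof (rule smooth_on_cong[OF open'(1)])
    define k where "k x = log_radius x powr (1 / q) * bump (\<epsilon> * ln (log_radius x)) * flat_exp (3 - angle x)" for x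
    show "complex_of_real (k x) = test_fun q \<epsilon> x" if "x \<in> S" for x
      using lr[OF that] that by (simp add: k_def test_fun_def extremal_def S_def)
    have "S \<subseteq> {x. 0 < x \<bullet> b0}" by (auto simp: S_def)
    then have "smooth_on S k"
      unfolding k_def using lr
      by (intro smooth_on_mult smooth_on_powr_compose smooth_on_compose_real[OF _ _ smooth_bump]
          smooth_on_compose_real[OF _ _ smooth_on_flat_exp] smooth_on_diff smooth_on_const
          smooth_on_ln_compose smooth_log_radius smooth_angle open') auto
    then show "smooth_on S (\<lambda>x. complex_of_real (k x))"
      by (rule smooth_on_bounded_linear_compose[OF open'(1) bounded_linear_of_real])
  qed
  moreover have "smooth_on T (test_fun q \<epsilon>)"
  proof (rule smooth_on_cong[OF open'(2) _ smooth_on_const[OF open'(2), of 0]])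
    show "0 = test_fun q \<epsilon> x" if "x \<in> T" for x
    proof (cases "0 < x \<bullet> b0")
      case True
      then have "ln (x \<bullet> b0) < c b0" using that ln_less_cancel_iff[of "x \<bullet> b0" "exp (c b0)"] by (simp add: T_def)
      then have "log_radius x \<le> 1" using c_b0 by (simp add: log_radius_def)
      then show ?thesis by (simp add: test_fun_def extremal_eq_0[OF \<epsilon>])
    qed (simp add: test_fun_def)
  qed
  moreover have "S \<union> T = UNIV"
  proof (rule UNIV_eq_I[symmetric])
    have "1 < exp (c b0)" using c_b0 by simp
    then show "x \<in> S \<union> T" for x unfolding S_def T_def Un_iff mem_Collect_eq by linarith
  qed
  ultimately show ?thesis using smooth_on_Un[OF open'] by metis
qed

lemma test_fun_nonzero:
  assumes \<epsilon>: "0 < \<epsilon>" and nz: "test_fun q \<epsilon> x \<noteq> 0"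
  shows "0 < x \<bullet> b0" "angle x \<le> 3" "exp (1 / \<epsilon>) < log_radius x" "log_radius x < exp (2 / \<epsilon>)"
proof -
  show "0 < x \<bullet> b0" using nz by (auto simp: test_fun_def split: if_splits)
  with nz have "extremal q \<epsilon> (log_radius x) \<noteq> 0" "flat_exp (3 - angle x) \<noteq> 0"
    by (auto simp: test_fun_def)
  then show "angle x \<le> 3" "exp (1 / \<epsilon>) < log_radius x" "log_radius x < exp (2 / \<epsilon>)"
    using extremal_support[OF \<epsilon>] by (auto simp: flat_exp_def split: if_splits)
qed

lemma test_fun_support:
  assumes \<epsilon>: "0 < \<epsilon>"
  shows "compact (closure {x. test_fun q \<epsilon> x \<noteq> 0})" and "0 \<notin> closure {x. test_fun q \<epsilon> x \<noteq> 0}"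
proof -
  let ?S = "{x. test_fun q \<epsilon> x \<noteq> 0}"
  obtain M where M: "{x. 0 < x \<bullet> b0 \<and> angle x \<le> 3 \<and> log_radius x \<le> exp (2 / \<epsilon>)} \<subseteq> cbox (- M) M"
    using bounded_log_radius_set by blast
  have "bounded ?S"
    by (rule bounded_subset[OF bounded_cbox[of "- M" M]])
      (use test_fun_nonzero[OF \<epsilon>] M less_imp_le in blast)
  then show "compact (closure ?S)" by simp
  have "?S \<subseteq> {x. 1 \<le> x \<bullet> b0}"
  proof
    fix x assume "x \<in> ?S"
    then have "0 < x \<bullet> b0" "exp (1 / \<epsilon>) < log_radius x" using test_fun_nonzero[OF \<epsilon>] by auto
    then show "x \<in> {x. 1 \<le> x \<bullet> b0}"
      using inner_b0_eq[of x] c_b0 less_trans[OF exp_gt_zero] by (auto intro!: one_le_exp_iff[THEN iffD2] mult_nonneg_nonneg less_imp_le)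
  qed
  moreover have "closed {x::'a. 1 \<le> x \<bullet> b0}" by (intro closed_Collect_le continuous_intros)
  ultimately have "closure ?S \<subseteq> {x. 1 \<le> x \<bullet> b0}" by (rule closure_minimal)
  then show "0 \<notin> closure ?S" by auto
qed

section \<open>Test functions along orbits\<close>

lemma test_fun_orbit:
  assumes "0 < x \<bullet> b0"
  shows "test_fun q \<epsilon> (dil (exp t) x) = of_real (extremal q \<epsilon> (log_radius x + t) * flat_exp (3 - angle x))"
  using assms by (simp add: test_fun_def log_radius_dil angle_dil zero_less_mult_iff)

lemma flow_deriv_test_fun:
  assumes \<epsilon>: "0 < \<epsilon>"
  shows "flow_deriv (test_fun q \<epsilon>) (dil (exp t) x) =
    (if 0 < x \<bullet> b0 then of_real (dextremal q \<epsilon> (log_radius x + t) * flat_exp (3 - angle x)) else 0)"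
proof (rule vector_derivative_unique_at[OF flow_has_vector_derivative[OF smooth_test_fun[OF \<epsilon>]]])
  show "((\<lambda>t. test_fun q \<epsilon> (dil (exp t) x)) has_vector_derivative
      (if 0 < x \<bullet> b0 then of_real (dextremal q \<epsilon> (log_radius x + t) * flat_exp (3 - angle x)) else 0)) (at t)"
  proof (cases "0 < x \<bullet> b0")
    case True
    have "((\<lambda>t. extremal q \<epsilon> (log_radius x + t)) has_real_derivative dextremal q \<epsilon> (log_radius x + t) * 1) (at t)"
      by (rule DERIV_chain2[OF extremal_has_real_derivative[OF \<epsilon>]]) (auto intro!: derivative_eq_intros)
    from DERIV_cmult_right[OF this, of "flat_exp (3 - angle x)"]
    have "((\<lambda>t. extremal q \<epsilon> (log_radius x + t) * flat_exp (3 - angle x)) has_vector_derivative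
        dextremal q \<epsilon> (log_radius x + t) * flat_exp (3 - angle x)) (at t)"
      by (simp add: has_real_derivative_iff_has_vector_derivative)
    then have "((\<lambda>t. complex_of_real (extremal q \<epsilon> (log_radius x + t) * flat_exp (3 - angle x))) has_vector_derivative
        of_real (dextremal q \<epsilon> (log_radius x + t) * flat_exp (3 - angle x))) (at t)"
      by (rule bounded_linear.has_vector_derivative[OF bounded_linear_of_real])
    then show ?thesis using True by (simp add: test_fun_orbit)
  next
    case False
    then have "test_fun q \<epsilon> (dil (exp t) x) = 0" for t
      by (simp add: test_fun_def zero_less_mult_iff)
    then show ?thesis using False by simp
  qed
qed

lemma nn_integral_shift: "(\<integral>\<^sup>+t. f (a + t) \<partial>lborel) = (\<integral>\<^sup>+t. f t \<partial>lborel)"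
  if "f \<in> borel_measurable borel" for f :: "real \<Rightarrow> ennreal" and a
  using nn_integral_real_affine[OF that, of 1 a] by simp

text \<open>The angular factor of the test function, raised to the power \<open>p\<close>; it is
  constant on orbits.\<close>

definition weight :: "real \<Rightarrow> 'a \<Rightarrow> real" where
  "weight p x = (if 0 < x \<bullet> b0 then flat_exp (3 - angle x) powr p else 0)"

text \<open>\<open>Z\<close> is the angular mass that multiplies both sides of the tested
  inequality, so it must be cancellable. It is finite because cone and shell meet in a bounded set,
  and nonzero because the integrand is positive on a nonempty open set.\<close>

lemma weight_mass:
  assumes p: "1 < p"
  defines "Z \<equiv> \<integral>\<^sup>+x. indicator {1..<exp 1} (n x) * ennreal (n x powr - Q) * ennreal (weight p x) \<partial>lborel"
  shows "Z \<noteq> 0" "Z < \<infinity>"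
proof -
  obtain \<kappa> where \<kappa>: "0 \<le> \<kappa>" "\<And>x. 0 < x \<bullet> b0 \<Longrightarrow> angle x \<le> 3 \<Longrightarrow> \<bar>log_radius x - ln (n x)\<bar> \<le> \<kappa>"
    using log_radius_n_bound by blast
  obtain M where M: "{x. 0 < x \<bullet> b0 \<and> angle x \<le> 3 \<and> log_radius x \<le> 1 + \<kappa>} \<subseteq> cbox (- M) M"
    using bounded_log_radius_set by blast
  have "Z \<le> (\<integral>\<^sup>+x. indicator (cbox (- M) M) x \<partial>lborel)"
    unfolding Z_def
  proof (rule nn_integral_mono)
    fix x
    show "indicator {1..<exp 1} (n x) * ennreal (n x powr - Q) * ennreal (weight p x) \<le> indicator (cbox (- M) M) x"
    proof (cases "n x \<in> {1..<exp 1} \<and> weight p x \<noteq> 0")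
      case True
      then have x: "0 < x \<bullet> b0" "angle x \<le> 3"
        by (auto simp: weight_def flat_exp_def split: if_splits)
      have "ln (n x) < 1" using True by (metis atLeastLessThan_iff exp_gt_zero less_le_trans ln_exp ln_less_cancel_iff zero_less_one)
      then have "log_radius x \<le> 1 + \<kappa>" using \<kappa>(2)[OF x] by linarith
      then have "x \<in> cbox (- M) M" using M x by blast
      moreover have "n x powr - Q \<le> 1"
        using True Q_nonneg powr_mono[of "- Q" 0 "n x"] by simp
      moreover have "weight p x \<le> 1"
        using p flat_exp_le_1 flat_exp_nonneg powr_mono2[of p "flat_exp (3 - angle x)" 1] by (simp add: weight_def)
      ultimately show ?thesis
        using True mult_mono[of "n x powr - Q" 1 "weight p x" 1]
        by (simp add: ennreal_mult'[symmetric] ennreal_le_1 weight_def)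
    qed auto
  qed
  also have "\<dots> < \<infinity>" using emeasure_bounded_finite[OF bounded_cbox, of "- M" M] by simp
  finally show "Z < \<infinity>" .
  define V where "V = {x. 0 < x \<bullet> b0} \<inter> (\<lambda>x. (angle x, n x)) -` ({..<3} \<times> {1<..<exp 1})"
  have ang: "continuous_on {x. 0 < x \<bullet> b0} angle"
    by (intro smooth_on_imp_continuous_on smooth_angle open_half_space) auto
  have "open V"
    unfolding V_def
    by (intro continuous_open_preimage open_half_space open_Times open_lessThan open_greaterThanLessThan
        continuous_on_Pair ang continuous_on_subset[OF n_continuous]) auto
  have "V \<noteq> {}"
  proof -
    have b: "b0 \<noteq> (0::'a)" using nonzero_Basis[OF b0_in] by auto
    \<comment> \<open>Dilates the axis point \<open>b0\<close> to quasi-norm \<open>2\<close>, which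
      lies strictly between \<open>1\<close> and \<open>exp 1\<close>.\<close>
    define x where "x = dil (2 / n b0) b0"
    have n: "0 < n b0" using n_pos[OF b] .
    have x0: "x \<bullet> b0 = (2 / n b0) powr c b0" by (simp add: x_def)
    have "angle x = angle b0" unfolding x_def using n by (intro angle_dil) auto
    also have "angle b0 = 1"
    proof -
      have "angle b0 = (\<Sum>b\<in>Basis. if b = b0 then 1 else 0)"
        unfolding angle_def by (intro sum.cong) (auto simp: inner_Basis)
      then show ?thesis by simp
    qed
    finally have "angle x = 1" .
    moreover have "n x = 2" using n by (simp add: x_def n_dilation)
    moreover have "(2::real) < exp 1"
      using exp_lower_Taylor_quadratic[of "1::real"] by simp
    ultimately have "x \<in> V" using n by (simp add: V_def x0)
    then show ?thesis by blast
  qed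
  show "Z \<noteq> 0"
  proof
    assume "Z = 0"
    have [measurable]: "angle \<in> borel_measurable borel" unfolding angle_def[abs_def] by measurable
    have [measurable]: "flat_exp \<in> borel_measurable borel"
      using smooth_on_imp_continuous_on[OF smooth_on_flat_exp] by (rule borel_measurable_continuous_onI)
    have [measurable]: "weight p \<in> borel_measurable borel" unfolding weight_def[abs_def] by measurable
    have "AE x in lborel. indicator {1..<exp 1} (n x) * ennreal (n x powr - Q) * ennreal (weight p x) = 0"
      using \<open>Z = 0\<close> unfolding Z_def by (subst (asm) nn_integral_0_iff_AE) auto
    then have "AE x in lborel. x \<notin> V"
    proof eventually_elim
      case (elim x)
      show ?case
      proof
        assume "x \<in> V"
        then have "0 < weight p x" "0 < n x powr - Q" "n x \<in> {1..<exp 1}"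
          by (auto simp: V_def weight_def flat_exp_def)
        then show False using elim by (simp add: ennreal_mult'[symmetric])
      qed
    qed
    then have "V \<in> null_sets lborel"
      using AE_iff_null_sets[of V lborel] \<open>open V\<close> by simp
    then have "negligible V"
      unfolding negligible_iff_null_sets by (rule null_sets_completionI)
    then show False using \<open>open V\<close> \<open>V \<noteq> {}\<close> open_not_negligible by blast
  qed
qed

text \<open>On each orbit the test function is the one-dimensional extremal, translated by
  \<open>log_radius x\<close> and scaled by a constant. Integration over the fundamental domain
  multiplies both sides by \<open>Z\<close>, and the line case applies with
  \<open>K = 2 * \<kappa>\<close>.\<close>

lemma hardy_sharp:
  assumes p: "1 < p" and q: "q = p / (p - 1)" and C: "0 \<le> C"
    and le: "\<And>f R. smooth_on UNIV f \<Longrightarrow> compact (closure {x. f x \<noteq> 0}) \<Longrightarrow> 0 \<notin> closure {x. f x \<noteq> 0} \<Longrightarrow> 0 < R \<Longrightarrow>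
      (\<integral>\<^sup>+x. ennreal (lhs_density p R f x) * ennreal (n x powr - Q) \<partial>lborel) \<le>
      ennreal (C powr p) * (\<integral>\<^sup>+x. ennreal (norm (flow_deriv f x) powr p) * ennreal (n x powr - Q) \<partial>lborel)"
  shows "q \<le> C"
proof -
  obtain \<kappa> where \<kappa>: "0 \<le> \<kappa>" "\<And>x. 0 < x \<bullet> b0 \<Longrightarrow> angle x \<le> 3 \<Longrightarrow> \<bar>log_radius x - ln (n x)\<bar> \<le> \<kappa>"
    using log_radius_n_bound by blast
  define Z where "Z = (\<integral>\<^sup>+x. indicator {1..<exp 1} (n x) * ennreal (n x powr - Q) * ennreal (weight p x) \<partial>lborel)"
  have Z: "Z \<noteq> 0" "Z < \<infinity>" unfolding Z_def by (rule weight_mass[OF p])+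
  have [measurable]: "angle \<in> borel_measurable borel" unfolding angle_def[abs_def] by measurable
  have [measurable]: "flat_exp \<in> borel_measurable borel"
    using smooth_on_imp_continuous_on[OF smooth_on_flat_exp] by (rule borel_measurable_continuous_onI)
  have [measurable]: "weight p \<in> borel_measurable borel" unfolding weight_def[abs_def] by measurable
  show ?thesis
  proof (rule hardy_line_sharp[OF p q _ C])
    show "0 \<le> 2 * \<kappa>" using \<kappa>(1) by simp
    fix \<epsilon> :: real assume \<epsilon>: "0 < \<epsilon>"
    define f where "f = test_fun q \<epsilon>"
    have f: "smooth_on UNIV f" unfolding f_def by (rule smooth_test_fun[OF \<epsilon>])
    note [measurable] = smooth_on_UNIV_measurable[OF f]
      borel_measurable_continuous_onI[OF flow_deriv_continuous[OF f]]
    define L where "L = (\<integral>\<^sup>+s. ennreal ((extremal q \<epsilon> s / (s + 2 * \<kappa>)) powr p) \<partial>lborel)"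
    define D where "D = (\<integral>\<^sup>+s. ennreal (\<bar>dextremal q \<epsilon> s\<bar> powr p) \<partial>lborel)"
    \<comment> \<open>With \<open>R = exp (- \<kappa>)\<close> the projected point \<open>y\<close>
      has logarithmic radius at most \<open>0\<close>, outside the support, so
      \<open>f y = 0\<close>. The remaining denominator \<open>\<kappa> + ln (n x)\<close> exceeds
      \<open>1\<close> on the support and is at most
      \<open>log_radius x + 2 * \<kappa>\<close>.\<close>
    have lower: "ennreal ((extremal q \<epsilon> (log_radius x) / (log_radius x + 2 * \<kappa>)) powr p) * ennreal (weight p x)
        \<le> ennreal (lhs_density p (exp (- \<kappa>)) f x)" for x
    proof (cases "f x = 0")
      case True
      then show ?thesis
        by (auto simp: f_def test_fun_def weight_def split: if_splits)
    next
      case False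
      note x = test_fun_nonzero[OF \<epsilon> False[unfolded f_def]]
      have "x \<noteq> 0" using x(1) by auto
      note n = n_pos[OF this]
      define y where "y = dil (exp (- \<kappa>) / n x) x"
      have "log_radius y = log_radius x + (- \<kappa> - ln (n x))"
        using n x(1) by (simp add: y_def log_radius_dil ln_div)
      then have "log_radius y \<le> 1" using \<kappa>(2)[OF x(1,2)] by linarith
      then have fy: "f y = 0" by (simp add: f_def test_fun_def extremal_eq_0[OF \<epsilon>])
      have lr: "1 < log_radius x"
        using x(3) \<epsilon> one_less_exp_iff[of "1 / \<epsilon>"] by (meson divide_pos_pos less_trans zero_less_one)
      have ln: "\<bar>ln (exp (- \<kappa>) / n x)\<bar> = \<bar>\<kappa> + ln (n x)\<bar>"
        using n by (simp add: ln_div abs_minus_commute)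
      have pos: "0 < \<bar>\<kappa> + ln (n x)\<bar>" "\<bar>\<kappa> + ln (n x)\<bar> \<le> log_radius x + 2 * \<kappa>"
        using \<kappa>(2)[OF x(1,2)] lr \<kappa>(1) by linarith+
      have nf: "norm (f x) = extremal q \<epsilon> (log_radius x) * flat_exp (3 - angle x)"
        using x(1) by (simp add: f_def test_fun_def norm_mult extremal_nonneg flat_exp_nonneg del: of_real_mult)
      have "(extremal q \<epsilon> (log_radius x) / (log_radius x + 2 * \<kappa>)) powr p * weight p x =
          (norm (f x) / (log_radius x + 2 * \<kappa>)) powr p"
        unfolding nf using x(1) lr \<kappa>(1)
        by (simp add: weight_def powr_mult[symmetric] extremal_nonneg flat_exp_nonneg)
      also have "\<dots> \<le> (norm (f x) / \<bar>\<kappa> + ln (n x)\<bar>) powr p"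
        using p pos by (intro powr_mono2 divide_left_mono) auto
      also have "\<dots> = lhs_density p (exp (- \<kappa>)) f x"
        unfolding lhs_density_def y_def[symmetric] fy ln by simp
      finally show ?thesis by (simp add: ennreal_mult'[symmetric] ennreal_leI weight_def)
    qed
    have wo: "weight p (dil (exp t) x) = weight p x" for x t
      by (simp add: weight_def angle_dil zero_less_mult_iff)
    have "Z * L = (\<integral>\<^sup>+x. indicator {1..<exp 1} (n x) * ennreal (n x powr - Q) * ennreal (weight p x) * L \<partial>lborel)"
      unfolding Z_def by (rule nn_integral_multc[symmetric]) measurable
    also have "\<dots> \<le> (\<integral>\<^sup>+x. indicator {1..<exp 1} (n x) * ennreal (n x powr - Q) *
        (\<integral>\<^sup>+t. ennreal (lhs_density p (exp (- \<kappa>)) f (dil (exp t) x)) \<partial>lborel) \<partial>lborel)"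
    proof (rule nn_integral_mono)
      fix x
      have "ennreal (weight p x) * L \<le> (\<integral>\<^sup>+t. ennreal (lhs_density p (exp (- \<kappa>)) f (dil (exp t) x)) \<partial>lborel)"
      proof (cases "0 < x \<bullet> b0")
        case True
        have "ennreal (weight p x) * L = ennreal (weight p x) *
            (\<integral>\<^sup>+t. ennreal ((extremal q \<epsilon> (log_radius x + t) / (log_radius x + t + 2 * \<kappa>)) powr p) \<partial>lborel)"
          unfolding L_def by (subst nn_integral_shift[symmetric, where a = "log_radius x"]) auto
        also have "\<dots> = (\<integral>\<^sup>+t. ennreal (weight p x) *
            ennreal ((extremal q \<epsilon> (log_radius x + t) / (log_radius x + t + 2 * \<kappa>)) powr p) \<partial>lborel)"
          by (rule nn_integral_cmult[symmetric]) measurable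
        also have "\<dots> \<le> (\<integral>\<^sup>+t. ennreal (lhs_density p (exp (- \<kappa>)) f (dil (exp t) x)) \<partial>lborel)"
        proof (rule nn_integral_mono)
          fix t
          show "ennreal (weight p x) * ennreal ((extremal q \<epsilon> (log_radius x + t) / (log_radius x + t + 2 * \<kappa>)) powr p)
              \<le> ennreal (lhs_density p (exp (- \<kappa>)) f (dil (exp t) x))"
            using lower[of "dil (exp t) x"] True by (simp add: wo log_radius_dil mult.commute)
        qed
        finally show ?thesis .
      qed (simp add: weight_def)
      then show "indicator {1..<exp 1} (n x) * ennreal (n x powr - Q) * ennreal (weight p x) * L \<le>
          indicator {1..<exp 1} (n x) * ennreal (n x powr - Q) *
          (\<integral>\<^sup>+t. ennreal (lhs_density p (exp (- \<kappa>)) f (dil (exp t) x)) \<partial>lborel)"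
        unfolding mult.assoc by (intro mult_left_mono) auto
    qed
    also have "\<dots> = (\<integral>\<^sup>+x. ennreal (lhs_density p (exp (- \<kappa>)) f x) * ennreal (n x powr - Q) \<partial>lborel)"
      by (rule nn_integral_orbits[symmetric]) measurable
    also have "\<dots> \<le> ennreal (C powr p) *
        (\<integral>\<^sup>+x. ennreal (norm (flow_deriv f x) powr p) * ennreal (n x powr - Q) \<partial>lborel)"
      by (rule le[OF f]) (use test_fun_support[OF \<epsilon>] in \<open>simp_all add: f_def\<close>)
    also have "(\<integral>\<^sup>+x. ennreal (norm (flow_deriv f x) powr p) * ennreal (n x powr - Q) \<partial>lborel) =
        (\<integral>\<^sup>+x. indicator {1..<exp 1} (n x) * ennreal (n x powr - Q) *
          (\<integral>\<^sup>+t. ennreal (norm (flow_deriv f (dil (exp t) x)) powr p) \<partial>lborel) \<partial>lborel)"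
      by (rule nn_integral_orbits) measurable
    also have "\<dots> = (\<integral>\<^sup>+x. indicator {1..<exp 1} (n x) * ennreal (n x powr - Q) * ennreal (weight p x) * D \<partial>lborel)"
    proof (rule nn_integral_cong)
      fix x
      have "(\<integral>\<^sup>+t. ennreal (norm (flow_deriv f (dil (exp t) x)) powr p) \<partial>lborel) = ennreal (weight p x) * D"
      proof (cases "0 < x \<bullet> b0")
        case True
        have "norm (flow_deriv f (dil (exp t) x)) powr p =
            weight p x * \<bar>dextremal q \<epsilon> (log_radius x + t)\<bar> powr p" for t
          using True
          by (simp add: f_def flow_deriv_test_fun[OF \<epsilon>] weight_def norm_mult powr_mult flat_exp_nonneg mult.commute)
        then have "(\<integral>\<^sup>+t. ennreal (norm (flow_deriv f (dil (exp t) x)) powr p) \<partial>lborel) =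
            (\<integral>\<^sup>+t. ennreal (weight p x) * ennreal (\<bar>dextremal q \<epsilon> (log_radius x + t)\<bar> powr p) \<partial>lborel)"
          by (simp add: ennreal_mult' weight_def)
        also have "\<dots> = ennreal (weight p x) * (\<integral>\<^sup>+t. ennreal (\<bar>dextremal q \<epsilon> (log_radius x + t)\<bar> powr p) \<partial>lborel)"
          by (rule nn_integral_cmult) measurable
        also have "(\<integral>\<^sup>+t. ennreal (\<bar>dextremal q \<epsilon> (log_radius x + t)\<bar> powr p) \<partial>lborel) = D"
          unfolding D_def
          by (rule nn_integral_shift[where f = "\<lambda>s. ennreal (\<bar>dextremal q \<epsilon> s\<bar> powr p)"]) measurable
        finally show ?thesis .
      next
        case False
        then show ?thesis by (simp add: f_def flow_deriv_test_fun[OF \<epsilon>] weight_def)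
      qed
      then show "indicator {1..<exp 1} (n x) * ennreal (n x powr - Q) *
          (\<integral>\<^sup>+t. ennreal (norm (flow_deriv f (dil (exp t) x)) powr p) \<partial>lborel) =
          indicator {1..<exp 1} (n x) * ennreal (n x powr - Q) * ennreal (weight p x) * D"
        by (simp add: mult.assoc)
    qed
    also have "\<dots> = Z * D"
      unfolding Z_def by (rule nn_integral_multc) measurable
    finally have "Z * L \<le> Z * (ennreal (C powr p) * D)" by (simp add: mult.left_commute)
    then show "L \<le> ennreal (C powr p) * D"
      using Z by (simp add: ennreal_mult_le_mult_iff)
  qed
qed

end

section \<open>Homogeneous groups in exponential coordinates\<close>

lemma exp_series_eigenvector:
  fixes A :: "'a::euclidean_space \<Rightarrow> 'a"
  assumes lin: "linear A" and eig: "A v = c *\<^sub>R v" and r: "0 < r"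
  shows "dilation A r v = r powr c *\<^sub>R v"
proof -
  have pow: "((\<lambda>Y. ln r *\<^sub>R A Y) ^^ k) v = (ln r * c) ^ k *\<^sub>R v" for k
    by (induction k) (simp_all add: eig linear_scale[OF lin] mult_ac)
  have "(\<lambda>k. ((ln r * c) ^ k /\<^sub>R fact k) *\<^sub>R v) sums (exp (ln r * c) *\<^sub>R v)"
    by (rule bounded_linear.sums[OF bounded_linear_scaleR_left exp_converges])
  then have "(\<lambda>k. (1 / fact k) *\<^sub>R ((\<lambda>Y. ln r *\<^sub>R A Y) ^^ k) v) sums (r powr c *\<^sub>R v)"
    using r by (simp add: pow powr_def inverse_eq_divide mult.commute)
  then show ?thesis unfolding dilation_def by (rule sums_unique[symmetric])
qed

lemma diagonalisable_pos_coordinates: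
  fixes A :: "'a::euclidean_space \<Rightarrow> 'a"
  assumes "diagonalisable_pos A"
  obtains P P' :: "'a \<Rightarrow> 'a" and c where "linear P" "linear P'" "\<And>x. P' (P x) = x" "\<And>x. P (P' x) = x"
    "\<And>b. b \<in> Basis \<Longrightarrow> 0 < c b" "\<And>b. b \<in> Basis \<Longrightarrow> A (P b) = c b *\<^sub>R P b"
proof -
  obtain B where B: "independent B" "span B = UNIV" and eig: "\<And>b. b \<in> B \<Longrightarrow> \<exists>c>0. A b = c *\<^sub>R b"
    using assms unfolding diagonalisable_pos_def by blast
  obtain \<beta> where \<beta>: "bij_betw \<beta> (Basis :: 'a set) B"
    using bij_if_span_eq_span_bases[OF independent_Basis B(1)] B(2) by (auto simp: span_Basis)
  obtain P where P: "linear P" "\<And>b. b \<in> Basis \<Longrightarrow> P b = \<beta> b"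
    using linear_independent_extend[OF independent_Basis, of \<beta>] by blast
  have "P ` Basis = B" using P(2) \<beta> by (auto simp: bij_betw_def)
  then have "surj P"
    using linear_span_image[OF P(1), of Basis] B(2) by (simp add: span_Basis)
  then have "inj P" by (rule linear_surjective_imp_injective[OF P(1) _ refl])
  from linear_injective_isomorphism[OF P(1) this]
  obtain P' where P': "linear P'" "\<forall>x. P' (P x) = x" "\<forall>x. P (P' x) = x" by blast
  have "\<forall>b\<in>Basis. \<exists>c>0. A (P b) = c *\<^sub>R P b"
    using eig \<open>P ` Basis = B\<close> by blast
  then obtain c where "\<forall>b\<in>Basis. 0 < c b \<and> A (P b) = c b *\<^sub>R P b" by metis
  then show ?thesis using that[of P P' c] P(1) P' by blast
qed

locale exp_group =
  fixes \<A> :: "('g::{topological_group_add, t2_space, second_countable_topology}, 'a::euclidean_space) atlas"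
    and e :: "'a \<Rightarrow> 'g"
  assumes lie: "lie_group \<A>" and exp: "global_exp \<A> e"
begin

lemma chart_exists: obtains U \<phi> where "(U, \<phi>) \<in> \<A>" "x \<in> U"
proof -
  have "x \<in> (\<Union>(U, \<phi>)\<in>\<A>. U)" using lie by (simp add: lie_group_def smooth_atlas_def)
  then show ?thesis using that by auto
qed

lemma chart:
  assumes "(U, \<phi>) \<in> \<A>"
  shows "open U" "continuous_on U \<phi>" "x \<in> U \<Longrightarrow> inv_into U \<phi> (\<phi> x) = x" "open (\<phi> ` U)"
    "smooth_on (\<phi> ` U) (inv e \<circ> inv_into U \<phi>)" "smooth_on (e -` U) (\<phi> \<circ> e)"
proof -
  from assms lie exp have *: "open U \<and> open (\<phi> ` U) \<and> homeomorphism U (\<phi> ` U) \<phi> (inv_into U \<phi>)"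
    "smooth_on (\<phi> ` U) (inv e \<circ> inv_into U \<phi>)" "smooth_on (e -` U) (\<phi> \<circ> e)"
    by (auto simp: lie_group_def smooth_atlas_def global_exp_def smooth_fun_def)
  then show "open U" "continuous_on U \<phi>" "x \<in> U \<Longrightarrow> inv_into U \<phi> (\<phi> x) = x" "open (\<phi> ` U)"
    "smooth_on (\<phi> ` U) (inv e \<circ> inv_into U \<phi>)" "smooth_on (e -` U) (\<phi> \<circ> e)"
    by (auto simp: homeomorphism_def)
qed

lemma e_bij: "inv e (e X) = X" "e (inv e x) = x"
  using exp by (auto simp: global_exp_def bij_def surj_f_inv_f)

lemma e_continuous: "continuous_on UNIV e"
  using exp by (simp add: global_exp_def)

lemma e_add: "e ((s + t) *\<^sub>R X) = e (s *\<^sub>R X) + e (t *\<^sub>R X)"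
  using exp by (simp add: global_exp_def)

lemma e_zero: "e 0 = 0"
  using e_add[of 0 0 0] by (metis add.right_neutral add_left_cancel scale_zero_left)

lemma e_minus: "e (- X) = - e X"
  using e_add[of 1 "- 1" X] by (simp add: e_zero eq_neg_iff_add_eq_0 minus_unique)

lemma inv_e_continuous: "continuous_on UNIV (inv e)"
proof (rule continuous_at_imp_continuous_on, rule ballI)
  fix x
  obtain U \<phi> where U: "(U, \<phi>) \<in> \<A>" "x \<in> U" using chart_exists by blast
  have "continuous_on U (\<lambda>x. (inv e \<circ> inv_into U \<phi>) (\<phi> x))"
    by (rule continuous_on_compose2[OF smooth_on_imp_continuous_on[OF chart(5)[OF U(1)]] chart(2)[OF U(1)]]) simp
  then have "continuous_on U (inv e)"
    by (rule continuous_on_cong[THEN iffD1, rotated -1]) (simp_all add: chart(3)[OF U(1)])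
  then show "isCont (inv e) x"
    using U chart(1)[OF U(1)] continuous_on_eq_continuous_at by blast
qed

lemma open_e_vimage: "open U \<Longrightarrow> open (e -` U)"
  using continuous_open_vimage[of U e] e_continuous by (simp add: continuous_on_eq_continuous_at)

lemma smooth_fun_e:
  fixes f :: "'g \<Rightarrow> 'b::real_normed_vector"
  assumes "smooth_fun \<A> f"
  shows "smooth_on UNIV (\<lambda>X. f (e X))"
proof (rule smooth_on_local)
  fix X
  obtain U \<phi> where U: "(U, \<phi>) \<in> \<A>" "e X \<in> U" using chart_exists by blast
  have o: "open (e -` U)" by (rule open_e_vimage[OF chart(1)[OF U(1)]])
  have "smooth_on (\<phi> ` U) (f \<circ> inv_into U \<phi>)" using assms U(1) by (auto simp: smooth_fun_def)
  from smooth_on_compose[OF o chart(6)[OF U(1)] this]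
  have "smooth_on (e -` U) (\<lambda>X. (f \<circ> inv_into U \<phi>) ((\<phi> \<circ> e) X))" by auto
  then have "smooth_on (e -` U) (\<lambda>X. f (e X))"
    by (rule smooth_on_cong[OF o, rotated]) (simp add: chart(3)[OF U(1)])
  then show "\<exists>T. open T \<and> X \<in> T \<and> smooth_on T (\<lambda>X. f (e X))"
    using o U(2) by blast
qed

lemma smooth_fun_inv_e:
  assumes "smooth_on UNIV F"
  shows "smooth_fun \<A> (\<lambda>x. F (inv e x))"
  unfolding smooth_fun_def
proof clarify
  fix U \<phi> assume U: "(U, \<phi>) \<in> \<A>"
  from smooth_on_compose[OF chart(4,5)[OF U] assms]
  show "smooth_on (\<phi> ` U) ((\<lambda>x. F (inv e x)) \<circ> inv_into U \<phi>)" by (simp add: o_def)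
qed

definition mult :: "'a \<Rightarrow> 'a \<Rightarrow> 'a" where
  "mult X Y = inv e (e X + e Y)"

text \<open>Near a given pair the product is factored through charts around the two factors and
  around their product; \<open>inv e\<close> then leads from the last chart back to the Lie
  algebra.\<close>

lemma smooth_mult: "smooth_on UNIV (\<lambda>(X, Y). mult X Y)"
proof (rule smooth_on_local)
  fix z :: "'a \<times> 'a"
  obtain X Y where z: "z = (X, Y)" by (cases z)
  obtain U \<phi> where U: "(U, \<phi>) \<in> \<A>" "e X \<in> U" using chart_exists by blast
  obtain V \<psi> where V: "(V, \<psi>) \<in> \<A>" "e Y \<in> V" using chart_exists by blast
  obtain W \<theta> where W: "(W, \<theta>) \<in> \<A>" "e X + e Y \<in> W" using chart_exists by blast
  define O' where "O' = fst -` (e -` U) \<inter> snd -` (e -` V) \<inter> (\<lambda>z. e (fst z) + e (snd z)) -` W"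
  have c: "continuous_on UNIV (\<lambda>z. e (fst z) + e (snd z))"
    by (intro continuous_on_add continuous_on_compose2[OF e_continuous] continuous_on_fst
        continuous_on_snd continuous_on_id) auto
  have "open O'"
    unfolding O'_def using open_vimage[OF chart(1)[OF W(1)] c]
    by (intro open_Int open_vimage_fst open_vimage_snd open_e_vimage chart(1)[OF U(1)] chart(1)[OF V(1)])
  define S where "S = {(\<phi> x, \<psi> y) | x y. x \<in> U \<and> y \<in> V \<and> x + y \<in> W}"
  have \<mu>: "smooth_on S (\<lambda>(a, b). \<theta> (inv_into U \<phi> a + inv_into V \<psi> b))"
    using lie U(1) V(1) W(1) unfolding lie_group_def S_def by fastforce
  have 1: "smooth_on O' (\<lambda>z. ((\<phi> \<circ> e) (fst z), (\<psi> \<circ> e) (snd z)))"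
    by (intro smooth_on_Pair \<open>open O'\<close> smooth_on_compose[OF _ _ chart(6)[OF U(1)]]
        smooth_on_compose[OF _ _ chart(6)[OF V(1)]] smooth_on_bounded_linear bounded_linear_fst bounded_linear_snd)
      (auto simp: O'_def)
  have "smooth_on O' (\<lambda>z. (\<lambda>(a, b). \<theta> (inv_into U \<phi> a + inv_into V \<psi> b)) ((\<phi> \<circ> e) (fst z), (\<psi> \<circ> e) (snd z)))"
    by (rule smooth_on_compose[OF \<open>open O'\<close> 1 \<mu>]) (auto simp: O'_def S_def)
  then have 2: "smooth_on O' (\<lambda>z. \<theta> (e (fst z) + e (snd z)))"
    by (rule smooth_on_cong[OF \<open>open O'\<close>, rotated])
      (auto simp: O'_def chart(3)[OF U(1)] chart(3)[OF V(1)])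
  have "smooth_on O' (\<lambda>z. (inv e \<circ> inv_into W \<theta>) (\<theta> (e (fst z) + e (snd z))))"
    by (rule smooth_on_compose[OF \<open>open O'\<close> 2 chart(5)[OF W(1)]]) (auto simp: O'_def)
  then have "smooth_on O' (\<lambda>(X, Y). mult X Y)"
    by (rule smooth_on_cong[OF \<open>open O'\<close>, rotated]) (auto simp: O'_def mult_def chart(3)[OF W(1)])
  moreover have "z \<in> O'" using U V W by (simp add: O'_def z)
  ultimately show "\<exists>T. open T \<and> z \<in> T \<and> smooth_on T (\<lambda>(X, Y). mult X Y)"
    using \<open>open O'\<close> by blast
qed

sublocale exp_coordinates mult
proof
  show "mult (mult x y) z = mult x (mult y z)" for x y z
    by (simp add: mult_def e_bij add.assoc)
  show "mult (s *\<^sub>R x) (t *\<^sub>R x) = (s + t) *\<^sub>R x" for s t x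
    by (simp add: mult_def e_bij flip: e_add)
qed (rule smooth_mult)

lemma Ad_eq: "Ad e (e X) Y = adj X Y"
proof -
  have "(\<lambda>t. inv e (e X + e (t *\<^sub>R Y) - e X)) = (\<lambda>t. inner_aut X (t *\<^sub>R Y))"
    by (simp add: inner_aut_def mult_def e_bij e_minus)
  moreover have "((\<lambda>t. inner_aut X (t *\<^sub>R Y)) has_vector_derivative adj X Y) (at 0)"
  proof -
    have "((\<lambda>t::real. t *\<^sub>R Y) has_derivative (\<lambda>h. h *\<^sub>R Y)) (at 0)"
      by (auto intro!: derivative_eq_intros)
    moreover have "(inner_aut X has_derivative adj X) (at (0 *\<^sub>R Y))"
      by (simp add: inner_aut_has_derivative)
    ultimately have "((\<lambda>t. inner_aut X (t *\<^sub>R Y)) has_derivative (\<lambda>h. adj X (h *\<^sub>R Y))) (at 0)"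
      by (rule has_derivative_compose)
    then show ?thesis by (simp add: has_vector_derivative_def linear_scale[OF linear_adj])
  qed
  ultimately show ?thesis by (simp add: Ad_def vector_derivative_at)
qed

lemma lie_bracket_eq: "lie_bracket e X Y = bracket X Y"
  by (simp add: lie_bracket_def bracket_def Ad_eq)

end

section \<open>Dilations and Haar measure in diagonal coordinates\<close>

locale homogeneous_coordinates = exp_group \<A> e
  for \<A> :: "('g::{topological_group_add, t2_space, second_countable_topology}, 'a::euclidean_space) atlas"
    and e :: "'a \<Rightarrow> 'g" +
  fixes A P P' :: "'a \<Rightarrow> 'a" and c :: "'a \<Rightarrow> real"
  assumes dilation_hom: "0 < r \<Longrightarrow> linear (dilation A r)"
      "0 < r \<Longrightarrow> dilation A r (lie_bracket e X Y) = lie_bracket e (dilation A r X) (dilation A r Y)"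
    and linear_A: "linear A" and linear_P: "linear P" "linear P'"
    and P_inverse: "P' (P x) = x" "P (P' x) = x"
    and c_pos: "b \<in> Basis \<Longrightarrow> 0 < c b"
    and eigenbasis: "b \<in> Basis \<Longrightarrow> A (P b) = c b *\<^sub>R P b"
begin

text \<open>Both sides are linear, so the exponential series only has to be summed on
  eigenvectors.\<close>

lemma dilation_P:
  assumes "0 < r"
  shows "dilation A r (P x) = P (diag_dilation c r x)"
proof -
  have "dilation A r \<circ> P = P \<circ> diag_dilation c r"
  proof (rule linear_eq_stdbasis)
    fix b :: 'a assume b: "b \<in> Basis"
    then have "diag_dilation c r b = r powr c b *\<^sub>R b"
      unfolding diag_dilation_def by (rule diagonal_Basis)
    then show "(dilation A r \<circ> P) b = (P \<circ> diag_dilation c r) b"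
      using exp_series_eigenvector[OF linear_A eigenbasis[OF b] assms]
      by (simp add: linear_scale[OF linear_P(1)])
  qed (intro linear_compose linear_P linear_diag_dilation dilation_hom(1) assms)+
  then show ?thesis by (metis comp_apply)
qed

lemma homogeneous_dimension_eq: "homogeneous_dimension A = (\<Sum>b\<in>Basis. c b)"
  unfolding homogeneous_dimension_def
  by (rule edet_eigenbasis(2)[OF linear_A linear_P P_inverse eigenbasis])

lemma group_dilation_eq: "0 < r \<Longrightarrow> group_dilation e A r (e (P x)) = e (P (diag_dilation c r x))"
  by (simp add: group_dilation_def e_bij dilation_P)

lemma bounded_linear_P: "bounded_linear P" "bounded_linear P'"
  using linear_P by (simp_all add: linear_conv_bounded_linear)

lemma dilation_tendsto_0: "(\<lambda>k. dilation A (1 / real (Suc k)) x) \<longlonglongrightarrow> 0"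
proof -
  have "(\<lambda>k. 1 / real (Suc k)) \<longlonglongrightarrow> 0" by (rule LIMSEQ_Suc) (rule lim_1_over_n)
  then have "(\<lambda>k. (1 / real (Suc k)) powr c b) \<longlonglongrightarrow> 0" if "b \<in> Basis" for b
    using c_pos[OF that] by (intro tendsto_zero_powrI[where b = "c b"] tendsto_const) auto
  then have "(\<lambda>k. diag_dilation c (1 / real (Suc k)) (P' x)) \<longlonglongrightarrow> (\<Sum>b\<in>Basis. (0 * (P' x \<bullet> b)) *\<^sub>R b)"
    unfolding diag_dilation_def by (intro tendsto_sum tendsto_scaleR tendsto_mult tendsto_const) auto
  from bounded_linear.tendsto[OF bounded_linear_P(1) this]
  show ?thesis using dilation_P[of "1 / real (Suc _)" "P' x"] by (simp add: P_inverse linear_0[OF linear_P(1)])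
qed

sublocale contractible_exp_coordinates mult "\<lambda>k. dilation A (1 / real (Suc k))" "\<lambda>k. dilation A (real (Suc k))"
proof (intro contractible_exp_coordinates.intro contractible_exp_coordinates_axioms.intro exp_coordinates_axioms)
  fix k x y
  have "dilation A (real (Suc k)) (dilation A (1 / real (Suc k)) (P (P' x))) = P (P' x)"
    by (simp add: dilation_P diag_dilation_compose del: of_nat_Suc)
  then show "dilation A (real (Suc k)) (dilation A (1 / real (Suc k)) x) = x" by (simp only: P_inverse)
  show "dilation A (1 / real (Suc k)) (bracket x y) =
      bracket (dilation A (1 / real (Suc k)) x) (dilation A (1 / real (Suc k)) y)"
    using dilation_hom(2)[of "1 / real (Suc k)"] by (simp add: lie_bracket_eq del: of_nat_Suc)
qed (simp_all add: dilation_hom(1) dilation_tendsto_0 del: of_nat_Suc)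

text \<open>Transported by \<open>inv e\<close>, the Haar measure is left invariant for
  \<open>mult\<close>, hence a multiple of Lebesgue measure. The linear change of coordinates
  \<open>P\<close> only alters the constant.\<close>

lemma haar_measure_coordinates:
  assumes \<mu>: "haar_measure \<mu>"
  obtains \<kappa> :: real where "0 < \<kappa>"
    "\<And>h. (\<lambda>x. h (e (P x))) \<in> borel_measurable borel \<Longrightarrow>
      (\<integral>\<^sup>+x. h x \<partial>\<mu>) = ennreal \<kappa> * (\<integral>\<^sup>+x. h (e (P x)) \<partial>lborel)"
proof -
  have sets [measurable_cong]: "sets \<mu> = sets borel" using \<mu> by (simp add: haar_measure_def)
  have space: "space \<mu> = UNIV" using sets_eq_imp_space_eq[OF sets] by simp
  have e [measurable]: "e \<in> borel_measurable borel" "inv e \<in> borel_measurable borel"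
    by (intro borel_measurable_continuous_onI e_continuous inv_e_continuous)+
  have P [measurable]: "P \<in> borel_measurable borel" "P' \<in> borel_measurable borel"
    using bounded_linear_P by (auto intro: borel_measurable_continuous_onI linear_continuous_on)
  define \<nu> where "\<nu> = distr \<mu> borel (inv e)"
  have \<nu>_int: "(\<integral>\<^sup>+x. F x \<partial>\<nu>) = (\<integral>\<^sup>+y. F (inv e y) \<partial>\<mu>)" if "F \<in> borel_measurable borel" for F
    unfolding \<nu>_def using that by (simp add: nn_integral_distr)
  obtain \<kappa> :: real where \<kappa>: "0 < \<kappa>"
    "\<And>F. F \<in> borel_measurable borel \<Longrightarrow> (\<integral>\<^sup>+x. F x \<partial>\<nu>) = ennreal \<kappa> * (\<integral>\<^sup>+x. F x \<partial>lborel)"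
  proof (rule left_invariant_eq_lborel)
    show "sets \<nu> = sets borel" by (simp add: \<nu>_def)
  next
    fix a and F :: "'a \<Rightarrow> ennreal" assume F [measurable]: "F \<in> borel_measurable borel"
    have "mult a \<in> borel_measurable borel" using continuous_m(1) by (rule borel_measurable_continuous_onI)
    then have "(\<integral>\<^sup>+x. F (mult a x) \<partial>\<nu>) = (\<integral>\<^sup>+y. F (mult a (inv e y)) \<partial>\<mu>)"
      by (intro \<nu>_int measurable_compose[OF _ F])
    also have "\<dots> = (\<integral>\<^sup>+y. F (inv e (e a + y)) \<partial>\<mu>)"
      by (simp add: mult_def e_bij)
    also have "\<dots> = (\<integral>\<^sup>+y. F (inv e y) \<partial>distr \<mu> borel (\<lambda>y. e a + y))"
    proof (rule nn_integral_distr[symmetric])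
      have "(\<lambda>y. e a + y) \<in> borel_measurable borel"
        by (intro borel_measurable_continuous_onI continuous_intros)
      then show "(\<lambda>y. e a + y) \<in> \<mu> \<rightarrow>\<^sub>M borel" by measurable
    qed measurable
    also have "distr \<mu> borel (\<lambda>y. e a + y) = \<mu>" using \<mu> by (simp add: haar_measure_def)
    finally show "(\<integral>\<^sup>+x. F (mult a x) \<partial>\<nu>) = (\<integral>\<^sup>+x. F x \<partial>\<nu>)" by (simp add: \<nu>_int)
  next
    fix r
    have "inv e -` cball 0 r = e ` cball 0 r"
      by (auto simp: e_bij intro!: image_eqI[of _ e "inv e _"])
    then have "emeasure \<nu> (cball 0 r) = emeasure \<mu> (e ` cball 0 r)"
      by (simp add: \<nu>_def emeasure_distr space)
    also have "\<dots> < \<infinity>"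
      using \<mu> compact_continuous_image[OF continuous_on_subset[OF e_continuous] compact_cball]
      by (simp add: haar_measure_def)
    finally show "emeasure \<nu> (cball 0 r) < \<infinity>" .
  next
    show "emeasure \<nu> UNIV \<noteq> 0"
      using \<mu> by (simp add: \<nu>_def emeasure_distr space haar_measure_def)
  qed (rule that)
  have dP: "edet P' * edet P = 1"
  proof -
    have "P' \<circ> P = (\<lambda>x. x)" by (auto simp: P_inverse)
    then show ?thesis using edet_compose[OF linear_P(2,1)] edet_id by metis
  qed
  define d where "d = \<bar>edet P'\<bar>"
  have d: "0 < d" using dP by (auto simp: d_def)
  have main: "(\<integral>\<^sup>+x. h x \<partial>\<mu>) = ennreal (\<kappa> / d) * (\<integral>\<^sup>+x. h (e (P x)) \<partial>lborel)"
    if h: "(\<lambda>x. h (e (P x))) \<in> borel_measurable borel" for h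
  proof -
    have he: "(\<lambda>x. h (e x)) \<in> borel_measurable borel"
      using measurable_compose[OF P(2) h] by (simp add: P_inverse)
    have "(\<integral>\<^sup>+x. h (e (P x)) \<partial>lborel) = ennreal d * (\<integral>\<^sup>+x. h (e x) \<partial>lborel)"
      using nn_integral_lborel_const_det[where f = P' and f' = "\<lambda>_. P'" and h = P and d = d, OF _ _ _ _ P(1) d he]
        bounded_linear_imp_has_derivative[OF bounded_linear_P(2)]
      by (simp add: d_def P_inverse)
    moreover have "(\<integral>\<^sup>+x. h x \<partial>\<mu>) = ennreal \<kappa> * (\<integral>\<^sup>+x. h (e x) \<partial>lborel)"
      using \<nu>_int[OF he] \<kappa>(2)[OF he] by (simp add: e_bij)
    ultimately show ?thesis
      using d \<kappa>(1) by (simp add: mult.assoc[symmetric] ennreal_mult[symmetric])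
  qed
  show ?thesis by (rule that[of "\<kappa> / d"]) (use d \<kappa>(1) main in auto)
qed

lemma smooth_e_P: "smooth_fun \<A> f \<Longrightarrow> smooth_on UNIV (\<lambda>x. f (e (P x)))"
  using smooth_on_compose[OF open_UNIV smooth_on_bounded_linear[OF open_UNIV bounded_linear_P(1)] smooth_fun_e]
  by simp

lemma test_function_coordinates:
  assumes F: "smooth_on UNIV F" "compact (closure {x. F x \<noteq> 0})" "0 \<notin> closure {x. F x \<noteq> 0}"
  shows "test_function_off_0 \<A> (\<lambda>x. F (P' (inv e x)))"
  unfolding test_function_off_0_def
proof (intro conjI)
  have "smooth_on UNIV (\<lambda>X. F (P' X))"
    using smooth_on_compose[OF open_UNIV smooth_on_bounded_linear[OF open_UNIV bounded_linear_P(2)] F(1)] by simp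
  then show "smooth_fun \<A> (\<lambda>x. F (P' (inv e x)))" by (rule smooth_fun_inv_e)
  let ?S = "{x. F (P' (inv e x)) \<noteq> 0}" and ?K = "(\<lambda>x. e (P x)) ` closure {x. F x \<noteq> 0}"
  have "continuous_on UNIV (\<lambda>x. e (P x))"
    by (rule continuous_on_compose2[OF e_continuous linear_continuous_on[OF bounded_linear_P(1)]]) simp
  then have K: "compact ?K"
    by (intro compact_continuous_image F(2)) (rule continuous_on_subset, auto)
  have "?S \<subseteq> ?K"
  proof
    fix x assume "x \<in> ?S"
    then show "x \<in> ?K"
      by (intro image_eqI[of _ _ "P' (inv e x)"]) (auto simp: P_inverse e_bij intro: closure_subset[THEN subsetD])
  qed
  then have S: "closure ?S \<subseteq> ?K" using compact_imp_closed[OF K] by (rule closure_minimal)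
  then have "closure ?S = ?K \<inter> closure ?S" by blast
  then show "compact (closure ?S)" using compact_Int_closed[OF K closed_closure] by metis
  have "x = 0" if "e (P x) = 0" for x
  proof -
    have "e (P x) = e (P 0)" using that by (simp add: e_zero linear_0[OF linear_P(1)])
    then show ?thesis by (metis e_bij(1) P_inverse(1))
  qed
  then have "0 \<notin> ?K" using F(3) by force
  then show "0 \<notin> closure ?S" using S by blast
qed

end

text \<open>Raising to the power \<open>p\<close>, with infinite integrals allowed. When
  \<open>C = 0\<close> and the right integral is infinite, both right sides are \<open>0\<close>
  because \<open>0 * \<infinity> = 0\<close>.\<close>

lemma Lp_norm_le_iff:
  assumes p: "0 < p" and C: "0 \<le> C"
  shows "Lp_norm \<mu> p u \<le> ennreal C * Lp_norm \<mu> p v \<longleftrightarrow>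
    (\<integral>\<^sup>+x. ennreal (norm (u x) powr p) \<partial>\<mu>) \<le> ennreal (C powr p) * (\<integral>\<^sup>+x. ennreal (norm (v x) powr p) \<partial>\<mu>)"
proof -
  define rt where "rt I = (if I = \<infinity> then \<infinity> else ennreal (enn2real I powr (1 / p)))" for I
  have "rt I \<le> ennreal C * rt J \<longleftrightarrow> I \<le> ennreal (C powr p) * J" for I J
  proof (cases J rule: ennreal_cases)
    case (real b)
    show ?thesis
    proof (cases I rule: ennreal_cases)
      case (real a)
      have "rt I \<le> ennreal C * rt J \<longleftrightarrow> a powr (1 / p) \<le> C * b powr (1 / p)"
        using \<open>I = ennreal a\<close> \<open>J = ennreal b\<close> \<open>0 \<le> a\<close> \<open>0 \<le> b\<close> C
        by (simp add: rt_def ennreal_mult[symmetric])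
      also have "\<dots> \<longleftrightarrow> (a powr (1 / p)) powr p \<le> (C * b powr (1 / p)) powr p"
        using powr_mono2[of p "a powr (1 / p)" "C * b powr (1 / p)"]
          powr_less_mono2[of p "C * b powr (1 / p)" "a powr (1 / p)"] p C
        by (cases "a powr (1 / p) \<le> C * b powr (1 / p)") auto
      also have "\<dots> \<longleftrightarrow> a \<le> C powr p * b"
        using p C \<open>0 \<le> a\<close> \<open>0 \<le> b\<close> by (simp add: powr_powr powr_mult)
      also have "\<dots> \<longleftrightarrow> I \<le> ennreal (C powr p) * J"
        using \<open>I = ennreal a\<close> \<open>J = ennreal b\<close> \<open>0 \<le> a\<close> \<open>0 \<le> b\<close>
        by (simp add: ennreal_mult[symmetric])
      finally show ?thesis .
    next
      case top
      then show ?thesis using \<open>J = ennreal b\<close>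
        by (simp add: rt_def ennreal_mult_eq_top_iff top_unique)
    qed
  next
    case top
    show ?thesis
    proof (cases "C = 0")
      case True
      then show ?thesis using p
        by (cases I rule: ennreal_cases) (auto simp: rt_def ennreal_eq_0_iff)
    next
      case False
      then show ?thesis using top C by (simp add: rt_def ennreal_mult_top)
    qed
  qed
  then show ?thesis unfolding Lp_norm_def Let_def rt_def by blast
qed

theorem theorem3p1:
  fixes \<A> :: "('g::{topological_group_add, t2_space, second_countable_topology}, 'a::euclidean_space) atlas"
    and e :: "'a \<Rightarrow> 'g" and A :: "'a \<Rightarrow> 'a" and N :: "'g \<Rightarrow> real" and \<mu> :: "'g measure" and p :: real
  assumes "homogeneous_group \<A> e A"
    and "homogeneous_dimension A \<ge> 2"
    and "homogeneous_quasi_norm e A N"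
    and "haar_measure \<mu>"
    and "1 < p"
  shows "(\<forall>f. test_function_off_0 \<A> f \<longrightarrow>
            hardy_lhs e A N \<mu> p f \<le> ennreal (p / (p - 1)) * hardy_rhs e A N \<mu> p f) \<and>
         (\<forall>C::real. (\<forall>f. test_function_off_0 \<A> f \<longrightarrow>
            hardy_lhs e A N \<mu> p f \<le> ennreal C * hardy_rhs e A N \<mu> p f) \<longrightarrow> p / (p - 1) \<le> C)"
proof -
  have G: "lie_group \<A>" "global_exp \<A> e" "diagonalisable_pos A" "linear A"
    "\<And>r. 0 < r \<Longrightarrow> linear (dilation A r)"
    "\<And>r X Y. 0 < r \<Longrightarrow> dilation A r (lie_bracket e X Y) = lie_bracket e (dilation A r X) (dilation A r Y)"
    using assms(1) by (auto simp: homogeneous_group_def diagonalisable_pos_def)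
  obtain P P' :: "'a \<Rightarrow> 'a" and c where P: "linear P" "linear P'" "\<And>x. P' (P x) = x" "\<And>x. P (P' x) = x"
    "\<And>b. b \<in> Basis \<Longrightarrow> 0 < c b" "\<And>b. b \<in> Basis \<Longrightarrow> A (P b) = c b *\<^sub>R P b"
    using diagonalisable_pos_coordinates[OF G(3)] by blast
  interpret H: homogeneous_coordinates \<A> e A P P' c
    by (intro homogeneous_coordinates.intro exp_group.intro homogeneous_coordinates_axioms.intro) (fact G P)+
  have N: "continuous_on UNIV N" "\<And>x. 0 \<le> N x" "\<And>x r. 0 < r \<Longrightarrow> N (group_dilation e A r x) = r * N x"
    "\<And>x. N x = 0 \<longleftrightarrow> x = 0"
    using assms(3) by (auto simp: homogeneous_quasi_norm_def)
  define n where "n x = N (e (P x))" for x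
  interpret D: diagonal_dilation c n
  proof
    show "continuous_on UNIV n"
      unfolding n_def
      by (intro continuous_on_compose2[OF N(1)] continuous_on_compose2[OF H.e_continuous]
          linear_continuous_on H.bounded_linear_P) auto
    show "n (diag_dilation c r x) = r * n x" if "0 < r" for r x
      unfolding n_def using N(3)[OF that] H.group_dilation_eq[OF that] by metis
    show "n x = 0 \<longleftrightarrow> x = 0" for x
      unfolding n_def N(4) by (metis H.e_bij(1) H.e_zero P(1,3) linear_0)
  qed (use P(5) N(2) in \<open>auto simp: n_def\<close>)
  have Q: "homogeneous_dimension A = D.Q"
    by (simp add: H.homogeneous_dimension_eq D.Q_def)
  obtain \<kappa> where \<kappa>: "0 < \<kappa>"
    "\<And>h. (\<lambda>x. h (e (P x))) \<in> borel_measurable borel \<Longrightarrow>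
      (\<integral>\<^sup>+x. h x \<partial>\<mu>) = ennreal \<kappa> * (\<integral>\<^sup>+x. h (e (P x)) \<partial>lborel)"
    using H.haar_measure_coordinates[OF assms(4)] by blast
  define q where "q = p / (p - 1)"
  have q1: "1 < q" using assms(5) unfolding q_def by (simp add: less_divide_eq)
  define lhs where "lhs R f x = (f x - sphere_value e A N R f x) /
      of_real (N x powr (homogeneous_dimension A / p) * ln (R / N x))" for R f x
  define rhs where "rhs f x = of_real (1 / N x powr (homogeneous_dimension A / p - 1)) *
      radial_derivative e A N f x" for f x
  have lhs_int: "(\<integral>\<^sup>+x. ennreal (norm (lhs R f x) powr p) \<partial>\<mu>) = ennreal \<kappa> *
      (\<integral>\<^sup>+x. ennreal (D.lhs_density p R (\<lambda>x. f (e (P x))) x) * ennreal (n x powr - D.Q) \<partial>lborel)"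
    if f: "smooth_on UNIV (\<lambda>x. f (e (P x)))" and R: "0 < R" for f R
  proof -
    note [measurable] = D.smooth_on_UNIV_measurable[OF f]
    \<comment> \<open>This holds at the origin as well, where both sides are \<open>0\<close> by the
      conventions for \<open>powr\<close> and division; no null set has to be removed.\<close>
    have eq: "ennreal (norm (lhs R f (e (P x))) powr p) =
        ennreal (D.lhs_density p R (\<lambda>x. f (e (P x))) x) * ennreal (n x powr - D.Q)" for x
    proof (cases "x = 0")
      case True
      then have "N (e (P x)) = 0" using D.n_eq_0[of x] by (simp add: n_def)
      then show ?thesis by (simp add: lhs_def n_def)
    next
      case False
      then have "sphere_value e A N R f (e (P x)) = f (e (P (diag_dilation c (R / n x) x)))"
        using R D.n_pos[OF False] by (simp add: sphere_value_def H.group_dilation_eq n_def)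
      then show ?thesis
        using D.lhs_density_eq[OF assms(5), of "\<lambda>x. f (e (P x))" x R] by (simp only: lhs_def n_def Q)
    qed
    \<comment> \<open>Besides rewriting the integrand, \<open>eq\<close> yields the measurability
      that the formula for the Haar integral requires.\<close>
    show ?thesis
      unfolding eq[symmetric] by (rule \<kappa>(2)) (simp add: eq)
  qed
  have rhs_int: "(\<integral>\<^sup>+x. ennreal (norm (rhs f x) powr p) \<partial>\<mu>) = ennreal \<kappa> *
      (\<integral>\<^sup>+x. ennreal (norm (D.flow_deriv (\<lambda>x. f (e (P x))) x) powr p) * ennreal (n x powr - D.Q) \<partial>lborel)"
    if f: "smooth_on UNIV (\<lambda>x. f (e (P x)))" for f
  proof -
    note [measurable] = borel_measurable_continuous_onI[OF D.flow_deriv_continuous[OF f]]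
    have eq: "ennreal (norm (rhs f (e (P x))) powr p) =
        ennreal (norm (D.flow_deriv (\<lambda>x. f (e (P x))) x) powr p) * ennreal (n x powr - D.Q)" for x
    proof (cases "x = 0")
      case True
      then have "N (e (P x)) = 0" using D.n_eq_0[of x] by (simp add: n_def)
      then show ?thesis by (simp add: rhs_def n_def)
    next
      case False
      note n = D.n_pos[OF False]
      let ?d = "D.flow_deriv (\<lambda>x. f (e (P x))) x"
      have "radial_derivative e A N f (e (P x)) = (1 / n x) *\<^sub>R ?d"
        unfolding radial_derivative_def n_def[symmetric]
      proof (rule vector_derivative_at)
        show "((\<lambda>r. f (group_dilation e A r (group_dilation e A (1 / n x) (e (P x))))) has_vector_derivative
            (1 / n x) *\<^sub>R ?d) (at (n x))"
        proof (rule has_vector_derivative_transform_within_open[OF D.radial_has_vector_derivative[OF f False]])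
          show "open {0::real<..}" by simp
          show "n x \<in> {0<..}" using n by simp
          show "f (e (P (diag_dilation c r (diag_dilation c (1 / n x) x)))) =
              f (group_dilation e A r (group_dilation e A (1 / n x) (e (P x))))" if "r \<in> {0<..}" for r
            using that n by (simp add: H.group_dilation_eq)
        qed
      qed
      then show ?thesis
        using D.rhs_density_eq[OF assms(5), of x "\<lambda>x. f (e (P x))"] by (simp only: rhs_def n_def Q)
    qed
    show ?thesis
      unfolding eq[symmetric] by (rule \<kappa>(2)) (simp add: eq)
  qed
  have Lp_iff: "Lp_norm \<mu> p (lhs R f) \<le> ennreal C * Lp_norm \<mu> p (rhs f) \<longleftrightarrow>
      (\<integral>\<^sup>+x. ennreal (D.lhs_density p R (\<lambda>x. f (e (P x))) x) * ennreal (n x powr - D.Q) \<partial>lborel) \<le>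
      ennreal (C powr p) *
      (\<integral>\<^sup>+x. ennreal (norm (D.flow_deriv (\<lambda>x. f (e (P x))) x) powr p) * ennreal (n x powr - D.Q) \<partial>lborel)"
    if "smooth_on UNIV (\<lambda>x. f (e (P x)))" "0 < R" "0 \<le> C" for f R C
  proof -
    have "ennreal \<kappa> * X \<le> ennreal (C powr p) * (ennreal \<kappa> * Y) \<longleftrightarrow> X \<le> ennreal (C powr p) * Y" for X Y
      using \<kappa>(1) by (simp add: mult.left_commute[of _ "ennreal \<kappa>"] ennreal_mult_le_mult_iff)
    then show ?thesis
      using Lp_norm_le_iff[of p C \<mu> "lhs R f" "rhs f"] assms(5) that by (simp add: lhs_int rhs_int)
  qed
  have hardy_lhs: "hardy_lhs e A N \<mu> p f = (SUP R\<in>{0<..}. Lp_norm \<mu> p (lhs R f))" for f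
    by (simp add: hardy_lhs_def lhs_def[abs_def])
  have hardy_rhs: "hardy_rhs e A N \<mu> p f = Lp_norm \<mu> p (rhs f)" for f
    by (simp add: hardy_rhs_def rhs_def[abs_def])
  show ?thesis
    unfolding q_def[symmetric] hardy_lhs hardy_rhs
  proof (intro conjI allI impI)
    fix f assume "test_function_off_0 \<A> f"
    then have f: "smooth_on UNIV (\<lambda>x. f (e (P x)))"
      by (intro H.smooth_e_P) (simp add: test_function_off_0_def)
    show "(SUP R\<in>{0<..}. Lp_norm \<mu> p (lhs R f)) \<le> ennreal q * Lp_norm \<mu> p (rhs f)"
    proof (rule SUP_least)
      fix R :: real assume "R \<in> {0<..}"
      then show "Lp_norm \<mu> p (lhs R f) \<le> ennreal q * Lp_norm \<mu> p (rhs f)"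
        using q1 D.hardy_orbits[OF assms(5) q_def _ f] by (subst Lp_iff[OF f]) auto
    qed
  next
    fix C :: real
    assume C: "\<forall>f. test_function_off_0 \<A> f \<longrightarrow>
        (SUP R\<in>{0<..}. Lp_norm \<mu> p (lhs R f)) \<le> ennreal C * Lp_norm \<mu> p (rhs f)"
    \<comment> \<open>\<open>ennreal\<close> sends a negative \<open>C\<close> to \<open>0\<close>,
      so only \<open>max C 0\<close> can be tested; since \<open>q > 1\<close>, the maximum is then
      \<open>C\<close>.\<close>
    have "q \<le> max C 0"
    proof (rule D.hardy_sharp[OF assms(5) q_def])
      fix F :: "'a \<Rightarrow> complex" and R :: real
      assume F: "smooth_on UNIV F" "compact (closure {x. F x \<noteq> 0})" "0 \<notin> closure {x. F x \<noteq> 0}" and R: "0 < R"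
      define f where "f x = F (P' (inv e x))" for x
      have fF: "(\<lambda>x. f (e (P x))) = F" by (simp add: f_def H.e_bij P(3))
      have "Lp_norm \<mu> p (lhs R f) \<le> (SUP R\<in>{0<..}. Lp_norm \<mu> p (lhs R f))"
        using R by (intro SUP_upper) simp
      also have "\<dots> \<le> ennreal C * Lp_norm \<mu> p (rhs f)"
        using C H.test_function_coordinates[OF F] by (simp add: f_def[abs_def])
      also have "ennreal C = ennreal (max C 0)" by (simp add: max_def ennreal_neg)
      finally show "(\<integral>\<^sup>+x. ennreal (D.lhs_density p R F x) * ennreal (n x powr - D.Q) \<partial>lborel) \<le>
          ennreal (max C 0 powr p) *
          (\<integral>\<^sup>+x. ennreal (norm (D.flow_deriv F x) powr p) * ennreal (n x powr - D.Q) \<partial>lborel)"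
        using Lp_iff[of f R "max C 0"] F(1) R unfolding fF by simp
    qed simp
    then show "q \<le> C" using q1 by linarith
  qed
qed

end
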